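(* Let $\mathfrak{a}=a(\dot x,\dot x)=a_{ab}(x)\dot x^a\dot x^b$ for a (pseudo-)Riemannian metric $a$ on a smooth manifold $M$, and let $\beta=\beta(\dot x)=b_a(x)\dot x^a$, where $b_a$ are the components of a $1$-form $b$ on $M$. Write $\dot x_b=a_{bc}(x)\dot x^c$ and let $\nabla$ be the Levi-Civita covariant derivative of $a$. Any $(\alpha,\beta)$-Finsler geometry $(M,L)$, i.e. $L=L(\mathfrak{a},\beta)=\Omega\!\left(\tfrac{\beta^2}{\mathfrak{a}}\right)\mathfrak{a}$, is of Berwald type if and only if there exists a tensor field $T^a{}_{bc}$ on $M$ such that $$\dot x^c\nabla_ab_c=T^b{}_{ac}\dot x^cb_b+T^b{}_{ac}\dot x^c\dot x_b\left(\frac{\Omega}{\Omega'\beta}-\frac{\beta}{\mathfrak{a}}\right),$$ where $\Omega'$ denotes the derivative of $\Omega$ with respect to its argument. A further $\dot\partial_d$ derivative yields the equivalent condition $$\nabla_ab_d=T^b{}_{ad}b_b+\left(T^b{}_{ad}\dot x_b+T^b{}_{ac}\dot x^ca_{db}\right)\left(\frac{\Omega}{\Omega'\beta}-\frac{\beta}{\mathfrak{a}}\right)+T^b{}_{ac}\dot x^c\dot x_b\left[\dot x_d\,\frac{2\beta}{\mathfrak{a}^2}\frac{\Omega\Omega''}{\Omega'^2}-b_d\left(-\frac1{\mathfrak{a}}+\frac{\Omega}{\Omega'\beta^2}+\frac{2\Omega\Omega''}{\Omega'^2\mathfrak{a}}\right)\right].$$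
   Context: Coordinates: local coordinates $x^a$ on the $n$-dimensional smooth manifold $M$ induce coordinates $(x,\dot x)$ on $TM$, where $(x,\dot x)$ denotes the vector $\dot x^a\partial_a|_x$. Write $\partial_a=\partial/\partial x^a$ and $\dot\partial_a=\partial/\partial\dot x^a$ for the coordinate derivatives on $TM$. The summation convention is used. Finsler Lagrangian: a continuous function $L:TM\to\mathbb{R}$ such that (i) $L(x,\lambda\dot x)=\lambda^2L(x,\dot x)$ for all $\lambda>0$; (ii) there is a conic subbundle $\mathcal{A}$ of $TM$ (closed under positive rescaling of $\dot x$), with $TM\setminus\mathcal{A}$ of measure zero, on which $L$ is smooth and the $L$-metric $g^L_{ab}(x,\dot x)=\tfrac12\dot\partial_a\dot\partial_bL(x,\dot x)$ is non-degenerate. No assumption is made on the signature of $g^L$. The inverse of $g^L_{ab}$ is denoted $g^{Lab}$. A Finsler geometry is a pair $(M,L)$ with $L$ a Finsler Lagrangian. $(\alpha,\beta)$-Finsler geometry: a Finsler geometry whose Finsler Lagrangian is constructed from a (pseudo-)Riemannian metric $a$ and a $1$-form $b$ on $M$ through $\mathfrak{a}$ and $\beta$ only, written $L=\Omega(\beta^2/\mathfrak{a})\,\mathfrak{a}$ with $\Omega$ a function of one variable. In the conditions, $\Omega,\Omega',\Omega''$ are evaluated at $\beta^2/\mathfrak{a}$, and $\Omega''$ is the second derivative with respect to the argument. Cartan non-linear connection coefficients on $\mathcal{A}$: $$N^a{}_b(x,\dot x)=\tfrac14\dot\partial_b\Big(g^{Laq}(x,\dot x)\big(\dot x^m\partial_m\dot\partial_qL(x,\dot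 x)-\partial_qL(x,\dot x)\big)\Big).$$ Berwald type: $(M,L)$ is of Berwald type if the Cartan non-linear connection coefficients are linear in $\dot x$, i.e. $N^a{}_b(x,\dot x)=\Xi^a{}_{bc}(x)\dot x^c$ for some functions $\Xi^a{}_{bc}$ of $x$ only.
   Formalization: In the Berwald equivalence T is required symmetric in its lower indices (false otherwise: constant-length b with a metric connection with torsion making b parallel); Ω is smooth, and Ω′ may vanish only on a set of values of β²/𝔞 with empty interior, the conditions being imposed where defined. *)

theory Defs
  imports "HOL-Analysis.Analysis"
begin

primrec Ck_on :: "nat \<Rightarrow> 'a::real_normed_vector set \<Rightarrow> ('a \<Rightarrow> 'b::real_normed_vector) \<Rightarrow> bool" where
  "Ck_on 0 S f \<longleftrightarrow> continuous_on S f"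
| "Ck_on (Suc k) S f \<longleftrightarrow> (\<forall>x\<in>S. f differentiable (at x)) \<and>
     (\<forall>h. Ck_on k S (\<lambda>x. frechet_derivative f (at x) h))"

text \<open>Only meaningful for open \<open>S\<close>, because the derivatives are not taken relative to \<open>S\<close>.\<close>

definition smooth_on :: "'a::real_normed_vector set \<Rightarrow> ('a \<Rightarrow> 'b::real_normed_vector) \<Rightarrow> bool" where
  "smooth_on S f \<longleftrightarrow> (\<forall>k. Ck_on k S f)"

text \<open>The manifold is the whole type \<open>'m\<close>, which is Hausdorff and second countable by its
  type class; its dimension is \<open>CARD('n)\<close>. A chart is a pair of an open domain and a coordinate
  map, whose values outside the domain are irrelevant.\<close>

type_synonym ('m, 'n) chart = "'m set \<times> ('m \<Rightarrow> real ^ 'n)"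

definition chart_dom :: "('m, 'n) chart \<Rightarrow> 'm set" where
  "chart_dom c = fst c"

definition chart_map :: "('m, 'n) chart \<Rightarrow> 'm \<Rightarrow> real ^ 'n" where
  "chart_map c = snd c"

definition chart_img :: "('m, 'n) chart \<Rightarrow> (real ^ 'n) set" where
  "chart_img c = chart_map c ` chart_dom c"

definition chart_inv :: "('m, 'n) chart \<Rightarrow> real ^ 'n \<Rightarrow> 'm" where
  "chart_inv c = inv_into (chart_dom c) (chart_map c)"

definition is_chart :: "('m::topological_space, 'n::finite) chart \<Rightarrow> bool" where
  "is_chart c \<longleftrightarrow> open (chart_dom c) \<and> open (chart_img c) \<and>
     homeomorphism (chart_dom c) (chart_img c) (chart_map c) (chart_inv c)"

definition transition :: "('m, 'n) chart \<Rightarrow> ('m, 'n) chart \<Rightarrow> real ^ 'n \<Rightarrow> real ^ 'n" where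
  "transition c d = chart_map d \<circ> chart_inv c"

definition smooth_atlas :: "('m::topological_space, 'n::finite) chart set \<Rightarrow> bool" where
  "smooth_atlas At \<longleftrightarrow> (\<forall>c\<in>At. is_chart c) \<and> (\<Union>c\<in>At. chart_dom c) = UNIV \<and>
     (\<forall>c\<in>At. \<forall>d\<in>At. smooth_on (chart_map c ` (chart_dom c \<inter> chart_dom d)) (transition c d))"

text \<open>A tangent vector at \<open>p\<close> is the family of its coordinate columns in all charts of the atlas
  around \<open>p\<close>, related by the Jacobians of the chart transitions. Columns for charts that are not in
  the atlas or not around \<open>p\<close> are fixed to be zero, so that equality of families is equality of
  tangent vectors.\<close>

type_synonym ('m, 'n) tvec = "('m, 'n) chart \<Rightarrow> real ^ 'n"

definition tangent_space :: "('m, 'n::finite) chart set \<Rightarrow> 'm \<Rightarrow> ('m, 'n) tvec set" where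
  "tangent_space At p =
     {w. (\<forall>c\<in>At. \<forall>d\<in>At. p \<in> chart_dom c \<and> p \<in> chart_dom d \<longrightarrow>
            w d = frechet_derivative (transition c d) (at (chart_map c p)) (w c)) \<and>
         (\<forall>c. \<not> (c \<in> At \<and> p \<in> chart_dom c) \<longrightarrow> w c = 0)}"

definition tangent_bundle :: "('m, 'n::finite) chart set \<Rightarrow> ('m \<times> ('m, 'n) tvec) set" where
  "tangent_bundle At = (SIGMA p:UNIV. tangent_space At p)"

definition tadd :: "('m, 'n::finite) tvec \<Rightarrow> ('m, 'n) tvec \<Rightarrow> ('m, 'n) tvec" where
  "tadd u w = (\<lambda>c. u c + w c)"

definition tscale :: "real \<Rightarrow> ('m, 'n::finite) tvec \<Rightarrow> ('m, 'n) tvec" where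
  "tscale r w = (\<lambda>c. r *\<^sub>R w c)"

text \<open>The tangent vector with induced coordinates \<open>(x, v)\<close> in the chart \<open>c\<close>: its column in another
  chart is the image of \<open>v\<close> under the Jacobian.\<close>

definition coord_vec ::
  "('m, 'n::finite) chart set \<Rightarrow> ('m, 'n) chart \<Rightarrow> real ^ 'n \<Rightarrow> real ^ 'n \<Rightarrow> 'm \<times> ('m, 'n) tvec" where
  "coord_vec At c x v =
     (chart_inv c x,
      \<lambda>d. if d \<in> At \<and> chart_inv c x \<in> chart_dom d
          then frechet_derivative (transition c d) (at x) v else 0)"

definition coord_basis ::
  "('m, 'n::finite) chart set \<Rightarrow> ('m, 'n) chart \<Rightarrow> real ^ 'n \<Rightarrow> 'n \<Rightarrow> ('m, 'n) tvec" where
  "coord_basis At c x i = snd (coord_vec At c x (axis i 1))"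

definition local_rep ::
  "('m, 'n::finite) chart set \<Rightarrow> ('m, 'n) chart \<Rightarrow> ('m \<times> ('m, 'n) tvec \<Rightarrow> real)
     \<Rightarrow> (real ^ 'n) \<times> (real ^ 'n) \<Rightarrow> real" where
  "local_rep At c F = (\<lambda>(x, v). F (coord_vec At c x v))"

definition local_region ::
  "('m, 'n::finite) chart set \<Rightarrow> ('m, 'n) chart \<Rightarrow> ('m \<times> ('m, 'n) tvec) set
     \<Rightarrow> ((real ^ 'n) \<times> (real ^ 'n)) set" where
  "local_region At c A = {(x, v). x \<in> chart_img c \<and> coord_vec At c x v \<in> A}"

definition pd :: "'n::finite \<Rightarrow> (real ^ 'n \<Rightarrow> real) \<Rightarrow> real ^ 'n \<Rightarrow> real" where
  "pd i f x = frechet_derivative f (at x) (axis i 1)"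

definition pdx :: "'n::finite \<Rightarrow> ((real ^ 'n) \<times> (real ^ 'n) \<Rightarrow> real) \<Rightarrow> (real ^ 'n) \<times> (real ^ 'n) \<Rightarrow> real" where
  "pdx i f z = frechet_derivative f (at z) (axis i 1, 0)"

definition pdv :: "'n::finite \<Rightarrow> ((real ^ 'n) \<times> (real ^ 'n) \<Rightarrow> real) \<Rightarrow> (real ^ 'n) \<times> (real ^ 'n) \<Rightarrow> real" where
  "pdv i f z = frechet_derivative f (at z) (0, axis i 1)"

definition fibre_linear ::
  "('m, 'n::finite) chart set \<Rightarrow> 'm \<Rightarrow> (('m, 'n) tvec \<Rightarrow> real) \<Rightarrow> bool" where
  "fibre_linear At p f \<longleftrightarrow>
     (\<forall>u\<in>tangent_space At p. \<forall>w\<in>tangent_space At p. f (tadd u w) = f u + f w) \<and>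
     (\<forall>r. \<forall>u\<in>tangent_space At p. f (tscale r u) = r * f u)"

definition fibre_endo ::
  "('m, 'n::finite) chart set \<Rightarrow> 'm \<Rightarrow> (('m, 'n) tvec \<Rightarrow> ('m, 'n) tvec) \<Rightarrow> bool" where
  "fibre_endo At p f \<longleftrightarrow>
     (\<forall>u\<in>tangent_space At p. f u \<in> tangent_space At p) \<and>
     (\<forall>u\<in>tangent_space At p. \<forall>w\<in>tangent_space At p. f (tadd u w) = tadd (f u) (f w)) \<and>
     (\<forall>r. \<forall>u\<in>tangent_space At p. f (tscale r u) = tscale r (f u))"

definition form_comp ::
  "('m, 'n::finite) chart set \<Rightarrow> ('m, 'n) chart \<Rightarrow> ('m \<Rightarrow> ('m, 'n) tvec \<Rightarrow> real)
     \<Rightarrow> 'n \<Rightarrow> real ^ 'n \<Rightarrow> real" where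
  "form_comp At c b i x = b (chart_inv c x) (coord_basis At c x i)"

definition one_form ::
  "('m, 'n::finite) chart set \<Rightarrow> ('m \<Rightarrow> ('m, 'n) tvec \<Rightarrow> real) \<Rightarrow> bool" where
  "one_form At b \<longleftrightarrow> (\<forall>p. fibre_linear At p (b p)) \<and>
     (\<forall>c\<in>At. \<forall>i. smooth_on (chart_img c) (form_comp At c b i))"

definition metric_comp ::
  "('m, 'n::finite) chart set \<Rightarrow> ('m, 'n) chart \<Rightarrow> ('m \<Rightarrow> ('m, 'n) tvec \<Rightarrow> ('m, 'n) tvec \<Rightarrow> real)
     \<Rightarrow> 'n \<Rightarrow> 'n \<Rightarrow> real ^ 'n \<Rightarrow> real" where
  "metric_comp At c a i j x = a (chart_inv c x) (coord_basis At c x i) (coord_basis At c x j)"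

definition pseudo_riemannian_metric ::
  "('m, 'n::finite) chart set \<Rightarrow> ('m \<Rightarrow> ('m, 'n) tvec \<Rightarrow> ('m, 'n) tvec \<Rightarrow> real) \<Rightarrow> bool" where
  "pseudo_riemannian_metric At a \<longleftrightarrow>
     (\<forall>p. \<forall>u\<in>tangent_space At p. fibre_linear At p (a p u)) \<and>
     (\<forall>p. \<forall>u\<in>tangent_space At p. \<forall>w\<in>tangent_space At p. a p u w = a p w u) \<and>
     (\<forall>p. \<forall>u\<in>tangent_space At p. (\<forall>w\<in>tangent_space At p. a p u w = 0) \<longrightarrow> u = (\<lambda>c. 0)) \<and>
     (\<forall>c\<in>At. \<forall>i j. smooth_on (chart_img c) (metric_comp At c a i j))"

text \<open>\<open>tensor_comp At c T i j k\<close> is the component with upper index \<open>i\<close> and lower indices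
  \<open>j\<close>, \<open>k\<close> in this order.\<close>

definition tensor_comp ::
  "('m, 'n::finite) chart set \<Rightarrow> ('m, 'n) chart
     \<Rightarrow> ('m \<Rightarrow> ('m, 'n) tvec \<Rightarrow> ('m, 'n) tvec \<Rightarrow> ('m, 'n) tvec)
     \<Rightarrow> 'n \<Rightarrow> 'n \<Rightarrow> 'n \<Rightarrow> real ^ 'n \<Rightarrow> real" where
  "tensor_comp At c T i j k x =
     T (chart_inv c x) (coord_basis At c x j) (coord_basis At c x k) c $ i"

definition tensor12_field ::
  "('m, 'n::finite) chart set \<Rightarrow> ('m \<Rightarrow> ('m, 'n) tvec \<Rightarrow> ('m, 'n) tvec \<Rightarrow> ('m, 'n) tvec) \<Rightarrow> bool" where
  "tensor12_field At T \<longleftrightarrow>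
     (\<forall>p. \<forall>u\<in>tangent_space At p. fibre_endo At p (T p u)) \<and>
     (\<forall>p. \<forall>w\<in>tangent_space At p. fibre_endo At p (\<lambda>u. T p u w)) \<and>
     (\<forall>c\<in>At. \<forall>i j k. smooth_on (chart_img c) (tensor_comp At c T i j k))"

definition symmetric_tensor12 ::
  "('m, 'n::finite) chart set \<Rightarrow> ('m \<Rightarrow> ('m, 'n) tvec \<Rightarrow> ('m, 'n) tvec \<Rightarrow> ('m, 'n) tvec) \<Rightarrow> bool" where
  "symmetric_tensor12 At T \<longleftrightarrow>
     (\<forall>p. \<forall>u\<in>tangent_space At p. \<forall>w\<in>tangent_space At p. T p u w = T p w u)"

definition metric_inv ::
  "('m, 'n::finite) chart set \<Rightarrow> ('m, 'n) chart \<Rightarrow> ('m \<Rightarrow> ('m, 'n) tvec \<Rightarrow> ('m, 'n) tvec \<Rightarrow> real)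
     \<Rightarrow> real ^ 'n \<Rightarrow> real ^ 'n ^ 'n" where
  "metric_inv At c a x = matrix_inv (\<chi> i j. metric_comp At c a i j x)"

definition christoffel ::
  "('m, 'n::finite) chart set \<Rightarrow> ('m, 'n) chart \<Rightarrow> ('m \<Rightarrow> ('m, 'n) tvec \<Rightarrow> ('m, 'n) tvec \<Rightarrow> real)
     \<Rightarrow> 'n \<Rightarrow> 'n \<Rightarrow> 'n \<Rightarrow> real ^ 'n \<Rightarrow> real" where
  "christoffel At c a i j k x =
     (\<Sum>l\<in>UNIV. metric_inv At c a x $ i $ l *
        (pd j (metric_comp At c a l k) x + pd k (metric_comp At c a j l) x
           - pd l (metric_comp At c a j k) x)) / 2"

text \<open>In \<open>nabla_form At c a b i j\<close> the first index \<open>i\<close> is the direction of differentiation and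
  \<open>j\<close> the index of the form.\<close>

definition nabla_form ::
  "('m, 'n::finite) chart set \<Rightarrow> ('m, 'n) chart \<Rightarrow> ('m \<Rightarrow> ('m, 'n) tvec \<Rightarrow> ('m, 'n) tvec \<Rightarrow> real)
     \<Rightarrow> ('m \<Rightarrow> ('m, 'n) tvec \<Rightarrow> real) \<Rightarrow> 'n \<Rightarrow> 'n \<Rightarrow> real ^ 'n \<Rightarrow> real" where
  "nabla_form At c a b i j x =
     pd i (form_comp At c b j) x - (\<Sum>k\<in>UNIV. christoffel At c a k i j x * form_comp At c b k x)"

definition conic_subbundle ::
  "('m, 'n::finite) chart set \<Rightarrow> ('m \<times> ('m, 'n) tvec) set \<Rightarrow> bool" where
  "conic_subbundle At A \<longleftrightarrow> A \<subseteq> tangent_bundle At \<and>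
     (\<forall>c\<in>At. open (local_region At c A)) \<and>
     (\<forall>p. \<exists>w. (p, w) \<in> A) \<and>
     (\<forall>p w. \<forall>r>0. (p, w) \<in> A \<longrightarrow> (p, tscale r w) \<in> A)"

definition L_metric ::
  "('m, 'n::finite) chart set \<Rightarrow> ('m, 'n) chart \<Rightarrow> ('m \<times> ('m, 'n) tvec \<Rightarrow> real)
     \<Rightarrow> (real ^ 'n) \<times> (real ^ 'n) \<Rightarrow> real ^ 'n ^ 'n" where
  "L_metric At c L z = (\<chi> i j. pdv i (pdv j (local_rep At c L)) z / 2)"

definition finsler_lagrangian ::
  "('m, 'n::finite) chart set \<Rightarrow> ('m \<times> ('m, 'n) tvec \<Rightarrow> real) \<Rightarrow> ('m \<times> ('m, 'n) tvec) set \<Rightarrow> bool" where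
  "finsler_lagrangian At L A \<longleftrightarrow>
     (\<forall>c\<in>At. continuous_on (chart_img c \<times> UNIV) (local_rep At c L)) \<and>
     (\<forall>p. \<forall>w\<in>tangent_space At p. \<forall>r>0. L (p, tscale r w) = r\<^sup>2 * L (p, w)) \<and>
     conic_subbundle At A \<and>
     (\<forall>c\<in>At. negligible (local_region At c (tangent_bundle At - A))) \<and>
     (\<forall>c\<in>At. smooth_on (local_region At c A) (local_rep At c L)) \<and>
     (\<forall>c\<in>At. \<forall>z\<in>local_region At c A. invertible (L_metric At c L z))"

definition cartan_connection ::
  "('m, 'n::finite) chart set \<Rightarrow> ('m, 'n) chart \<Rightarrow> ('m \<times> ('m, 'n) tvec \<Rightarrow> real)
     \<Rightarrow> 'n \<Rightarrow> 'n \<Rightarrow> (real ^ 'n) \<times> (real ^ 'n) \<Rightarrow> real" where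
  "cartan_connection At c L i j z =
     pdv j (\<lambda>y. \<Sum>q\<in>UNIV. matrix_inv (L_metric At c L y) $ i $ q *
        ((\<Sum>m\<in>UNIV. snd y $ m * pdx m (pdv q (local_rep At c L)) y)
           - pdx q (local_rep At c L) y)) z / 4"

definition berwald_type ::
  "('m, 'n::finite) chart set \<Rightarrow> ('m \<times> ('m, 'n) tvec \<Rightarrow> real) \<Rightarrow> ('m \<times> ('m, 'n) tvec) set \<Rightarrow> bool" where
  "berwald_type At L A \<longleftrightarrow>
     (\<forall>c\<in>At. \<exists>\<Xi> :: 'n \<Rightarrow> 'n \<Rightarrow> 'n \<Rightarrow> real ^ 'n \<Rightarrow> real. \<forall>(x, v)\<in>local_region At c A. \<forall>i j.
        cartan_connection At c L i j (x, v) = (\<Sum>k\<in>UNIV. \<Xi> i j k x * v $ k))"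

definition quad ::
  "('m \<Rightarrow> ('m, 'n) tvec \<Rightarrow> ('m, 'n) tvec \<Rightarrow> real) \<Rightarrow> 'm \<times> ('m, 'n) tvec \<Rightarrow> real" where
  "quad a X = a (fst X) (snd X) (snd X)"

definition lin :: "('m \<Rightarrow> ('m, 'n) tvec \<Rightarrow> real) \<Rightarrow> 'm \<times> ('m, 'n) tvec \<Rightarrow> real" where
  "lin b X = b (fst X) (snd X)"

definition lower ::
  "('m, 'n::finite) chart set \<Rightarrow> ('m, 'n) chart \<Rightarrow> ('m \<Rightarrow> ('m, 'n) tvec \<Rightarrow> ('m, 'n) tvec \<Rightarrow> real)
     \<Rightarrow> real ^ 'n \<Rightarrow> real ^ 'n \<Rightarrow> 'n \<Rightarrow> real" where
  "lower At c a x v i = (\<Sum>j\<in>UNIV. metric_comp At c a i j x * v $ j)"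

definition alpha_beta_form ::
  "('m, 'n::finite) chart set \<Rightarrow> ('m \<times> ('m, 'n) tvec \<Rightarrow> real)
     \<Rightarrow> ('m \<Rightarrow> ('m, 'n) tvec \<Rightarrow> ('m, 'n) tvec \<Rightarrow> real) \<Rightarrow> ('m \<Rightarrow> ('m, 'n) tvec \<Rightarrow> real)
     \<Rightarrow> (real \<Rightarrow> real) \<Rightarrow> bool" where
  "alpha_beta_form At L a b \<Omega> \<longleftrightarrow>
     (\<forall>X\<in>tangent_bundle At. quad a X \<noteq> 0 \<longrightarrow> L X = \<Omega> ((lin b X)\<^sup>2 / quad a X) * quad a X)"

definition ratio_set ::
  "('m \<times> ('m, 'n) tvec) set \<Rightarrow> ('m \<Rightarrow> ('m, 'n) tvec \<Rightarrow> ('m, 'n) tvec \<Rightarrow> real)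
     \<Rightarrow> ('m \<Rightarrow> ('m, 'n) tvec \<Rightarrow> real) \<Rightarrow> real set" where
  "ratio_set A a b = {(lin b X)\<^sup>2 / quad a X | X. X \<in> A \<and> quad a X \<noteq> 0 \<and> lin b X \<noteq> 0}"

text \<open>The two conditions are imposed exactly where their right-hand sides are defined, i.e. where
  none of the denominators vanishes.\<close>

definition formula_region ::
  "('m \<times> ('m, 'n) tvec) set \<Rightarrow> ('m \<Rightarrow> ('m, 'n) tvec \<Rightarrow> ('m, 'n) tvec \<Rightarrow> real)
     \<Rightarrow> ('m \<Rightarrow> ('m, 'n) tvec \<Rightarrow> real) \<Rightarrow> (real \<Rightarrow> real) \<Rightarrow> ('m \<times> ('m, 'n) tvec) set" where
  "formula_region A a b \<Omega> =
     {X \<in> A. quad a X \<noteq> 0 \<and> lin b X \<noteq> 0 \<and> deriv \<Omega> ((lin b X)\<^sup>2 / quad a X) \<noteq> 0}"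

definition berwald_condition ::
  "('m, 'n::finite) chart set \<Rightarrow> ('m \<times> ('m, 'n) tvec) set
     \<Rightarrow> ('m \<Rightarrow> ('m, 'n) tvec \<Rightarrow> ('m, 'n) tvec \<Rightarrow> real) \<Rightarrow> ('m \<Rightarrow> ('m, 'n) tvec \<Rightarrow> real)
     \<Rightarrow> (real \<Rightarrow> real) \<Rightarrow> ('m \<Rightarrow> ('m, 'n) tvec \<Rightarrow> ('m, 'n) tvec \<Rightarrow> ('m, 'n) tvec) \<Rightarrow> bool" where
  "berwald_condition At A a b \<Omega> T \<longleftrightarrow>
     (\<forall>c\<in>At. \<forall>(x, v)\<in>local_region At c (formula_region A a b \<Omega>). \<forall>i.
        let X = coord_vec At c x v; \<aa> = quad a X; \<beta> = lin b X; s = \<beta>\<^sup>2 / \<aa>;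
            \<Omega>0 = \<Omega> s; \<Omega>1 = deriv \<Omega> s;
            bc = (\<lambda>j. form_comp At c b j x); Tc = (\<lambda>j k l. tensor_comp At c T j k l x);
            xl = lower At c a x v
        in (\<Sum>k\<in>UNIV. v $ k * nabla_form At c a b i k x) =
             (\<Sum>j\<in>UNIV. \<Sum>k\<in>UNIV. Tc j i k * v $ k * bc j)
             + (\<Sum>j\<in>UNIV. \<Sum>k\<in>UNIV. Tc j i k * v $ k * xl j) * (\<Omega>0 / (\<Omega>1 * \<beta>) - \<beta> / \<aa>))"

definition berwald_condition_deriv ::
  "('m, 'n::finite) chart set \<Rightarrow> ('m \<times> ('m, 'n) tvec) set
     \<Rightarrow> ('m \<Rightarrow> ('m, 'n) tvec \<Rightarrow> ('m, 'n) tvec \<Rightarrow> real) \<Rightarrow> ('m \<Rightarrow> ('m, 'n) tvec \<Rightarrow> real)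
     \<Rightarrow> (real \<Rightarrow> real) \<Rightarrow> ('m \<Rightarrow> ('m, 'n) tvec \<Rightarrow> ('m, 'n) tvec \<Rightarrow> ('m, 'n) tvec) \<Rightarrow> bool" where
  "berwald_condition_deriv At A a b \<Omega> T \<longleftrightarrow>
     (\<forall>c\<in>At. \<forall>(x, v)\<in>local_region At c (formula_region A a b \<Omega>). \<forall>i d.
        let X = coord_vec At c x v; \<aa> = quad a X; \<beta> = lin b X; s = \<beta>\<^sup>2 / \<aa>;
            \<Omega>0 = \<Omega> s; \<Omega>1 = deriv \<Omega> s; \<Omega>2 = deriv (deriv \<Omega>) s;
            bc = (\<lambda>j. form_comp At c b j x); Tc = (\<lambda>j k l. tensor_comp At c T j k l x);
            xl = lower At c a x v
        in nabla_form At c a b i d x =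
             (\<Sum>j\<in>UNIV. Tc j i d * bc j)
             + ((\<Sum>j\<in>UNIV. Tc j i d * xl j)
                + (\<Sum>j\<in>UNIV. \<Sum>k\<in>UNIV. Tc j i k * v $ k * metric_comp At c a d j x))
               * (\<Omega>0 / (\<Omega>1 * \<beta>) - \<beta> / \<aa>)
             + (\<Sum>j\<in>UNIV. \<Sum>k\<in>UNIV. Tc j i k * v $ k * xl j)
               * (xl d * (2 * \<beta> / \<aa>\<^sup>2) * (\<Omega>0 * \<Omega>2 / \<Omega>1\<^sup>2)
                  - bc d * (- 1 / \<aa> + \<Omega>0 / (\<Omega>1 * \<beta>\<^sup>2) + 2 * \<Omega>0 * \<Omega>2 / (\<Omega>1\<^sup>2 * \<aa>))))"

end

theory Submission
  imports Defs
begin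

text \<open>Call a symmetric bilinear map \<open>B\<close> parallel for \<open>L\<close> at \<open>x\<close> if \<open>dL\<close> annihilates all
  horizontal lifts \<open>(h, - B h v)\<close> at \<open>(x, v)\<close>. Differentiating this identity in the fibre gives the
  spray equation \<open>v\<^sup>m \<partial>\<^sub>m \<partial>'\<^sub>k L - \<partial>\<^sub>k L = B v v \<cdot> \<partial>' \<partial>'\<^sub>k L\<close>; the converse follows from Euler's theorem on
  homogeneous functions. Hence \<open>(M, L)\<close> is of Berwald type iff a parallel \<open>B\<close> exists at each point, and
  \<open>B\<close> is then unique and transforms as a connection. The Levi-Civita connection is parallel for \<open>\<aa>\<close>, so
  writing \<open>B\<close> as its sum with a tensor \<open>T\<close> turns the parallelism equation for \<open>\<Omega>(\<beta>\<^sup>2 / \<aa>) \<aa>\<close>, multiplied by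
  a nonzero factor, into the stated condition.

  For the converse the identity has to be extended by continuity from the region where the condition
  makes sense. That region is dense over the points where \<open>b \<noteq> 0\<close>, provided the dimension is at least two;
  in dimension one, and near points where \<open>b\<close> vanishes identically, a parallel \<open>B\<close> exists anyway.\<close>

section \<open>Calculus of smooth functions\<close>

text \<open>The bracket in the condition is a quotient of two coefficients. Along the lift
  \<open>(h, - (LC h v + w))\<close> with \<open>w = T h v\<close>, metric compatibility leaves only
  \<open>- 2 a(v, w)\<close> from the derivative of \<alpha>, and the derivative of \<beta> is
  \<open>(nabla b)(h, v) - b(w)\<close>. With s the ratio, the derivative of L becomes \<open>2
  \<beta> \<Omega>' ((nabla b)(h, v) - b(w)) - 2 (\<Omega> - s \<Omega>') a(v, w)\<close>, and
  \<open>(\<Omega> - s \<Omega>') / (\<beta> \<Omega>')\<close> is the bracket. The obstacle is that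
  \<open>berwald_type\<close> offers coefficients with neither regularity nor a transformation law.
  Both come without computation: the coefficients are second fibre derivatives of the spray, hence
  smooth and symmetric, and uniqueness of the parallel map in each chart forces the affine law. The
  same uniqueness, applied to the quadratic form of the metric, yields the law of the Christoffel
  symbols. The differentiated condition gives back the original by contraction with v, since the
  bracket is homogeneous of degree -1.\<close>

abbreviation dd :: "'a::real_normed_vector \<Rightarrow> ('a \<Rightarrow> 'b::real_normed_vector) \<Rightarrow> 'a \<Rightarrow> 'b" where
  "dd h f \<equiv> \<lambda>z. frechet_derivative f (at z) h"

lemma dd_has_derivative: "(f has_derivative f') (at z) \<Longrightarrow> dd h f z = f' h"
  by (metis frechet_derivative_at)

lemma has_derivative_dd: "f differentiable (at z) \<Longrightarrow> (f has_derivative (\<lambda>h. dd h f z)) (at z)"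
  by (simp add: frechet_derivative_works[symmetric])

lemma dd_linear: "f differentiable (at z) \<Longrightarrow> linear (\<lambda>h. dd h f z)"
  using linear_frechet_derivative by auto

text \<open>\<open>frechet_derivative\<close> is a choice from the set of derivatives, and that set
  is local. Equality therefore also holds where nothing is differentiable and the value is an
  arbitrary default.\<close>

lemma dd_cong_open:
  assumes "open S" "z \<in> S" "\<And>y. y \<in> S \<Longrightarrow> f y = g y"
  shows "dd h f z = dd h g z"
proof -
  have "(f has_derivative F) (at z) \<longleftrightarrow> (g has_derivative F) (at z)" for F
    using assms has_derivative_transform_within_open by (metis (no_types, lifting))
  then show ?thesis by (simp add: frechet_derivative_def)
qed

section \<open>Closure properties of finite and infinite differentiability\<close>

lemma Ck_on_cong:
  assumes "open S" "\<And>y. y \<in> S \<Longrightarrow> f y = g y" "Ck_on k S f"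
  shows "Ck_on k S g"
  using assms(2,3)
proof (induction k arbitrary: f g)
  case 0
  then show ?case using continuous_on_cong by (metis Ck_on.simps(1))
next
  case (Suc k)
  have "g differentiable (at x)" if "x \<in> S" for x
    using Suc.prems that assms(1) has_derivative_transform_within_open
    unfolding Ck_on.simps differentiable_def by (metis (no_types, lifting))
  moreover have "Ck_on k S (dd h g)" for h
  proof (rule Suc.IH[of "dd h f"])
    show "dd h f y = dd h g y" if "y \<in> S" for y
      by (rule dd_cong_open[OF assms(1) that Suc.prems(1)])
    show "Ck_on k S (dd h f)" using Suc.prems by auto
  qed
  ultimately show ?case by simp
qed

lemma Ck_on_Suc_imp:
  assumes "Ck_on (Suc k) S f" shows "Ck_on k S f"
  using assms
proof (induction k arbitrary: f)
  case 0
  then show ?case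
    by (auto intro!: continuous_at_imp_continuous_on differentiable_imp_continuous_within)
next
  case (Suc k)
  then show ?case by (metis Ck_on.simps(2))
qed

text \<open>\<open>Ck_on\<close> uses derivatives at points of the whole space, so smoothness glues
  even when the neighbourhoods, and the formulas valid on them, change from point to point.\<close>

lemma Ck_on_local:
  assumes "\<And>x. x \<in> S \<Longrightarrow> \<exists>T. open T \<and> x \<in> T \<and> Ck_on k T f"
  shows "Ck_on k S f"
  using assms
proof (induction k arbitrary: f)
  case 0
  have "continuous (at x) f" if "x \<in> S" for x
    using 0[OF that] continuous_on_eq_continuous_at by auto
  then show ?case by (simp add: continuous_at_imp_continuous_on)
next
  case (Suc k)
  have "Ck_on k S (dd h f)" for h
    by (rule Suc.IH) (metis Suc.prems Ck_on.simps(2))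
  moreover have "f differentiable (at x)" if "x \<in> S" for x
    using Suc.prems[OF that] Ck_on.simps(2) by blast
  ultimately show ?case by simp
qed

lemma Ck_on_const: "Ck_on k S (\<lambda>x. c)"
proof (induction k arbitrary: c)
  case 0
  then show ?case by simp
next
  case (Suc k)
  then show ?case by (simp add: frechet_derivative_const)
qed

lemma Ck_on_bounded_linear_compose:
  assumes "bounded_linear g" "open S" "Ck_on k S f"
  shows "Ck_on k S (\<lambda>x. g (f x))"
  using assms(3)
proof (induction k arbitrary: f)
  case 0
  then show ?case using assms(1) by (auto intro: bounded_linear.continuous_on)
next
  case (Suc k)
  have der: "((\<lambda>x. g (f x)) has_derivative (\<lambda>h. g (dd h f x))) (at x)" if "x \<in> S" for x
    using Suc.prems that
    by (intro bounded_linear.has_derivative[OF assms(1)] has_derivative_dd) auto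
  have "Ck_on k S (dd h (\<lambda>x. g (f x)))" for h
  proof (rule Ck_on_cong[OF assms(2)])
    show "Ck_on k S (\<lambda>x. g (dd h f x))" using Suc by auto
    show "g (dd h f y) = dd h (\<lambda>x. g (f x)) y" if "y \<in> S" for y
      using dd_has_derivative[OF der[OF that], of h] by simp
  qed
  then show ?case using der by (auto simp: differentiable_def)
qed

text \<open>For an affine inner map the derivative is \<open>dd (g h) f\<close> with the same inner
  map, so the induction closes on itself; a general chain rule would bring in products. Restriction
  to slices and projections are the instances used.\<close>

lemma Ck_on_affine_pre:
  assumes "bounded_linear g" "open S" "Ck_on k S f" "open T" "\<And>x. x \<in> T \<Longrightarrow> c + g x \<in> S"
  shows "Ck_on k T (\<lambda>x. f (c + g x))"
  using assms(3)
proof (induction k arbitrary: f)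
  case 0
  show ?case unfolding Ck_on.simps
  proof (rule continuous_on_compose2[of S f])
    show "continuous_on T (\<lambda>x. c + g x)"
      using assms(1) by (intro continuous_on_add continuous_on_const linear_continuous_on)
  qed (use 0 assms in auto)
next
  case (Suc k)
  have der: "((\<lambda>x. f (c + g x)) has_derivative (\<lambda>h. dd (g h) f (c + g x))) (at x)" if "x \<in> T" for x
  proof -
    have "((\<lambda>x. c + g x) has_derivative (\<lambda>h. g h)) (at x)"
      using assms(1) by (auto intro!: derivative_eq_intros bounded_linear_imp_has_derivative)
    moreover have "f differentiable (at (c + g x))"
      using Suc.prems assms(5)[OF that] by auto
    from has_derivative_dd[OF this] have "(f has_derivative (\<lambda>h. dd h f (c + g x))) (at (c + g x))" .
    ultimately show ?thesis by (rule has_derivative_compose)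
  qed
  have "Ck_on k T (dd h (\<lambda>x. f (c + g x)))" for h
  proof (rule Ck_on_cong[OF assms(4)])
    show "Ck_on k T (\<lambda>x. dd (g h) f (c + g x))"
      by (rule Suc.IH) (use Suc.prems in auto)
    show "dd (g h) f (c + g y) = dd h (\<lambda>x. f (c + g x)) y" if "y \<in> T" for y
      using dd_has_derivative[OF der[OF that], of h] by simp
  qed
  then show ?case using der by (auto simp: differentiable_def)
qed

lemma Ck_on_add:
  assumes "open S" "Ck_on k S f" "Ck_on k S g"
  shows "Ck_on k S (\<lambda>x. f x + g x)"
  using assms(2,3)
proof (induction k arbitrary: f g)
  case 0
  then show ?case by (auto intro: continuous_on_add)
next
  case (Suc k)
  have der: "((\<lambda>x. f x + g x) has_derivative (\<lambda>h. dd h f x + dd h g x)) (at x)" if "x \<in> S" for x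
    using Suc.prems that by (intro has_derivative_add has_derivative_dd) auto
  have "Ck_on k S (dd h (\<lambda>x. f x + g x))" for h
  proof (rule Ck_on_cong[OF assms(1)])
    show "Ck_on k S (\<lambda>x. dd h f x + dd h g x)" using Suc by auto
    show "dd h f y + dd h g y = dd h (\<lambda>x. f x + g x) y" if "y \<in> S" for y
      using dd_has_derivative[OF der[OF that], of h] by simp
  qed
  then show ?case using der by (auto simp: differentiable_def)
qed

lemma Ck_on_mult:
  fixes f g :: "'a::real_normed_vector \<Rightarrow> real"
  assumes "open S" "Ck_on k S f" "Ck_on k S g"
  shows "Ck_on k S (\<lambda>x. f x * g x)"
  using assms(2,3)
proof (induction k arbitrary: f g)
  case 0
  then show ?case by (auto intro: continuous_on_mult)
next
  case (Suc k)
  have der: "((\<lambda>x. f x * g x) has_derivative (\<lambda>h. f x * dd h g x + dd h f x * g x)) (at x)" if "x \<in> S" for x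
    using Suc.prems that by (intro has_derivative_mult has_derivative_dd) auto
  have "Ck_on k S (dd h (\<lambda>x. f x * g x))" for h
  proof (rule Ck_on_cong[OF assms(1)])
    \<comment> \<open>The product rule keeps undifferentiated factors, which are known to order
      \<open>Suc k\<close> and are needed to order \<open>k\<close>.\<close>
    show "Ck_on k S (\<lambda>x. f x * dd h g x + dd h f x * g x)"
      using Suc.prems Suc.prems[THEN Ck_on_Suc_imp]
      by (intro Ck_on_add[OF assms(1)] Suc.IH) auto
    show "f y * dd h g y + dd h f y * g y = dd h (\<lambda>x. f x * g x) y" if "y \<in> S" for y
      using dd_has_derivative[OF der[OF that], of h] by simp
  qed
  then show ?case using der by (auto simp: differentiable_def)
qed

text \<open>The derivative of a reciprocal contains the reciprocal itself, whose regularity of order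
  \<open>k\<close> is the induction hypothesis; hence the induction runs with f fixed.\<close>

lemma Ck_on_inverse:
  fixes f :: "'a::real_normed_vector \<Rightarrow> real"
  assumes "open S" "Ck_on k S f" and nz: "\<And>x. x \<in> S \<Longrightarrow> f x \<noteq> 0"
  shows "Ck_on k S (\<lambda>x. inverse (f x))"
  using assms(2)
proof (induction k)
  case 0
  then show ?case using nz by (auto intro: continuous_on_inverse)
next
  case (Suc k)
  have der: "((\<lambda>x. inverse (f x)) has_derivative (\<lambda>h. - (inverse (f x) * dd h f x * inverse (f x)))) (at x)"
    if "x \<in> S" for x
    by (rule Deriv.has_derivative_inverse[where f = f, OF nz[OF that]]) (use Suc.prems that in \<open>auto intro: has_derivative_dd\<close>)
  have "Ck_on k S (dd h (\<lambda>x. inverse (f x)))" for h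
  proof (rule Ck_on_cong[OF assms(1)])
    show "Ck_on k S (\<lambda>x. - (inverse (f x) * dd h f x * inverse (f x)))"
      using Suc.prems Ck_on_Suc_imp[OF Suc.prems]
      by (intro Ck_on_bounded_linear_compose[OF bounded_linear_minus[OF bounded_linear_ident]]
            Ck_on_mult[OF assms(1)] assms(1)) (auto intro: Suc.IH)
    show "- (inverse (f y) * dd h f y * inverse (f y)) = dd h (\<lambda>x. inverse (f x)) y" if "y \<in> S" for y
      using dd_has_derivative[OF der[OF that], of h] by simp
  qed
  then show ?case using der by (auto simp: differentiable_def)
qed

lemma smooth_on_differentiable: "smooth_on S f \<Longrightarrow> z \<in> S \<Longrightarrow> f differentiable (at z)"
  unfolding smooth_on_def using Ck_on.simps(2) by blast

lemma smooth_on_has_derivative: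
  "smooth_on S f \<Longrightarrow> z \<in> S \<Longrightarrow> (f has_derivative (\<lambda>h. dd h f z)) (at z)"
  by (rule has_derivative_dd[OF smooth_on_differentiable])

lemma smooth_on_dd: "smooth_on S f \<Longrightarrow> smooth_on S (dd h f)"
  unfolding smooth_on_def using Ck_on.simps(2) by blast

lemma smooth_on_continuous_on: "smooth_on S f \<Longrightarrow> continuous_on S f"
  unfolding smooth_on_def using Ck_on.simps(1) by blast

lemma smooth_on_cong: "smooth_on S f \<Longrightarrow> open S \<Longrightarrow> (\<And>y. y \<in> S \<Longrightarrow> f y = g y) \<Longrightarrow> smooth_on S g"
  unfolding smooth_on_def using Ck_on_cong by blast

lemma smooth_on_local:
  "(\<And>x. x \<in> S \<Longrightarrow> \<exists>T. open T \<and> x \<in> T \<and> smooth_on T f) \<Longrightarrow> smooth_on S f"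
  unfolding smooth_on_def by (metis Ck_on_local)

lemma smooth_on_const: "smooth_on S (\<lambda>x. c)"
  unfolding smooth_on_def using Ck_on_const by blast

lemma smooth_on_bounded_linear_compose:
  "bounded_linear g \<Longrightarrow> open S \<Longrightarrow> smooth_on S f \<Longrightarrow> smooth_on S (\<lambda>x. g (f x))"
  unfolding smooth_on_def using Ck_on_bounded_linear_compose by blast

lemma smooth_on_affine_pre:
  assumes "bounded_linear g" "open S" "smooth_on S f" "open T" "\<And>x. x \<in> T \<Longrightarrow> c + g x \<in> S"
  shows "smooth_on T (\<lambda>x. f (c + g x))"
  using assms unfolding smooth_on_def by (auto intro: Ck_on_affine_pre)

lemma smooth_on_add:
  "open S \<Longrightarrow> smooth_on S f \<Longrightarrow> smooth_on S g \<Longrightarrow> smooth_on S (\<lambda>x. f x + g x)"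
  unfolding smooth_on_def by (auto intro: Ck_on_add)

lemma smooth_on_minus: "open S \<Longrightarrow> smooth_on S f \<Longrightarrow> smooth_on S (\<lambda>x. - f x)"
  by (rule smooth_on_bounded_linear_compose[OF bounded_linear_minus[OF bounded_linear_ident]])

lemma smooth_on_diff:
  "open S \<Longrightarrow> smooth_on S f \<Longrightarrow> smooth_on S g \<Longrightarrow> smooth_on S (\<lambda>x. f x - g x)"
  using smooth_on_add[of S f "\<lambda>x. - g x"] smooth_on_minus[of S g] by simp

lemma smooth_on_mult:
  fixes f g :: "'a::real_normed_vector \<Rightarrow> real"
  shows "open S \<Longrightarrow> smooth_on S f \<Longrightarrow> smooth_on S g \<Longrightarrow> smooth_on S (\<lambda>x. f x * g x)"
  unfolding smooth_on_def by (auto intro: Ck_on_mult)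

lemma smooth_on_divide:
  fixes f g :: "'a::real_normed_vector \<Rightarrow> real"
  assumes "open S" "smooth_on S f" "smooth_on S g" "\<And>x. x \<in> S \<Longrightarrow> g x \<noteq> 0"
  shows "smooth_on S (\<lambda>x. f x / g x)"
  unfolding divide_inverse using assms
  by (intro smooth_on_mult) (auto simp: smooth_on_def intro: Ck_on_inverse)

lemma smooth_on_sum:
  assumes "open S" "\<And>i. i \<in> I \<Longrightarrow> smooth_on S (f i)"
  shows "smooth_on S (\<lambda>x. \<Sum>i\<in>I. f i x)"
  using assms(2) by (induction I rule: infinite_finite_induct)
    (auto intro: smooth_on_add[OF assms(1)] smooth_on_const)

lemma smooth_on_prod:
  fixes f :: "'i \<Rightarrow> 'a::real_normed_vector \<Rightarrow> real"
  assumes "open S" "\<And>i. i \<in> I \<Longrightarrow> smooth_on S (f i)"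
  shows "smooth_on S (\<lambda>x. \<Prod>i\<in>I. f i x)"
  using assms(2) by (induction I rule: infinite_finite_induct)
    (auto intro: smooth_on_mult[OF assms(1)] smooth_on_const)

lemma smooth_on_bounded_linear: "bounded_linear g \<Longrightarrow> open S \<Longrightarrow> smooth_on S g"
proof -
  assume g: "bounded_linear g" and S: "open S"
  have "Ck_on k S g" for k
  proof (cases k)
    case 0
    then show ?thesis using g by (simp add: linear_continuous_on)
  next
    case (Suc k')
    have "(g has_derivative g) (at x)" for x by (rule bounded_linear_imp_has_derivative[OF g])
    then show ?thesis using Suc dd_has_derivative[of g g]
      by (auto simp: differentiable_def Ck_on_const)
  qed
  then show ?thesis by (simp add: smooth_on_def)
qed

lemma smooth_on_det:
  fixes M :: "'a::real_normed_vector \<Rightarrow> real ^ 'n::finite ^ 'n"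
  assumes "open S" "\<And>i j. smooth_on S (\<lambda>x. M x $ i $ j)"
  shows "smooth_on S (\<lambda>x. det (M x))"
  unfolding det_def using assms
  by (intro smooth_on_sum smooth_on_mult smooth_on_prod smooth_on_const) auto

lemma
  fixes M :: "real ^ 'n::finite ^ 'n"
  assumes "invertible M"
  shows matrix_inv_right: "M ** matrix_inv M = mat 1"
    and matrix_inv_left: "matrix_inv M ** M = mat 1"
  using assms someI_ex[of "\<lambda>M'. M ** M' = mat 1 \<and> M' ** M = mat 1"]
  unfolding invertible_def matrix_inv_def by auto

text \<open>Cramer's rule, applied to the columns of the identity, writes each entry of the inverse
  as a quotient of two determinants, which are polynomials in the entries.\<close>

lemma smooth_on_matrix_inv:
  fixes M :: "'a::real_normed_vector \<Rightarrow> real ^ 'n::finite ^ 'n"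
  assumes "open S" "\<And>i j. smooth_on S (\<lambda>x. M x $ i $ j)" "\<And>x. x \<in> S \<Longrightarrow> invertible (M x)"
  shows "smooth_on S (\<lambda>x. matrix_inv (M x) $ i $ j)"
proof -
  let ?D = "\<lambda>x. det (\<chi> p q. if q = i then axis j 1 $ p else M x $ p $ q)"
  have eq: "matrix_inv (M x) $ i $ j = ?D x / det (M x)" if "x \<in> S" for x
  proof -
    have inv: "invertible (M x)" and nz: "det (M x) \<noteq> 0"
      using assms(3)[OF that] by (auto simp: invertible_det_nz)
    let ?y = "matrix_inv (M x) *v axis j 1"
    have "M x *v ?y = axis j 1"
      using matrix_inv_right[OF inv] by (simp add: matrix_vector_mul_assoc)
    then have "?y = (\<chi> k. det (\<chi> p q. if q = k then axis j 1 $ p else M x $ p $ q) / det (M x))"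
      using cramer[OF nz] by blast
    moreover have "?y $ i = matrix_inv (M x) $ i $ j"
      by (simp add: matrix_vector_mul_component inner_axis matrix_vector_mult_basis column_def)
    ultimately show ?thesis by (metis (no_types, lifting) vec_lambda_beta)
  qed
  have "smooth_on S (\<lambda>x. ?D x / det (M x))"
  proof (intro smooth_on_divide smooth_on_det assms(1,2))
    show "smooth_on S (\<lambda>x. (\<chi> p q. if q = i then axis j 1 $ p else M x $ p $ q) $ k $ l)" for k l
      using assms(2) by (cases "l = i") (auto intro: smooth_on_const)
    show "det (M x) \<noteq> 0" if "x \<in> S" for x
      using assms(3)[OF that] by (simp add: invertible_det_nz)
  qed
  then show ?thesis by (rule smooth_on_cong) (use eq assms(1) in auto)
qed

section \<open>Directional derivatives: linearity, mixed derivatives, homogeneity\<close>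

lemma dd_bilinear_simps:
  assumes "f differentiable (at z)"
  shows "dd (u + w) f z = dd u f z + dd w f z" "dd (u - w) f z = dd u f z - dd w f z"
    "dd (r *\<^sub>R u) f z = r *\<^sub>R dd u f z" "dd (- u) f z = - dd u f z" "dd 0 f z = 0"
  using dd_linear[OF assms]
  by (simp_all add: linear_add linear_diff linear_cmul linear_neg linear_0)

lemma dd_along_line:
  assumes "f differentiable (at (c + t *\<^sub>R u))"
  shows "((\<lambda>t. f (c + t *\<^sub>R u)) has_vector_derivative dd u f (c + t *\<^sub>R u)) (at t)"
proof -
  have "((\<lambda>t. c + t *\<^sub>R u) has_derivative (\<lambda>s. s *\<^sub>R u)) (at t)"
    by (auto intro!: derivative_eq_intros)
  from has_derivative_compose[OF this has_derivative_dd[OF assms]]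
  show ?thesis using dd_bilinear_simps(3)[OF assms] by (simp add: has_vector_derivative_def)
qed

text \<open>The mean value theorem is applied twice: to the increment of f in direction w as a
  function of the position along u, then to \<open>dd u f\<close> along w. The left side is
  symmetric in u and w, the order of the derivatives on the right is not; this drives the symmetry
  of second derivatives.\<close>

lemma second_difference_mean_value:
  fixes f :: "'a::real_normed_vector \<Rightarrow> real"
  assumes f: "smooth_on S f" and S: "cball z (s * (norm u + norm w)) \<subseteq> S" and s: "s > 0"
  shows "\<exists>p. dist z p \<le> s * (norm u + norm w) \<and>
    f (z + s *\<^sub>R u + s *\<^sub>R w) - f (z + s *\<^sub>R u) - f (z + s *\<^sub>R w) + f z = s * (s * dd w (dd u f) p)"
proof -
  have near: "dist z (z + t *\<^sub>R u + r *\<^sub>R w) \<le> s * (norm u + norm w)"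
    if "0 \<le> t" "t \<le> s" "0 \<le> r" "r \<le> s" for t r
  proof -
    have "norm (t *\<^sub>R u + r *\<^sub>R w) \<le> t * norm u + r * norm w"
      using norm_triangle_ineq[of "t *\<^sub>R u" "r *\<^sub>R w"] that by simp
    also have "\<dots> \<le> s * norm u + s * norm w"
      using that by (intro add_mono mult_right_mono) auto
    finally show ?thesis by (simp add: dist_norm algebra_simps norm_minus_commute)
  qed
  have mem: "z + t *\<^sub>R u + r *\<^sub>R w \<in> S" if "0 \<le> t" "t \<le> s" "0 \<le> r" "r \<le> s" for t r
    using near[OF that] S by auto
  have line: "((\<lambda>t. g (c + t *\<^sub>R h)) has_field_derivative dd h g (c + t *\<^sub>R h)) (at t)"
    if "smooth_on S g" "c + t *\<^sub>R h \<in> S" for g c h t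
    using dd_along_line[OF smooth_on_differentiable[OF that]]
    by (simp add: has_real_derivative_iff_has_vector_derivative)
  let ?g = "\<lambda>t. f ((z + s *\<^sub>R w) + t *\<^sub>R u) - f (z + t *\<^sub>R u)"
  have "(?g has_field_derivative dd u f ((z + s *\<^sub>R w) + t *\<^sub>R u) - dd u f (z + t *\<^sub>R u)) (at t)"
    if "0 \<le> t" "t \<le> s" for t
    by (intro DERIV_diff line[OF f])
      (use mem[OF that, of s] mem[OF that, of 0] s in \<open>auto simp: algebra_simps\<close>)
  from MVT2[OF s this] obtain \<xi> where \<xi>: "0 < \<xi>" "\<xi> < s"
    and 1: "?g s - ?g 0 = (s - 0) * (dd u f ((z + s *\<^sub>R w) + \<xi> *\<^sub>R u) - dd u f (z + \<xi> *\<^sub>R u))"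
    by blast
  have "((\<lambda>r. dd u f ((z + \<xi> *\<^sub>R u) + r *\<^sub>R w)) has_field_derivative
      dd w (dd u f) ((z + \<xi> *\<^sub>R u) + r *\<^sub>R w)) (at r)" if "0 \<le> r" "r \<le> s" for r
    by (rule line[OF smooth_on_dd[OF f]]) (use mem[of \<xi> r] \<xi> that in auto)
  from MVT2[OF s this] obtain \<eta> where \<eta>: "0 < \<eta>" "\<eta> < s"
    and 2: "dd u f ((z + \<xi> *\<^sub>R u) + s *\<^sub>R w) - dd u f ((z + \<xi> *\<^sub>R u) + 0 *\<^sub>R w) =
      (s - 0) * dd w (dd u f) ((z + \<xi> *\<^sub>R u) + \<eta> *\<^sub>R w)"
    by blast
  show ?thesis
    by (rule exI[of _ "z + \<xi> *\<^sub>R u + \<eta> *\<^sub>R w"]) (use near[of \<xi> \<eta>] \<xi> \<eta> 1 2 in \<open>auto simp: algebra_simps\<close>)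
qed

text \<open>The same second difference, read in both orders, gives equal values of the two mixed
  derivatives at two nearby points; by continuity the values at \<open>z\<close> cannot
  differ.\<close>

lemma dd_commute_real:
  fixes f :: "'a::real_normed_vector \<Rightarrow> real"
  assumes f: "smooth_on S f" and S: "open S" "z \<in> S"
  shows "dd u (dd w f) z = dd w (dd u f) z"
proof (rule ccontr)
  let ?F = "dd u (dd w f)" and ?G = "dd w (dd u f)"
  assume ne: "?F z \<noteq> ?G z"
  define e where "e = \<bar>?F z - ?G z\<bar> / 2"
  have e: "e > 0" using ne by (simp add: e_def)
  obtain r where r: "r > 0" "cball z r \<subseteq> S" using S open_contains_cball by blast
  have cont: "continuous (at z) ?F" "continuous (at z) ?G"
    using smooth_on_continuous_on[OF smooth_on_dd[OF smooth_on_dd[OF f]]] S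
    by (auto simp: continuous_on_eq_continuous_at)
  obtain d1 where d1: "d1 > 0" "\<And>p. dist p z < d1 \<Longrightarrow> dist (?F p) (?F z) < e"
    using cont(1) e unfolding continuous_at_eps_delta by blast
  obtain d2 where d2: "d2 > 0" "\<And>p. dist p z < d2 \<Longrightarrow> dist (?G p) (?G z) < e"
    using cont(2) e unfolding continuous_at_eps_delta by blast
  define d where "d = Min {r, d1, d2} / 2"
  have d: "d > 0" "d < r" "d < d1" "d < d2" using r d1 d2 by (auto simp: d_def)
  \<comment> \<open>Scales the parallelogram spanned by u and w into the ball of radius
    \<open>d\<close>; the summand 1 keeps the denominator positive when both vectors are
    zero.\<close>
  define s where "s = d / (1 + norm u + norm w)"
  have pos: "1 + norm u + norm w > 0" by (smt (verit) norm_ge_zero)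
  have s: "s > 0" using d pos by (simp add: s_def)
  have "s * (norm u + norm w) \<le> s * (1 + norm u + norm w)" using s by simp
  also have "\<dots> = d" using pos by (simp add: s_def)
  finally have sd: "s * (norm u + norm w) \<le> d" .
  have "cball z (s * (norm u + norm w)) \<subseteq> S" using sd d r by force
  from second_difference_mean_value[OF f this s] obtain p where
    p: "dist z p \<le> s * (norm u + norm w)" "f (z + s *\<^sub>R u + s *\<^sub>R w) - f (z + s *\<^sub>R u) - f (z + s *\<^sub>R w) + f z = s * (s * ?G p)"
    by blast
  have "cball z (s * (norm w + norm u)) \<subseteq> S" using sd d r by (force simp: add.commute)
  from second_difference_mean_value[OF f this s] obtain q where
    q: "dist z q \<le> s * (norm w + norm u)" "f (z + s *\<^sub>R w + s *\<^sub>R u) - f (z + s *\<^sub>R w) - f (z + s *\<^sub>R u) + f z = s * (s * ?F q)"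
    by blast
  have "s * (s * ?G p) = s * (s * ?F q)" using p(2) q(2) by (simp add: algebra_simps)
  then have "?G p = ?F q" using s by simp
  moreover have "dist (?G p) (?G z) < e" using p(1) sd d by (intro d2) (simp add: dist_commute)
  moreover have "dist (?F q) (?F z) < e" using q(1) sd d by (intro d1) (simp add: dist_commute add.commute)
  ultimately show False by (simp add: e_def dist_real_def abs_if field_simps split: if_splits)
qed

lemma dd_vec_nth:
  fixes f :: "'a::real_normed_vector \<Rightarrow> real ^ 'n::finite"
  assumes "f differentiable (at z)"
  shows "dd h (\<lambda>z. f z $ i) z = dd h f z $ i"
  by (rule dd_has_derivative)
    (rule bounded_linear.has_derivative[OF bounded_linear_vec_nth has_derivative_dd[OF assms]])

lemma dd_commute:
  fixes f :: "'a::real_normed_vector \<Rightarrow> real ^ 'n::finite"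
  assumes f: "smooth_on S f" and S: "open S" "z \<in> S"
  shows "dd u (dd w f) z = dd w (dd u f) z"
proof -
  have "dd u (dd w f) z $ i = dd w (dd u f) z $ i" for i
  proof -
    have comp: "dd a (dd b f) z $ i = dd a (dd b (\<lambda>z. f z $ i)) z" for a b
    proof -
      have "dd a (dd b f) z $ i = dd a (\<lambda>z. dd b f z $ i) z"
        by (rule dd_vec_nth[symmetric, OF smooth_on_differentiable[OF smooth_on_dd[OF f] S(2)]])
      also have "\<dots> = dd a (dd b (\<lambda>z. f z $ i)) z"
        by (rule dd_cong_open[OF S]) (metis dd_vec_nth smooth_on_differentiable f)
      finally show ?thesis .
    qed
    show ?thesis unfolding comp
      by (rule dd_commute_real[OF smooth_on_bounded_linear_compose[OF bounded_linear_vec_nth S(1) f] S])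
  qed
  then show ?thesis by (simp add: vec_eq_iff)
qed

text \<open>Chain rule for \<open>(y, w) \<mapsto> (y, r w)\<close>. The factor r may be any real
  number; negative factors occur in dimension one.\<close>

lemma dd_scaling:
  fixes F :: "('a::real_normed_vector \<times> 'b::real_normed_vector) \<Rightarrow> real"
  assumes U: "open U" "(x, v) \<in> U"
    and hom: "\<And>y w. (y, w) \<in> U \<Longrightarrow> F (y, r *\<^sub>R w) = C * F (y, w)"
    and F: "F differentiable (at (x, v))" "F differentiable (at (x, r *\<^sub>R v))"
  shows "dd (h, r *\<^sub>R k) F (x, r *\<^sub>R v) = C * dd (h, k) F (x, v)"
proof -
  have "((\<lambda>z. (fst z, r *\<^sub>R snd z)) has_derivative (\<lambda>h. (fst h, r *\<^sub>R snd h))) (at (x, v))"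
    by (auto intro!: derivative_eq_intros)
  from has_derivative_compose[OF this, of F] has_derivative_dd[OF F(2)]
  have "((\<lambda>z. F (fst z, r *\<^sub>R snd z)) has_derivative (\<lambda>h. dd (fst h, r *\<^sub>R snd h) F (x, r *\<^sub>R v))) (at (x, v))"
    by simp
  then have "((\<lambda>z. C * F z) has_derivative (\<lambda>h. dd (fst h, r *\<^sub>R snd h) F (x, r *\<^sub>R v))) (at (x, v))"
    by (rule has_derivative_transform_within_open[OF _ U]) (use hom in auto)
  moreover have "((\<lambda>z. C * F z) has_derivative (\<lambda>h. C * dd h F (x, v))) (at (x, v))"
    by (rule has_derivative_mult_right[OF has_derivative_dd[OF F(1)]])
  ultimately have "(\<lambda>h. dd (fst h, r *\<^sub>R snd h) F (x, r *\<^sub>R v)) = (\<lambda>h. C * dd h F (x, v))"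
    by (rule has_derivative_unique)
  from fun_cong[OF this, of "(h, k)"] show ?thesis by simp
qed

lemma euler_homogeneous:
  fixes F :: "('a::real_normed_vector \<times> 'b::real_normed_vector) \<Rightarrow> real"
  assumes F: "F differentiable (at (x, v))"
    and hom: "\<And>r. r > 0 \<Longrightarrow> F (x, r *\<^sub>R v) = r ^ n * F (x, v)"
  shows "dd (0, v) F (x, v) = n * F (x, v)"
proof -
  have "((\<lambda>t. F ((x, 0) + t *\<^sub>R (0, v))) has_field_derivative dd (0, v) F (x, v)) (at 1)"
    using dd_along_line[of F "(x, 0)" 1 "(0, v)"] F
    by (simp add: has_real_derivative_iff_has_vector_derivative)
  then have "((\<lambda>t. t ^ n * F (x, v)) has_field_derivative dd (0, v) F (x, v)) (at 1)"
    by (rule has_field_derivative_transform_within_open[of _ _ _ "{0<..}"]) (use hom in auto)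
  moreover have "((\<lambda>t. t ^ n * F (x, v)) has_field_derivative n * F (x, v)) (at 1)"
    by (auto intro!: derivative_eq_intros)
  ultimately show ?thesis by (rule DERIV_unique)
qed

text \<open>Adding the expansions of \<open>D\<close> at \<open>v + t u\<close> and
  \<open>v - t u\<close> cancels the mixed term and leaves \<open>2 t t D u u = 0\<close>;
  polarization then gives all values. Facts known only for the vectors of an open cone extend to the
  whole fibre in this way.\<close>

lemma symmetric_bilinear_zero_on_open:
  fixes D :: "'a::real_normed_vector \<Rightarrow> 'a \<Rightarrow> 'b::real_normed_vector"
  assumes D: "bilinear D" "\<And>u w. D u w = D w u"
    and V: "open V" "v \<in> V" "\<And>v. v \<in> V \<Longrightarrow> D v v = 0"
  shows "D u w = 0"
proof -
  note simps = bilinear_ladd[OF D(1)] bilinear_radd[OF D(1)] bilinear_lmul[OF D(1)] bilinear_rmul[OF D(1)]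
  have diag: "D u u = 0" for u
  proof -
    obtain e where e: "e > 0" "ball v e \<subseteq> V" using V open_contains_ball by blast
    define t where "t = e / (2 * (1 + norm u))"
    have pos: "1 + norm u > 0" by (smt (verit) norm_ge_zero)
    then have t: "t > 0" using e by (simp add: t_def)
    have "t * norm u \<le> t * (1 + norm u)" using t by simp
    also have "\<dots> = e / 2" using pos unfolding t_def by (simp add: divide_simps)
    finally have tu: "t * norm u < e" using e by simp
    have ex: "D (v + r *\<^sub>R u) (v + r *\<^sub>R u) = D v v + (2 * r) *\<^sub>R D v u + (r * r) *\<^sub>R D u u" for r
    proof -
      have "(2 * r) *\<^sub>R D v u = r *\<^sub>R D v u + r *\<^sub>R D v u" by (metis mult_2 scaleR_add_left)
      then show ?thesis using D(2)[of u v] by (simp add: simps scaleR_add_right)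
    qed
    have mem: "v + t *\<^sub>R u \<in> V" "v + (- t) *\<^sub>R u \<in> V"
      using tu t e(2) by (auto simp: dist_norm subset_iff)
    have "(2 * t) *\<^sub>R D v u + (t * t) *\<^sub>R D u u = 0"
      using V(3)[OF mem(1)] V(3)[OF V(2)] ex[of t] by simp
    moreover have "- ((2 * t) *\<^sub>R D v u) + (t * t) *\<^sub>R D u u = 0"
      using V(3)[OF mem(2)] V(3)[OF V(2)] ex[of "- t"] by simp
    ultimately have "((2 * t) *\<^sub>R D v u + (t * t) *\<^sub>R D u u) + (- ((2 * t) *\<^sub>R D v u) + (t * t) *\<^sub>R D u u) = 0"
      by simp
    then have "(t * t) *\<^sub>R D u u + (t * t) *\<^sub>R D u u = 0" by simp
    then have "(t * t + t * t) *\<^sub>R D u u = 0" by (simp only: scaleR_add_left)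
    moreover have "t * t + t * t \<noteq> 0" using t by (simp add: add_pos_pos order_less_imp_not_eq2)
    ultimately show ?thesis by simp
  qed
  have "D (u + w) (u + w) = 0" by (rule diag)
  then have "2 *\<^sub>R D u w = 0"
    using diag[of u] diag[of w] D(2)[of u w] by (simp add: simps scaleR_2)
  then show ?thesis by simp
qed

section \<open>Horizontal lifts and sprays\<close>

text \<open>A condition at a single base point: nothing is said about how \<open>B\<close> depends
  on x. It is void if the fibre of \<open>U\<close> over x is empty, so uniqueness needs a vector
  there.\<close>

definition parallel_at ::
  "((real ^ 'n::finite) \<times> (real ^ 'n)) set \<Rightarrow> ((real ^ 'n) \<times> (real ^ 'n) \<Rightarrow> real) \<Rightarrow> real ^ 'n
     \<Rightarrow> (real ^ 'n \<Rightarrow> real ^ 'n \<Rightarrow> real ^ 'n) \<Rightarrow> bool" where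
  "parallel_at U F x B \<longleftrightarrow> bilinear B \<and> (\<forall>u w. B u w = B w u) \<and>
     (\<forall>v h. (x, v) \<in> U \<longrightarrow> dd (h, - B h v) F (x, v) = 0)"

text \<open>Index-free form of the invertibility of the fibre Hessian.\<close>

definition fibre_nondegenerate ::
  "((real ^ 'n::finite) \<times> (real ^ 'n)) set \<Rightarrow> ((real ^ 'n) \<times> (real ^ 'n) \<Rightarrow> real) \<Rightarrow> bool" where
  "fibre_nondegenerate U F \<longleftrightarrow>
     (\<forall>z\<in>U. \<forall>u. (\<forall>k. dd (0, u) (dd (0, k) F) z = 0) \<longrightarrow> u = 0)"

lemma dd_pair:
  fixes F :: "('a::real_normed_vector \<times> 'b::real_normed_vector) \<Rightarrow> 'c::real_normed_vector"
  assumes "F differentiable (at z)"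
  shows "dd (h, k) F z = dd (h, 0) F z + dd (0, k) F z"
  using dd_bilinear_simps(1)[OF assms, of "(h, 0)" "(0, k)"] by simp

lemma dd_fibre:
  fixes F :: "('a::real_normed_vector \<times> 'b::real_normed_vector) \<Rightarrow> 'c::real_normed_vector"
  assumes "F differentiable (at z)"
  shows "dd (0, u + w) F z = dd (0, u) F z + dd (0, w) F z" "dd (0, u - w) F z = dd (0, u) F z - dd (0, w) F z"
    "dd (0, r *\<^sub>R u) F z = r *\<^sub>R dd (0, u) F z" "dd (0, - u) F z = - dd (0, u) F z" "dd (0, 0) F z = 0"
  using dd_bilinear_simps(1,2)[OF assms, of "(0, u)" "(0, w)"] dd_bilinear_simps(3)[OF assms, of r "(0, u)"]
    dd_bilinear_simps(4)[OF assms, of "(0, u)"] dd_bilinear_simps(5)[OF assms]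
  by (simp_all add: zero_prod_def)

lemma dd_base:
  fixes F :: "('a::real_normed_vector \<times> 'b::real_normed_vector) \<Rightarrow> 'c::real_normed_vector"
  assumes "F differentiable (at z)"
  shows "dd (u + w, 0) F z = dd (u, 0) F z + dd (w, 0) F z" "dd (r *\<^sub>R u, 0) F z = r *\<^sub>R dd (u, 0) F z"
  using dd_bilinear_simps(1)[OF assms, of "(u, 0)" "(w, 0)"] dd_bilinear_simps(3)[OF assms, of r "(u, 0)"]
  by (simp_all add: zero_prod_def)

lemma open_fibre: "open U \<Longrightarrow> open {v. (x, v) \<in> U}"
  using open_vimage[of U "\<lambda>v. (x, v)"] by (simp add: vimage_def continuous_on_Pair)

lemma fibre_line_derivative:
  fixes F :: "('a::real_normed_vector \<times> 'b::real_normed_vector) \<Rightarrow> real"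
  assumes "smooth_on U F" "(x, v) \<in> U"
  shows "((\<lambda>t. F (x, v + t *\<^sub>R k)) has_field_derivative dd (0, k) F (x, v)) (at 0)"
  using dd_along_line[of F "(x, v)" 0 "(0, k)"] smooth_on_differentiable[OF assms]
  by (simp add: has_real_derivative_iff_has_vector_derivative)

lemma eventually_fibre_line:
  fixes v :: "'b::real_normed_vector"
  assumes "open U" "(x, v) \<in> U"
  shows "eventually (\<lambda>t::real. (x, v + t *\<^sub>R k) \<in> U) (nhds 0)"
proof -
  have "open ((\<lambda>t::real. (x, v + t *\<^sub>R k)) -` U)"
    using assms(1) by (intro open_vimage continuous_intros)
  moreover have "0 \<in> (\<lambda>t::real. (x, v + t *\<^sub>R k)) -` U" using assms(2) by simp
  ultimately show ?thesis by (auto simp: eventually_nhds vimage_def intro!: exI[of _ "(\<lambda>t::real. (x, v + t *\<^sub>R k)) -` U"])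
qed

lemma DERIV_transfer_nhds:
  fixes f g :: "'a::real_normed_field \<Rightarrow> 'a"
  assumes "(f has_field_derivative D) (at x)" "eventually (\<lambda>t. f t = g t) (nhds x)"
  shows "(g has_field_derivative D) (at x)"
  using DERIV_cong_ev[OF refl assms(2) refl] assms(1) by blast

text \<open>With the direction v held fixed, the horizontal derivative vanishes at all points
  \<open>v + t k\<close> near v. Its t-derivative at 0 is the mixed second derivative minus the
  Hessian term minus \<open>dd (0, B v k) F\<close>, and the last summand is
  \<open>dd (k, 0) F\<close> by parallelism in direction k and the symmetry of
  \<open>B\<close>.\<close>

lemma parallel_at_spray:
  assumes F: "smooth_on U F" and U: "open U" "(x, v) \<in> U" and par: "parallel_at U F x B"
  shows "dd (v, 0) (dd (0, k) F) (x, v) - dd (k, 0) F (x, v) = dd (0, B v v) (dd (0, k) F) (x, v)"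
proof -
  have B: "bilinear B" "\<And>u w. B u w = B w u" using par by (auto simp: parallel_at_def)
  have zero: "dd (v, 0) F (x, v + t *\<^sub>R k) - dd (0, B v v) F (x, v + t *\<^sub>R k)
      - t * dd (0, B v k) F (x, v + t *\<^sub>R k) = 0" if "(x, v + t *\<^sub>R k) \<in> U" for t
  proof -
    note d = smooth_on_differentiable[OF F that]
    have "dd (v, - B v (v + t *\<^sub>R k)) F (x, v + t *\<^sub>R k) = 0"
      using par that by (auto simp: parallel_at_def)
    then have "dd (v, 0) F (x, v + t *\<^sub>R k) = dd (0, B v (v + t *\<^sub>R k)) F (x, v + t *\<^sub>R k)"
      unfolding dd_pair[OF d, of v "- B v (v + t *\<^sub>R k)"] dd_fibre[OF d] by simp
    then show ?thesis
      by (simp add: dd_fibre[OF d] bilinear_radd[OF B(1)] bilinear_rmul[OF B(1)])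
  qed
  have "((\<lambda>t. dd (v, 0) F (x, v + t *\<^sub>R k) - dd (0, B v v) F (x, v + t *\<^sub>R k)
      - t * dd (0, B v k) F (x, v + t *\<^sub>R k)) has_field_derivative
      dd (0, k) (dd (v, 0) F) (x, v) - dd (0, k) (dd (0, B v v) F) (x, v)
      - (1 * dd (0, B v k) F (x, v + 0 *\<^sub>R k) + dd (0, k) (dd (0, B v k) F) (x, v) * 0)) (at 0)"
    by (intro DERIV_diff DERIV_mult DERIV_ident fibre_line_derivative[OF smooth_on_dd[OF F] U(2)])
  moreover have "eventually (\<lambda>t. dd (v, 0) F (x, v + t *\<^sub>R k) - dd (0, B v v) F (x, v + t *\<^sub>R k)
      - t * dd (0, B v k) F (x, v + t *\<^sub>R k) = 0) (nhds 0)"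
    using eventually_fibre_line[OF U, of k] by eventually_elim (rule zero)
  ultimately have "((\<lambda>t. 0) has_field_derivative
      dd (0, k) (dd (v, 0) F) (x, v) - dd (0, k) (dd (0, B v v) F) (x, v)
      - (1 * dd (0, B v k) F (x, v + 0 *\<^sub>R k) + dd (0, k) (dd (0, B v k) F) (x, v) * 0)) (at 0)"
    by (rule DERIV_transfer_nhds)
  then have "dd (0, k) (dd (v, 0) F) (x, v) - dd (0, k) (dd (0, B v v) F) (x, v) - dd (0, B v k) F (x, v) = 0"
    using DERIV_unique[OF _ DERIV_const] by fastforce
  moreover have "dd (k, 0) F (x, v) = dd (0, B v k) F (x, v)"
  proof -
    note d = smooth_on_differentiable[OF F U(2)]
    have "dd (k, - B k v) F (x, v) = 0" using par U(2) by (auto simp: parallel_at_def)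
    then show ?thesis
      unfolding dd_pair[OF d, of k "- B v k"] dd_fibre[OF d] B(2)[of k v] by simp
  qed
  ultimately show ?thesis
    using dd_commute_real[OF F U, of "(0, k)" "(v, 0)"] dd_commute_real[OF F U, of "(0, k)" "(0, B v v)"]
    by simp
qed

lemma bilinear_diff:
  assumes "bilinear B" "bilinear B'"
  shows "bilinear (\<lambda>u w. B u w - B' u w)"
  using assms by (auto simp: bilinear_def intro: linear_compose_sub)

text \<open>Both maps satisfy the same spray equation, so nondegeneracy gives
  \<open>B y y = B' y y\<close> for every y in the open fibre, and polarization gives the
  rest.\<close>

lemma parallel_at_unique:
  assumes F: "smooth_on U F" "fibre_nondegenerate U F" and U: "open U" "(x, v) \<in> U"
    and par: "parallel_at U F x B" "parallel_at U F x B'"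
  shows "B u w = B' u w"
proof -
  have "B u w - B' u w = 0"
  proof (rule symmetric_bilinear_zero_on_open[where D = "\<lambda>u w. B u w - B' u w"
        and V = "{v. (x, v) \<in> U}" and v = v])
    show "bilinear (\<lambda>u w. B u w - B' u w)"
      using par by (auto simp: parallel_at_def intro: bilinear_diff)
    show "B u w - B' u w = B w u - B' w u" for u w
      using par unfolding parallel_at_def by metis
    show "open {v. (x, v) \<in> U}" "v \<in> {v. (x, v) \<in> U}" using U open_fibre by auto
    show "B y y - B' y y = 0" if "y \<in> {v. (x, v) \<in> U}" for y
    proof -
      from that have y: "(x, y) \<in> U" by simp
      have "dd (0, B y y - B' y y) (dd (0, k) F) (x, y) = 0" for k
        using parallel_at_spray[OF F(1) U(1) y par(1)] parallel_at_spray[OF F(1) U(1) y par(2)]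
        by (simp add: dd_fibre[OF smooth_on_differentiable[OF smooth_on_dd[OF F(1)] y]])
      then show ?thesis using F(2) y unfolding fibre_nondegenerate_def by blast
    qed
  qed
  then show ?thesis by simp
qed

text \<open>With \<open>D h\<close> the derivative along the horizontal lift of \<open>h\<close>, the hypothesis says that the
  fibre derivative of \<open>v \<mapsto> D v (x, v)\<close> is twice \<open>D\<close>; as that function is homogeneous of degree
  three, Euler's theorem forces it, and then \<open>D\<close>, to vanish.\<close>

lemma spray_parallel_at:
  assumes F: "smooth_on U F" and U: "open U"
    and cone: "\<And>y w r. (y, w) \<in> U \<Longrightarrow> r > 0 \<Longrightarrow> (y, r *\<^sub>R w) \<in> U"
    and hom: "\<And>y w r. (y, w) \<in> U \<Longrightarrow> r > 0 \<Longrightarrow> F (y, r *\<^sub>R w) = r\<^sup>2 * F (y, w)"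
    and B: "bilinear B" "\<And>u w. B u w = B w u"
    and spray: "\<And>v k. (x, v) \<in> U \<Longrightarrow>
      dd (v, 0) (dd (0, k) F) (x, v) - dd (k, 0) F (x, v) = dd (0, B v v) (dd (0, k) F) (x, v)"
  shows "parallel_at U F x B"
proof -
  note simps = bilinear_ladd[OF B(1)] bilinear_radd[OF B(1)] bilinear_lmul[OF B(1)] bilinear_rmul[OF B(1)]
  define D where "D h v = dd (h, 0) F (x, v) - dd (0, B h v) F (x, v)" for h v
  define H where "H v = D v v" for v
  \<comment> \<open>In \<open>H (v + t k)\<close> the directions of differentiation move with t as
    well. The expansion freezes them, so that only the point of evaluation and explicit powers of t
    depend on t.\<close>
  have H_exp: "H (v + t *\<^sub>R k) = dd (v, 0) F (x, v + t *\<^sub>R k) + t * dd (k, 0) F (x, v + t *\<^sub>R k)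
      - (dd (0, B v v) F (x, v + t *\<^sub>R k) + 2 * t * dd (0, B k v) F (x, v + t *\<^sub>R k)
         + t * t * dd (0, B k k) F (x, v + t *\<^sub>R k))"
    if "(x, v + t *\<^sub>R k) \<in> U" for v t k
  proof -
    note d = smooth_on_differentiable[OF F that]
    have "(2 * t) *\<^sub>R B k v = t *\<^sub>R B k v + t *\<^sub>R B k v" by (metis mult_2 scaleR_add_left)
    then have "B (v + t *\<^sub>R k) (v + t *\<^sub>R k) = B v v + (2 * t) *\<^sub>R B k v + (t * t) *\<^sub>R B k k"
      using B(2)[of v k] by (simp add: simps scaleR_add_right)
    then show ?thesis unfolding H_def D_def
      by (simp add: dd_base[OF d] dd_fibre[OF d])
  qed
  have H_der: "((\<lambda>t. H (v + t *\<^sub>R k)) has_field_derivative 2 * D k v) (at 0)" if v: "(x, v) \<in> U" for v k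
  proof -
    note line = fibre_line_derivative[OF smooth_on_dd[OF F] v]
    have "((\<lambda>t. dd (v, 0) F (x, v + t *\<^sub>R k) + t * dd (k, 0) F (x, v + t *\<^sub>R k)
      - (dd (0, B v v) F (x, v + t *\<^sub>R k) + 2 * t * dd (0, B k v) F (x, v + t *\<^sub>R k)
         + t * t * dd (0, B k k) F (x, v + t *\<^sub>R k))) has_field_derivative 2 * D k v) (at 0)"
      by (rule derivative_eq_intros line refl)+
        (use spray[OF v, of k] dd_commute_real[OF F U v, of "(0, k)" "(v, 0)"]
          dd_commute_real[OF F U v, of "(0, k)" "(0, B v v)"] in \<open>simp add: D_def\<close>)
    moreover have "eventually (\<lambda>t. (dd (v, 0) F (x, v + t *\<^sub>R k) + t * dd (k, 0) F (x, v + t *\<^sub>R k)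
      - (dd (0, B v v) F (x, v + t *\<^sub>R k) + 2 * t * dd (0, B k v) F (x, v + t *\<^sub>R k)
         + t * t * dd (0, B k k) F (x, v + t *\<^sub>R k))) = H (v + t *\<^sub>R k)) (nhds 0)"
      using eventually_fibre_line[OF U v, of k] by eventually_elim (rule H_exp[symmetric])
    ultimately show ?thesis by (rule DERIV_transfer_nhds)
  qed
  have H_zero: "H v = 0" if v: "(x, v) \<in> U" for v
  proof -
    have "H (r *\<^sub>R v) = r ^ 3 * H v" if r: "r > 0" for r
    proof -
      note d = smooth_on_differentiable[OF F v] smooth_on_differentiable[OF F cone[OF v r]]
      have "dd (v, r *\<^sub>R k) F (x, r *\<^sub>R v) = r\<^sup>2 * dd (v, k) F (x, v)" for k
        by (rule dd_scaling[OF U v hom[OF _ r] d])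
      from this[of "- B v v"] this[of 0]
      have "dd (v, 0) F (x, r *\<^sub>R v) = r\<^sup>2 * dd (v, 0) F (x, v)"
        "r * dd (0, B v v) F (x, r *\<^sub>R v) = r\<^sup>2 * dd (0, B v v) F (x, v)"
        by (simp_all add: dd_pair[OF d(1), of v "- B v v"] dd_pair[OF d(2), of v "- (r *\<^sub>R B v v)"]
            dd_fibre[OF d(1)] dd_fibre[OF d(2)] algebra_simps)
      then show ?thesis unfolding H_def D_def
        by (simp add: simps dd_base[OF d(2)] dd_fibre[OF d(2)] power2_eq_square power3_eq_cube algebra_simps)
          auto
    qed
    \<comment> \<open>Moving along v itself is rescaling by \<open>1 + t\<close>, so degree three
      gives the derivative \<open>3 H v\<close> there, while \<open>H_der\<close> with
      \<open>k = v\<close> gives \<open>2 D v v = 2 H v\<close>.\<close>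
    from this[of "1 + t" for t] have sc: "H (v + t *\<^sub>R v) = (1 + t) ^ 3 * H v" if "t > - 1" for t
      using that by (simp add: scaleR_add_left)
    have "((\<lambda>t. (1 + t) ^ 3 * H v) has_field_derivative 3 * H v) (at 0)"
      by (auto intro!: derivative_eq_intros)
    then have "((\<lambda>t. H (v + t *\<^sub>R v)) has_field_derivative 3 * H v) (at 0)"
      by (rule has_field_derivative_transform_within_open[of _ _ _ "{- 1 <..}"]) (auto simp: sc)
    from DERIV_unique[OF this H_der[OF v]] show ?thesis by (simp add: H_def)
  qed
  \<comment> \<open>H vanishes on the whole open fibre, hence so does its derivative
    \<open>2 D k v\<close>.\<close>
  have "D k v = 0" if v: "(x, v) \<in> U" for k v
  proof -
    have "eventually (\<lambda>t. H (v + t *\<^sub>R k) = 0) (nhds 0)"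
      using eventually_fibre_line[OF U v, of k] by eventually_elim (rule H_zero)
    with H_der[OF v, of k] have "((\<lambda>t. 0) has_field_derivative 2 * D k v) (at 0)"
      by (rule DERIV_transfer_nhds)
    then show ?thesis using DERIV_unique[OF _ DERIV_const] by fastforce
  qed
  then have "dd (h, - B h v) F (x, v) = 0" if "(x, v) \<in> U" for h v
    using that smooth_on_differentiable[OF F that] unfolding D_def
    by (simp add: dd_pair[of F _ h "- B h v"] dd_fibre)
  then show ?thesis using B by (simp add: parallel_at_def)
qed

text \<open>The tangent map of \<phi> sends \<open>(y, w)\<close> to
  \<open>(\<phi> y, d\<phi> w)\<close>. Its differential maps the horizontal lift
  \<open>(K h, - B (K h) w)\<close> to \<open>(h, d2\<phi>(K h, w) - d\<phi> (B (K h) w))\<close>,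
  where \<open>K\<close> inverts the Jacobian at x; this second component is minus the new map. It
  is the affine transformation law of connection coefficients.\<close>

lemma parallel_at_transfer:
  fixes \<phi> :: "real ^ 'n::finite \<Rightarrow> real ^ 'n"
  assumes F: "smooth_on U' F'" and U: "open U"
    and \<phi>: "smooth_on V \<phi>" "open V" "x \<in> V"
    and rel: "\<And>y w. y \<in> V \<Longrightarrow> (y, w) \<in> U \<Longrightarrow> F (y, w) = F' (\<phi> y, dd w \<phi> y)"
    and mem: "\<And>w. (\<phi> x, w) \<in> U' \<Longrightarrow> (x, K w) \<in> U"
    and K: "linear K" "\<And>w. dd (K w) \<phi> x = w"
    and par: "parallel_at U F x B"
  shows "parallel_at U' F' (\<phi> x) (\<lambda>h k. dd (B (K h) (K k)) \<phi> x - dd (K h) (dd (K k) \<phi>) x)"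
    (is "parallel_at _ _ _ ?B'")
proof -
  have B: "bilinear B" "\<And>u w. B u w = B w u" using par by (auto simp: parallel_at_def)
  have lin: "linear (\<lambda>h. dd h \<phi> x)" by (rule dd_linear[OF smooth_on_differentiable[OF \<phi>(1,3)]])
  have sec: "dd h (dd k \<phi>) x = dd k (dd h \<phi>) x" for h k by (rule dd_commute[OF \<phi>])
  have lin2: "linear (\<lambda>h. dd h (dd k \<phi>) x)" for k
    by (rule dd_linear[OF smooth_on_differentiable[OF smooth_on_dd[OF \<phi>(1)] \<phi>(3)]])
  have Bl: "linear (\<lambda>h. B h k)" "linear (\<lambda>h. B k h)" for k using B(1) by (auto simp: bilinear_def)
  have "linear (\<lambda>h. ?B' h k)" for k
    by (intro linear_compose_sub linear_compose[OF linear_compose[OF K(1) Bl(1)] lin, unfolded o_def]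
        linear_compose[OF K(1) lin2, unfolded o_def])
  moreover have sym: "?B' h k = ?B' k h" for h k using B(2) sec by metis
  ultimately have bil: "bilinear ?B'" unfolding bilinear_def by (metis (no_types, lifting) ext)
  moreover have "dd (h, - ?B' h v) F' (\<phi> x, v) = 0" if v: "(\<phi> x, v) \<in> U'" for h v
  proof -
    define w where "w = K v"
    have w: "(x, w) \<in> U" "dd w \<phi> x = v" using mem[OF v] K(2) by (auto simp: w_def)
    \<comment> \<open>The fibre part of the tangent map is expanded over the basis, which makes it a
      finite sum of products and yields its joint differentiability in base point and
      vector.\<close>
    have "((\<lambda>y. \<Sum>i\<in>UNIV. snd y $ i *\<^sub>R dd (axis i 1) \<phi> (fst y)) has_derivative
       (\<lambda>k. \<Sum>i\<in>UNIV. w $ i *\<^sub>R dd (fst k) (dd (axis i 1) \<phi>) x + (snd k $ i) *\<^sub>R dd (axis i 1) \<phi> x)) (at (x, w))"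
    proof (intro has_derivative_sum)
      fix i
      have "((\<lambda>y. dd (axis i 1) \<phi> (fst y)) has_derivative (\<lambda>k. dd (fst k) (dd (axis i 1) \<phi>) x)) (at (x, w))"
        using has_derivative_compose[OF has_derivative_fst[OF has_derivative_ident],
            of "dd (axis i 1) \<phi>" "\<lambda>k. dd k (dd (axis i 1) \<phi>) x" "(x, w)" UNIV]
          smooth_on_has_derivative[OF smooth_on_dd[OF \<phi>(1)] \<phi>(3)] by simp
      moreover have "((\<lambda>y. snd y $ i) has_derivative (\<lambda>k. snd k $ i)) (at (x, w))"
        by (rule bounded_linear.has_derivative[OF bounded_linear_vec_nth has_derivative_snd[OF has_derivative_ident]])
      ultimately show "((\<lambda>y. snd y $ i *\<^sub>R dd (axis i 1) \<phi> (fst y)) has_derivative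
        (\<lambda>k. w $ i *\<^sub>R dd (fst k) (dd (axis i 1) \<phi>) x + (snd k $ i) *\<^sub>R dd (axis i 1) \<phi> x)) (at (x, w))"
        using has_derivative_scaleR[of "\<lambda>y. snd y $ i" _ _ UNIV "\<lambda>y. dd (axis i 1) \<phi> (fst y)"] by fastforce
    qed
    moreover have lincomb: "dd u \<phi> y = (\<Sum>i\<in>UNIV. u $ i *\<^sub>R dd (axis i 1) \<phi> y)" if "y \<in> V" for y u
      using linear_sum[OF dd_linear[OF smooth_on_differentiable[OF \<phi>(1) that]], of "\<lambda>i. u $ i *\<^sub>R axis i 1" UNIV]
        dd_bilinear_simps(3)[OF smooth_on_differentiable[OF \<phi>(1) that]]
        basis_expansion[of u]
      by (simp add: scalar_mult_eq_scaleR)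
    moreover have "(\<Sum>i\<in>UNIV. w $ i *\<^sub>R dd k (dd (axis i 1) \<phi>) x) = dd k (dd w \<phi>) x" for k
    proof -
      have "(\<Sum>i\<in>UNIV. w $ i *\<^sub>R dd (axis i 1) (dd k \<phi>) x) = dd w (dd k \<phi>) x"
        using linear_sum[OF lin2[of k], of "\<lambda>i. w $ i *\<^sub>R axis i 1" UNIV]
          linear_cmul[OF lin2[of k]] basis_expansion[of w] by (simp add: scalar_mult_eq_scaleR)
      then show ?thesis by (simp add: sec)
    qed
    ultimately have "((\<lambda>y. \<Sum>i\<in>UNIV. snd y $ i *\<^sub>R dd (axis i 1) \<phi> (fst y)) has_derivative
       (\<lambda>k. dd (fst k) (dd w \<phi>) x + dd (snd k) \<phi> x)) (at (x, w))"
      using \<phi>(3) by (simp add: sum.distrib)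
    moreover have "((\<lambda>y. \<phi> (fst y)) has_derivative (\<lambda>k. dd (fst k) \<phi> x)) (at (x, w))"
      using has_derivative_compose[OF has_derivative_fst[OF has_derivative_ident], of \<phi> "\<lambda>k. dd k \<phi> x" "(x, w)" UNIV]
        smooth_on_has_derivative[OF \<phi>(1,3)] by simp
    ultimately have "((\<lambda>y. (\<phi> (fst y), \<Sum>i\<in>UNIV. snd y $ i *\<^sub>R dd (axis i 1) \<phi> (fst y))) has_derivative
       (\<lambda>k. (dd (fst k) \<phi> x, dd (fst k) (dd w \<phi>) x + dd (snd k) \<phi> x))) (at (x, w))"
      by (rule has_derivative_Pair[rotated])
    from has_derivative_compose[OF this, of F'] smooth_on_has_derivative[OF F v]
    have "((\<lambda>y. F' (\<phi> (fst y), \<Sum>i\<in>UNIV. snd y $ i *\<^sub>R dd (axis i 1) \<phi> (fst y))) has_derivative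
       (\<lambda>k. dd (dd (fst k) \<phi> x, dd (fst k) (dd w \<phi>) x + dd (snd k) \<phi> x) F' (\<phi> x, v))) (at (x, w))"
      using w(2) lincomb[OF \<phi>(3), of w] by simp
    then have "(F has_derivative
       (\<lambda>k. dd (dd (fst k) \<phi> x, dd (fst k) (dd w \<phi>) x + dd (snd k) \<phi> x) F' (\<phi> x, v))) (at (x, w))"
    proof (rule has_derivative_transform_within_open)
      show "open (U \<inter> V \<times> UNIV)" using U \<phi>(2) by (simp add: open_Int open_Times)
      show "(x, w) \<in> U \<inter> V \<times> UNIV" using w \<phi>(3) by simp
      show "F' (\<phi> (fst y), \<Sum>i\<in>UNIV. snd y $ i *\<^sub>R dd (axis i 1) \<phi> (fst y)) = F y" if "y \<in> U \<inter> V \<times> UNIV" for y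
        using that rel[of "fst y" "snd y"] lincomb[of "fst y" "snd y"] by (auto simp: mem_Times_iff)
    qed
    from dd_has_derivative[OF this, of "(K h, - B (K h) w)"]
    have "dd (K h, - B (K h) w) F (x, w)
        = dd (dd (K h) \<phi> x, dd (K h) (dd w \<phi>) x + dd (- B (K h) w) \<phi> x) F' (\<phi> x, v)"
      unfolding fst_conv snd_conv .
    moreover have "dd (K h, - B (K h) w) F (x, w) = 0"
      using par w(1) unfolding parallel_at_def by blast
    ultimately have "dd (dd (K h) \<phi> x, dd (K h) (dd w \<phi>) x + dd (- B (K h) w) \<phi> x) F' (\<phi> x, v) = 0"
      by simp
    moreover have "dd (K h) (dd w \<phi>) x + dd (- B (K h) w) \<phi> x = - ?B' h v"
      using linear_neg[OF lin] by (simp add: w_def)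
    ultimately show ?thesis by (simp add: K(2))
  qed
  ultimately show ?thesis using sym unfolding parallel_at_def by blast
qed

section \<open>The spray in coordinates and the Cartan connection\<close>

lemma pdv_eq_dd: "pdv j F = dd (0, axis j 1) F"
  by (simp add: fun_eq_iff pdv_def)

lemma pdx_eq_dd: "pdx j F = dd (axis j 1, 0) F"
  by (simp add: fun_eq_iff pdx_def)

lemma pd_eq_dd: "pd j f = dd (axis j 1) f"
  by (simp add: fun_eq_iff pd_def)

lemma linear_axis_expansion:
  fixes f :: "real ^ 'n::finite \<Rightarrow> 'b::real_vector"
  assumes "linear f"
  shows "f u = (\<Sum>i\<in>UNIV. u $ i *\<^sub>R f (axis i 1))"
proof -
  have "f u = f (\<Sum>i\<in>UNIV. u $ i *\<^sub>R axis i 1)"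
    using basis_expansion[of u] by (simp add: scalar_mult_eq_scaleR)
  then show ?thesis by (simp add: linear_sum[OF assms] linear_cmul[OF assms])
qed

text \<open>\<open>fibre_metric\<close> and \<open>spray\<close> repeat the expressions of the
  Cartan connection for an arbitrary function on coordinate space, so that the analysis needs no
  atlas.\<close>

definition fibre_metric :: "((real ^ 'n::finite) \<times> (real ^ 'n) \<Rightarrow> real) \<Rightarrow> (real ^ 'n) \<times> (real ^ 'n) \<Rightarrow> real ^ 'n ^ 'n" where
  "fibre_metric F z = (\<chi> i j. pdv i (pdv j F) z / 2)"

definition spray :: "((real ^ 'n::finite) \<times> (real ^ 'n) \<Rightarrow> real) \<Rightarrow> 'n \<Rightarrow> (real ^ 'n) \<times> (real ^ 'n) \<Rightarrow> real" where
  "spray F i y = (\<Sum>q\<in>UNIV. matrix_inv (fibre_metric F y) $ i $ q *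
        ((\<Sum>m\<in>UNIV. snd y $ m * pdx m (pdv q F) y) - pdx q F y))"

lemma L_metric_eq: "L_metric At c L = fibre_metric (local_rep At c L)"
  by (simp add: fun_eq_iff L_metric_def fibre_metric_def)

lemma cartan_connection_eq: "cartan_connection At c L i j z = pdv j (spray (local_rep At c L) i) z / 4"
proof -
  have "(\<lambda>y. \<Sum>q\<in>UNIV. matrix_inv (L_metric At c L y) $ i $ q *
        ((\<Sum>m\<in>UNIV. snd y $ m * pdx m (pdv q (local_rep At c L)) y)
           - pdx q (local_rep At c L) y)) = spray (local_rep At c L) i"
    by (simp add: fun_eq_iff spray_def L_metric_eq)
  then show ?thesis by (simp only: cartan_connection_def)
qed

lemma linear_fibre_dd:
  fixes F :: "('a::real_normed_vector \<times> 'b::real_normed_vector) \<Rightarrow> 'c::real_normed_vector"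
  assumes "F differentiable (at z)"
  shows "linear (\<lambda>u. dd (0, u) F z)" "linear (\<lambda>u. dd (u, 0) F z)"
  using dd_fibre[OF assms] dd_base[OF assms] by (auto intro!: linearI)

lemma hessian_fibre_metric:
  assumes F: "smooth_on U F" and U: "open U" "z \<in> U"
  shows "dd (0, u) (dd (0, axis j 1) F) z = 2 * (fibre_metric F z *v u) $ j"
proof -
  have "dd (0, u) (dd (0, axis j 1) F) z = (\<Sum>i\<in>UNIV. u $ i *\<^sub>R dd (0, axis i 1) (dd (0, axis j 1) F) z)"
    by (rule linear_axis_expansion[OF linear_fibre_dd(1)[OF smooth_on_differentiable[OF smooth_on_dd[OF F] U(2)]]])
  also have "\<dots> = (\<Sum>i\<in>UNIV. u $ i * dd (0, axis j 1) (dd (0, axis i 1) F) z)"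
    using dd_commute_real[OF F U] by (intro sum.cong refl) simp
  finally show ?thesis
    by (simp add: fibre_metric_def matrix_vector_mult_def pdv_eq_dd sum_distrib_left mult.commute)
qed

lemma fibre_nondegenerateI:
  assumes F: "smooth_on U F" and U: "open U" and inv: "\<And>z. z \<in> U \<Longrightarrow> invertible (fibre_metric F z)"
  shows "fibre_nondegenerate U F"
  unfolding fibre_nondegenerate_def
proof (intro ballI allI impI)
  fix z u assume z: "z \<in> U" and 0: "\<forall>k. dd (0, u) (dd (0, k) F) z = 0"
  have "fibre_metric F z *v u = 0"
    using hessian_fibre_metric[OF F U z, where u = u] 0 by (simp add: vec_eq_iff)
  then have "(matrix_inv (fibre_metric F z) ** fibre_metric F z) *v u = 0"
    by (simp add: matrix_vector_mul_assoc[symmetric])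
  then show "u = 0" by (simp add: matrix_inv_left[OF inv[OF z]])
qed

text \<open>Solving the spray equation for w with the inverse metric. The factor 2 arises because
  the metric is half the Hessian.\<close>

lemma spray_eq_iff:
  assumes F: "smooth_on U F" and U: "open U" "(x, v) \<in> U" and inv: "invertible (fibre_metric F (x, v))"
  shows "(\<forall>k. dd (v, 0) (dd (0, k) F) (x, v) - dd (k, 0) F (x, v) = dd (0, w) (dd (0, k) F) (x, v))
     \<longleftrightarrow> (\<forall>i. spray F i (x, v) = 2 * w $ i)"
proof -
  note d = smooth_on_differentiable[OF F U(2)]
  note d2 = smooth_on_differentiable[OF smooth_on_dd[OF F] U(2)]
  let ?g = "fibre_metric F (x, v)"
  define E where "E = (\<chi> q. dd (v, 0) (dd (0, axis q 1) F) (x, v) - dd (axis q 1, 0) F (x, v))"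
  have "dd (v, 0) (dd (0, axis q 1) F) (x, v) = (\<Sum>m\<in>UNIV. v $ m *\<^sub>R dd (axis m 1, 0) (dd (0, axis q 1) F) (x, v))" for q
    by (rule linear_axis_expansion[OF linear_fibre_dd(2)[OF d2]])
  then have E: "spray F i (x, v) = (matrix_inv ?g *v E) $ i" for i
    by (simp add: spray_def E_def matrix_vector_mult_def pdx_eq_dd pdv_eq_dd)
  have "(\<forall>i. spray F i (x, v) = 2 * w $ i) \<longleftrightarrow> matrix_inv ?g *v E = 2 *\<^sub>R w"
    by (simp add: E vec_eq_iff)
  also have "\<dots> \<longleftrightarrow> E = ?g *v (2 *\<^sub>R w)"
    using matrix_inv_left[OF inv] matrix_inv_right[OF inv]
    by (metis matrix_vector_mul_assoc matrix_vector_mul_lid)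
  also have "\<dots> \<longleftrightarrow> (\<forall>q. dd (v, 0) (dd (0, axis q 1) F) (x, v) - dd (axis q 1, 0) F (x, v)
      = dd (0, w) (dd (0, axis q 1) F) (x, v))"
    by (simp add: vec_eq_iff E_def hessian_fibre_metric[OF F U] matrix_vector_mult_scaleR)
  also have "\<dots> \<longleftrightarrow> (\<forall>k. dd (v, 0) (dd (0, k) F) (x, v) - dd (k, 0) F (x, v) = dd (0, w) (dd (0, k) F) (x, v))"
  proof
    assume *: "\<forall>q. dd (v, 0) (dd (0, axis q 1) F) (x, v) - dd (axis q 1, 0) F (x, v)
      = dd (0, w) (dd (0, axis q 1) F) (x, v)"
    show "\<forall>k. dd (v, 0) (dd (0, k) F) (x, v) - dd (k, 0) F (x, v) = dd (0, w) (dd (0, k) F) (x, v)"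
    proof
      fix k
      \<comment> \<open>Linearity in k is immediate only when k is the outer direction of
        differentiation, so the mixed derivatives are exchanged before passing from basis vectors to
        all k.\<close>
      let ?l = "\<lambda>k. dd (0, k) (dd (v, 0) F) (x, v) - dd (k, 0) F (x, v) - dd (0, k) (dd (0, w) F) (x, v)"
      have "linear ?l" by (intro linear_compose_sub linear_fibre_dd d d2)
      from linear_axis_expansion[OF this, of k] * have "?l k = 0"
        using dd_commute_real[OF F U, of "(0, axis i 1)" "(v, 0)" for i]
          dd_commute_real[OF F U, of "(0, axis i 1)" "(0, w)" for i] by simp
      then show "dd (v, 0) (dd (0, k) F) (x, v) - dd (k, 0) F (x, v) = dd (0, w) (dd (0, k) F) (x, v)"
        using dd_commute_real[OF F U, of "(0, k)" "(v, 0)"] dd_commute_real[OF F U, of "(0, k)" "(0, w)"] by simp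
    qed
  qed blast
  finally show ?thesis by blast
qed

lemma smooth_on_vec_nth: "bounded_linear g \<Longrightarrow> open S \<Longrightarrow> smooth_on S (\<lambda>y. g y $ i)"
  by (rule smooth_on_bounded_linear) (simp add: bounded_linear_compose[OF bounded_linear_vec_nth])

lemma smooth_on_spray:
  assumes F: "smooth_on U F" and U: "open U" and inv: "\<And>z. z \<in> U \<Longrightarrow> invertible (fibre_metric F z)"
  shows "smooth_on U (spray F i)"
proof -
  have "smooth_on U (\<lambda>z. pdv i (pdv j F) z / 2)" for i j
    unfolding pdv_eq_dd by (intro smooth_on_divide U smooth_on_const smooth_on_dd F) simp
  then have "smooth_on U (\<lambda>z. fibre_metric F z $ i $ j)" for i j by (simp add: fibre_metric_def)
  then have "smooth_on U (\<lambda>z. \<Sum>q\<in>UNIV. matrix_inv (fibre_metric F z) $ i $ q *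
        ((\<Sum>m\<in>UNIV. snd z $ m * pdx m (pdv q F) z) - pdx q F z))"
    unfolding pdv_eq_dd pdx_eq_dd
    by (intro smooth_on_sum smooth_on_mult smooth_on_diff smooth_on_matrix_inv smooth_on_dd
        smooth_on_vec_nth[OF bounded_linear_snd] F U inv)
  then show ?thesis by (simp add: spray_def[abs_def])
qed

text \<open>On the fibre the spray is the quadratic map \<open>2 B v v\<close>; its derivative along
  \<open>axis j 1\<close> is \<open>4 B (axis j 1) v\<close>, and the 4 cancels the quarter in the
  Cartan coefficients.\<close>

lemma parallel_at_imp_cartan:
  assumes F: "smooth_on U F" and U: "open U" "(x, v) \<in> U"
    and inv: "\<And>z. z \<in> U \<Longrightarrow> invertible (fibre_metric F z)" and par: "parallel_at U F x B"
  shows "pdv j (spray F i) (x, v) / 4 = B (axis j 1) v $ i"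
proof -
  have B: "bilinear B" "\<And>u w. B u w = B w u" using par by (auto simp: parallel_at_def)
  note simps = bilinear_ladd[OF B(1)] bilinear_radd[OF B(1)] bilinear_lmul[OF B(1)] bilinear_rmul[OF B(1)]
  have val: "spray F i (x, w) = 2 * B w w $ i" if "(x, w) \<in> U" for w
    using parallel_at_spray[OF F U(1) that par] spray_eq_iff[OF F U(1) that inv[OF that]] by blast
  let ?q = "\<lambda>t. 2 * (B v v $ i + 2 * t * B (axis j 1) v $ i + t * t * B (axis j 1) (axis j 1) $ i)"
  have "((\<lambda>t. spray F i (x, v + t *\<^sub>R axis j 1)) has_field_derivative pdv j (spray F i) (x, v)) (at 0)"
    unfolding pdv_eq_dd by (rule fibre_line_derivative[OF smooth_on_spray[OF F U(1) inv] U(2)])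
  moreover have "eventually (\<lambda>t. spray F i (x, v + t *\<^sub>R axis j 1) = ?q t) (nhds 0)"
    using eventually_fibre_line[OF U, of "axis j 1"]
    by eventually_elim (simp add: val simps B(2)[of v "axis j 1"] algebra_simps)
  ultimately have "(?q has_field_derivative pdv j (spray F i) (x, v)) (at 0)"
    by (rule DERIV_transfer_nhds)
  moreover have "(?q has_field_derivative 4 * B (axis j 1) v $ i) (at 0)"
    by (auto intro!: derivative_eq_intros)
  ultimately show ?thesis using DERIV_unique by fastforce
qed

text \<open>Each fibre derivative lowers the degree by one: the metric has degree 0 and the bracket
  that it is contracted with has degree 2.\<close>

lemma spray_scaling:
  assumes F: "smooth_on U F" and U: "open U"
    and cone: "\<And>y w r. (y, w) \<in> U \<Longrightarrow> r > 0 \<Longrightarrow> (y, r *\<^sub>R w) \<in> U"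
    and hom: "\<And>y w r. (y, w) \<in> U \<Longrightarrow> r > 0 \<Longrightarrow> F (y, r *\<^sub>R w) = r\<^sup>2 * F (y, w)"
    and z: "(x, v) \<in> U" and r: "r > 0"
  shows "spray F i (x, r *\<^sub>R v) = r\<^sup>2 * spray F i (x, v)"
proof -
  note dF = smooth_on_differentiable[OF F] and dF2 = smooth_on_differentiable[OF smooth_on_dd[OF F]]
  have 1: "dd (h, r *\<^sub>R k) F (y, r *\<^sub>R w) = r\<^sup>2 * dd (h, k) F (y, w)" if "(y, w) \<in> U" for y w h k
    by (rule dd_scaling[OF U that hom[OF _ r] dF[OF that] dF[OF cone[OF that r]]])
  have fib: "dd (0, k) F (y, r *\<^sub>R w) = r * dd (0, k) F (y, w)" if "(y, w) \<in> U" for y w k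
    using 1[OF that, of 0 k] r by (simp add: dd_fibre[OF dF[OF cone[OF that r]]] power2_eq_square)
  have 2: "dd (h, r *\<^sub>R u) (dd (0, k) F) (x, r *\<^sub>R v) = r * dd (h, u) (dd (0, k) F) (x, v)" for h k u
    by (rule dd_scaling[OF U z fib dF2[OF z] dF2[OF cone[OF z r]]])
  have "dd (0, u) (dd (0, k) F) (x, r *\<^sub>R v) = dd (0, u) (dd (0, k) F) (x, v)" for k u
    using 2[where h = 0 and u = u and k = k] r by (simp add: dd_fibre[OF dF2[OF cone[OF z r]]])
  then have "fibre_metric F (x, r *\<^sub>R v) = fibre_metric F (x, v)" by (simp add: fibre_metric_def pdv_eq_dd)
  moreover have "dd (h, 0) (dd (0, k) F) (x, r *\<^sub>R v) = r * dd (h, 0) (dd (0, k) F) (x, v)" for h k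
    using 2[where h = h and u = 0 and k = k] by simp
  moreover have "dd (h, 0) F (x, r *\<^sub>R v) = r\<^sup>2 * dd (h, 0) F (x, v)" for h
    using 1[OF z, of h 0] by simp
  ultimately show ?thesis
    by (simp add: spray_def pdx_eq_dd pdv_eq_dd sum_distrib_left power2_eq_square algebra_simps)
qed

definition bilin_of :: "('n \<Rightarrow> 'n \<Rightarrow> 'n \<Rightarrow> real) \<Rightarrow> real ^ 'n::finite \<Rightarrow> real ^ 'n \<Rightarrow> real ^ 'n" where
  "bilin_of C u w = (\<chi> i. \<Sum>j\<in>UNIV. \<Sum>k\<in>UNIV. C i j k * u $ j * w $ k)"

lemma bilinear_bilin_of: "bilinear (bilin_of C)"
  by (auto simp: bilinear_def bilin_of_def vec_eq_iff algebra_simps sum.distrib sum_distrib_left intro!: linearI)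

lemma bilin_of_axis: "bilin_of C (axis j 1) (axis k 1) $ i = C i j k"
  by (simp add: bilin_of_def axis_def if_distrib[where f = "\<lambda>x. _ * x"] if_distrib[where f = "\<lambda>x. x * _"] cong: if_cong)

lemma bilin_of_axis_left: "bilin_of C (axis j 1) w $ i = (\<Sum>k\<in>UNIV. C i j k * w $ k)"
proof -
  have "(\<Sum>k\<in>UNIV. C i j' k * (axis j 1 :: real ^ _) $ j' * w $ k) = (if j' = j then (\<Sum>k\<in>UNIV. C i j k * w $ k) else 0)" for j'
    by (simp add: axis_def)
  then show ?thesis by (simp add: bilin_of_def)
qed

lemma bilin_of_sym: "(\<And>i j k. C i j k = C i k j) \<Longrightarrow> bilin_of C u w = bilin_of C w u"
  unfolding bilin_of_def vec_eq_iff vec_lambda_beta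
  by (subst sum.swap) (simp add: mult.commute mult.left_commute)

lemma bilinear_eq_bilin_of:
  assumes "bilinear B"
  shows "B u w = bilin_of (\<lambda>i j k. B (axis j 1) (axis k 1) $ i) u w"
proof -
  have l: "linear (\<lambda>u. B u w)" "linear (B u)" for u w using assms by (auto simp: bilinear_def)
  have "B u w = (\<Sum>j\<in>UNIV. u $ j *\<^sub>R (\<Sum>k\<in>UNIV. w $ k *\<^sub>R B (axis j 1) (axis k 1)))"
    using linear_axis_expansion[OF l(1)] linear_axis_expansion[OF l(2)] by (metis (no_types, lifting) sum.cong)
  then show ?thesis by (simp add: bilin_of_def vec_eq_iff sum_distrib_left mult.commute mult.left_commute)
qed

text \<open>A further fibre derivative shows that the coefficients are a quarter of the second fibre
  derivatives of the spray at any vector of the fibre. This gives their symmetry here, and the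
  second conclusion lets smoothness in x be read off later.\<close>

lemma cartan_imp_parallel_at:
  assumes F: "smooth_on U F" and U: "open U"
    and inv: "\<And>z. z \<in> U \<Longrightarrow> invertible (fibre_metric F z)"
    and cone: "\<And>y w r. (y, w) \<in> U \<Longrightarrow> r > 0 \<Longrightarrow> (y, r *\<^sub>R w) \<in> U"
    and hom: "\<And>y w r. (y, w) \<in> U \<Longrightarrow> r > 0 \<Longrightarrow> F (y, r *\<^sub>R w) = r\<^sup>2 * F (y, w)"
    and lin: "\<And>v i j. (x, v) \<in> U \<Longrightarrow> pdv j (spray F i) (x, v) / 4 = (\<Sum>k\<in>UNIV. C i j k * v $ k)"
    and ne: "(x, v) \<in> U"
  shows "parallel_at U F x (bilin_of C)" "C i j k = pdv k (pdv j (spray F i)) (x, v) / 4"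
proof -
  note S = smooth_on_spray[OF F U inv]
  have C: "C i j k = pdv k (pdv j (spray F i)) (x, v) / 4" if v: "(x, v) \<in> U" for i j k v
  proof -
    have "((\<lambda>t. pdv j (spray F i) (x, v + t *\<^sub>R axis k 1)) has_field_derivative pdv k (pdv j (spray F i)) (x, v)) (at 0)"
      unfolding pdv_eq_dd by (rule fibre_line_derivative[OF smooth_on_dd[OF S] v])
    moreover have "eventually (\<lambda>t. pdv j (spray F i) (x, v + t *\<^sub>R axis k 1) = 4 * (\<Sum>l\<in>UNIV. C i j l * v $ l) + t * (4 * C i j k)) (nhds 0)"
      using eventually_fibre_line[OF U v, of "axis k 1"]
    proof eventually_elim
      case (elim t)
      have "(\<Sum>l\<in>UNIV. C i j l * (v + t *\<^sub>R axis k 1) $ l) = (\<Sum>l\<in>UNIV. C i j l * v $ l + (if l = k then t * C i j k else 0))"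
        by (intro sum.cong refl) (simp add: axis_def algebra_simps)
      then show ?case using lin[OF elim, of j i] by (simp add: sum.distrib)
    qed
    ultimately have "((\<lambda>t. 4 * (\<Sum>l\<in>UNIV. C i j l * v $ l) + t * (4 * C i j k)) has_field_derivative
        pdv k (pdv j (spray F i)) (x, v)) (at 0)"
      by (rule DERIV_transfer_nhds)
    moreover have "((\<lambda>t. 4 * (\<Sum>l\<in>UNIV. C i j l * v $ l) + t * (4 * C i j k)) has_field_derivative 4 * C i j k) (at 0)"
      by (auto intro!: derivative_eq_intros)
    ultimately show ?thesis using DERIV_unique by fastforce
  qed
  show "C i j k = pdv k (pdv j (spray F i)) (x, v) / 4" by (rule C[OF ne])
  have sym: "C i j k = C i k j" for i j k
    unfolding C[OF ne] pdv_eq_dd using dd_commute_real[OF S U ne] by metis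
  have val: "spray F i (x, v) = 2 * bilin_of C v v $ i" if v: "(x, v) \<in> U" for i v
  proof -
    note d = smooth_on_differentiable[OF S v]
    \<comment> \<open>Euler's theorem in degree two recovers the spray from its first derivatives,
      which are linear in v by assumption.\<close>
    have "2 * spray F i (x, v) = dd (0, v) (spray F i) (x, v)"
      using euler_homogeneous[OF d, where n = 2] spray_scaling[OF F U cone hom v] by simp
    also have "\<dots> = (\<Sum>j\<in>UNIV. v $ j *\<^sub>R dd (0, axis j 1) (spray F i) (x, v))"
      by (rule linear_axis_expansion[OF linear_fibre_dd(1)[OF d]])
    also have "\<dots> = (\<Sum>j\<in>UNIV. v $ j * (4 * (\<Sum>k\<in>UNIV. C i j k * v $ k)))"
      using lin[OF v] by (simp add: pdv_eq_dd field_simps)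
    also have "\<dots> = 4 * bilin_of C v v $ i"
      by (simp add: bilin_of_def sum_distrib_left mult.commute mult.left_commute)
    finally show ?thesis by simp
  qed
  show "parallel_at U F x (bilin_of C)"
  proof (rule spray_parallel_at[OF F U cone hom bilinear_bilin_of bilin_of_sym[OF sym]])
    show "dd (v, 0) (dd (0, k) F) (x, v) - dd (k, 0) F (x, v) = dd (0, bilin_of C v v) (dd (0, k) F) (x, v)"
      if "(x, v) \<in> U" for v k
      using spray_eq_iff[OF F U that inv[OF that], of "bilin_of C v v"] val[OF that] by blast
  qed
qed

section \<open>Levi-Civita connection and $(\alpha,\beta)$-Lagrangians\<close>

definition quad_form :: "('n \<Rightarrow> 'n \<Rightarrow> real ^ 'n \<Rightarrow> real) \<Rightarrow> (real ^ 'n::finite) \<times> (real ^ 'n) \<Rightarrow> real" where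
  "quad_form g z = (\<Sum>i\<in>UNIV. \<Sum>j\<in>UNIV. g i j (fst z) * snd z $ i * snd z $ j)"

definition lin_form :: "('n \<Rightarrow> real ^ 'n \<Rightarrow> real) \<Rightarrow> (real ^ 'n::finite) \<times> (real ^ 'n) \<Rightarrow> real" where
  "lin_form b z = (\<Sum>i\<in>UNIV. b i (fst z) * snd z $ i)"

definition levi_civita :: "('n \<Rightarrow> 'n \<Rightarrow> real ^ 'n \<Rightarrow> real) \<Rightarrow> real ^ 'n::finite \<Rightarrow> 'n \<Rightarrow> 'n \<Rightarrow> 'n \<Rightarrow> real" where
  "levi_civita g x i j k = (\<Sum>l\<in>UNIV. matrix_inv (\<chi> i j. g i j x) $ i $ l *
        (pd j (g l k) x + pd k (g j l) x - pd l (g j k) x)) / 2"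

definition cov_deriv :: "('n \<Rightarrow> 'n \<Rightarrow> real ^ 'n \<Rightarrow> real) \<Rightarrow> ('n \<Rightarrow> real ^ 'n \<Rightarrow> real) \<Rightarrow> real ^ 'n::finite \<Rightarrow> 'n \<Rightarrow> 'n \<Rightarrow> real" where
  "cov_deriv g b x i j = pd i (b j) x - (\<Sum>k\<in>UNIV. levi_civita g x k i j * b k x)"

lemma smooth_on_fst:
  fixes f :: "'a::real_normed_vector \<Rightarrow> 'c::real_normed_vector"
  assumes "open X" "smooth_on X f"
  shows "smooth_on (X \<times> (UNIV :: 'b::real_normed_vector set)) (\<lambda>z. f (fst z))"
  using smooth_on_affine_pre[OF bounded_linear_fst assms, of "X \<times> (UNIV :: 'b set)" 0] assms(1)
  by (simp add: open_Times mem_Times_iff)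

lemma smooth_on_snd_nth: "open S \<Longrightarrow> smooth_on S (\<lambda>z. snd z $ i)"
  by (rule smooth_on_vec_nth[OF bounded_linear_snd])

lemma smooth_on_quad_form:
  assumes "open X" "\<And>i j. smooth_on X (g i j)"
  shows "smooth_on (X \<times> UNIV) (quad_form g)"
  unfolding quad_form_def[abs_def] using assms
  by (intro smooth_on_sum smooth_on_mult smooth_on_snd_nth smooth_on_fst) (auto intro: open_Times)

lemma smooth_on_lin_form:
  assumes "open X" "\<And>i. smooth_on X (b i)"
  shows "smooth_on (X \<times> UNIV) (lin_form b)"
  unfolding lin_form_def[abs_def] using assms
  by (intro smooth_on_sum smooth_on_mult smooth_on_snd_nth smooth_on_fst) (auto intro: open_Times)

lemma has_derivative_fst_compose:
  assumes "f differentiable (at x)"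
  shows "((\<lambda>z. f (fst z)) has_derivative (\<lambda>h. dd (fst h) f x)) (at (x, v))"
  using has_derivative_compose[OF has_derivative_fst[OF has_derivative_ident], of f "\<lambda>k. dd k f x" "(x, v)" UNIV]
    has_derivative_dd[OF assms] by simp

lemma has_derivative_snd_nth: "((\<lambda>z. snd z $ i) has_derivative (\<lambda>h. snd h $ i)) (at z)"
  by (rule bounded_linear.has_derivative[OF bounded_linear_vec_nth has_derivative_snd[OF has_derivative_ident]])

lemma dd_quad_form:
  assumes g: "\<And>i j. g i j differentiable (at x)" and sym: "\<And>i j. g i j x = g j i x"
  shows "dd (h, k) (quad_form g) (x, v) =
    (\<Sum>i\<in>UNIV. \<Sum>j\<in>UNIV. dd h (g i j) x * v $ i * v $ j) + 2 * (\<Sum>i\<in>UNIV. \<Sum>j\<in>UNIV. g i j x * v $ i * k $ j)"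
proof -
  have "(quad_form g has_derivative (\<lambda>h. \<Sum>i\<in>UNIV. \<Sum>j\<in>UNIV.
      (g i j (fst (x, v)) * snd (x, v) $ i) * snd h $ j
       + (g i j (fst (x, v)) * snd h $ i + dd (fst h) (g i j) x * snd (x, v) $ i) * snd (x, v) $ j)) (at (x, v))"
    unfolding quad_form_def[abs_def]
    by (intro has_derivative_sum has_derivative_mult has_derivative_fst_compose has_derivative_snd_nth g)
  from dd_has_derivative[OF this, of "(h, k)"]
  have "dd (h, k) (quad_form g) (x, v) = (\<Sum>i\<in>UNIV. \<Sum>j\<in>UNIV. g i j x * v $ i * k $ j)
      + (\<Sum>i\<in>UNIV. \<Sum>j\<in>UNIV. g i j x * k $ i * v $ j) + (\<Sum>i\<in>UNIV. \<Sum>j\<in>UNIV. dd h (g i j) x * v $ i * v $ j)"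
    by (simp add: sum.distrib algebra_simps)
  moreover have "(\<Sum>i\<in>UNIV. \<Sum>j\<in>UNIV. g i j x * k $ i * v $ j) = (\<Sum>i\<in>UNIV. \<Sum>j\<in>UNIV. g i j x * v $ i * k $ j)"
    by (subst sum.swap) (simp add: sym mult.commute mult.left_commute)
  ultimately show ?thesis by simp
qed

lemma dd_lin_form:
  assumes b: "\<And>i. b i differentiable (at x)"
  shows "dd (h, k) (lin_form b) (x, v) = (\<Sum>i\<in>UNIV. dd h (b i) x * v $ i) + (\<Sum>i\<in>UNIV. b i x * k $ i)"
proof -
  have "(lin_form b has_derivative (\<lambda>h. \<Sum>i\<in>UNIV. b i (fst (x, v)) * snd h $ i + dd (fst h) (b i) x * snd (x, v) $ i)) (at (x, v))"
    unfolding lin_form_def[abs_def]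
    by (intro has_derivative_sum has_derivative_mult has_derivative_fst_compose has_derivative_snd_nth b)
  from dd_has_derivative[OF this, of "(h, k)"] show ?thesis by (simp add: sum.distrib)
qed

text \<open>Makes the quadratic form of a metric nondegenerate on the fibres, so that uniqueness of
  parallel maps also applies to the Levi-Civita connection.\<close>

lemma fibre_metric_quad_form:
  assumes X: "open X" "x \<in> X" and g: "\<And>i j. smooth_on X (g i j)" and sym: "\<And>i j y. y \<in> X \<Longrightarrow> g i j y = g j i y"
  shows "fibre_metric (quad_form g) (x, v) = (\<chi> i j. g i j x)"
proof -
  have "pdv i (pdv j (quad_form g)) (x, v) = 2 * g i j x" for i j
  proof -
    have 1: "pdv j (quad_form g) z = 2 * lin_form (\<lambda>i. g i j) z" if z: "z \<in> X \<times> UNIV" for z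
    proof -
      obtain y w where zy: "z = (y, w)" "y \<in> X" using z by auto
      have "(\<Sum>l\<in>UNIV. g i l y * w $ i * (axis j 1 :: real ^ _) $ l) = g i j y * w $ i" for i
        by (simp add: axis_def if_distrib[where f = "\<lambda>x. _ * x"] cong: if_cong)
      then show ?thesis
        using dd_quad_form[where g = g and x = y and h = 0 and k = "axis j 1" and v = w] sym[OF zy(2)] smooth_on_differentiable[OF g zy(2)]
          dd_linear[OF smooth_on_differentiable[OF g zy(2)], THEN linear_0]
        by (simp add: pdv_eq_dd zy lin_form_def)
    qed
    have d: "\<And>i. g i j differentiable (at x)" by (rule smooth_on_differentiable[OF g X(2)])
    have "pdv i (pdv j (quad_form g)) (x, v) = pdv i (\<lambda>z. 2 * lin_form (\<lambda>i. g i j) z) (x, v)"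
      unfolding pdv_eq_dd[of i] by (rule dd_cong_open[of "X \<times> UNIV"]) (use X 1 in \<open>auto intro: open_Times\<close>)
    also have "\<dots> = 2 * dd (0, axis i 1) (lin_form (\<lambda>i. g i j)) (x, v)"
      unfolding pdv_eq_dd
      by (rule dd_has_derivative[OF has_derivative_mult_right[OF smooth_on_has_derivative[OF smooth_on_lin_form[OF X(1) g]]]])
        (use X in auto)
    also have "\<dots> = 2 * g i j x"
      using dd_linear[OF d, THEN linear_0]
      by (simp add: dd_lin_form[OF d] axis_def if_distrib[where f = "\<lambda>x. _ * x"] cong: if_cong)
    finally show ?thesis .
  qed
  then show ?thesis by (simp add: fibre_metric_def vec_eq_iff)
qed

lemma levi_civita_sym:
  assumes "open X" "x \<in> X" "\<And>i j y. y \<in> X \<Longrightarrow> g i j y = g j i y"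
  shows "levi_civita g x i j k = levi_civita g x i k j"
proof -
  have "pd m (g i j) x = pd m (g j i) x" for m i j
    unfolding pd_eq_dd by (rule dd_cong_open[OF assms(1,2)]) (rule assms(3))
  then have "pd j (g l k) x + pd k (g j l) x - pd l (g j k) x = pd k (g l j) x + pd j (g k l) x - pd l (g k j) x" for l
    by (smt (verit))
  then show ?thesis by (simp add: levi_civita_def)
qed

lemma smooth_on_levi_civita:
  assumes "open X" "\<And>i j. smooth_on X (g i j)" "\<And>y. y \<in> X \<Longrightarrow> invertible (\<chi> i j. g i j y)"
  shows "smooth_on X (\<lambda>x. levi_civita g x i j k)"
  unfolding levi_civita_def pd_eq_dd using assms
  by (intro smooth_on_divide smooth_on_sum smooth_on_mult smooth_on_diff smooth_on_add smooth_on_const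
      smooth_on_matrix_inv smooth_on_dd) auto

text \<open>Christoffel symbols of the first kind: lowering the index cancels the inverse
  metric.\<close>

lemma lower_levi_civita:
  assumes inv: "invertible (\<chi> i j. g i j x)"
  shows "(\<Sum>i\<in>UNIV. g m i x * levi_civita g x i j k) = (pd j (g m k) x + pd k (g j m) x - pd m (g j k) x) / 2"
proof -
  let ?g = "\<chi> i j. g i j x"
  define e where "e = (\<chi> l. pd j (g l k) x + pd k (g j l) x - pd l (g j k) x)"
  define y where "y = matrix_inv ?g *v e"
  have lc: "levi_civita g x i j k = y $ i / 2" for i
    by (simp add: levi_civita_def matrix_vector_mult_def e_def y_def)
  have "(\<Sum>i\<in>UNIV. g m i x * levi_civita g x i j k) = (?g *v y) $ m / 2"
    unfolding lc by (simp add: matrix_vector_mult_def sum_divide_distrib)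
  then show ?thesis by (simp add: y_def matrix_vector_mul_assoc matrix_inv_right[OF inv] e_def)
qed

lemma dd_pd: "f differentiable (at x) \<Longrightarrow> dd h f x = (\<Sum>j\<in>UNIV. h $ j * pd j f x)"
  using linear_axis_expansion[OF dd_linear, of f x h] by (simp add: pd_eq_dd)

text \<open>Lowering the index turns the vertical part into symbols of the first kind contracted
  with h, v and v. Of their three terms two cancel, being contracted with the same vector twice, and
  the third is the base derivative of the quadratic form.\<close>

lemma levi_civita_metric_compatible:
  assumes X: "open X" "x \<in> X" and g: "\<And>i j. smooth_on X (g i j)" and sym: "\<And>i j y. y \<in> X \<Longrightarrow> g i j y = g j i y"
    and inv: "invertible (\<chi> i j. g i j x)"
  shows "dd (h, - bilin_of (levi_civita g x) h v) (quad_form g) (x, v) = 0"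
proof -
  note d = smooth_on_differentiable[OF g X(2)]
  let ?G = "bilin_of (levi_civita g x) h v"
  have pd_sym: "pd m (g i j) x = pd m (g j i) x" for m i j
    unfolding pd_eq_dd by (rule dd_cong_open[OF X]) (rule sym)
  have "(\<Sum>i\<in>UNIV. g m i x * ?G $ i) = (\<Sum>i\<in>UNIV. \<Sum>j\<in>UNIV. \<Sum>k\<in>UNIV. g m i x * levi_civita g x i j k * h $ j * v $ k)" for m
    by (simp add: bilin_of_def sum_distrib_left mult.assoc)
  also have "\<And>m. (\<Sum>i\<in>UNIV. \<Sum>j\<in>UNIV. \<Sum>k\<in>UNIV. g m i x * levi_civita g x i j k * h $ j * v $ k)
      = (\<Sum>j\<in>UNIV. \<Sum>k\<in>UNIV. \<Sum>i\<in>UNIV. g m i x * levi_civita g x i j k * h $ j * v $ k)"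
    by (subst sum.swap, rule sum.cong[OF refl], rule sum.swap)
  also have "\<And>m. \<dots> m = (\<Sum>j\<in>UNIV. \<Sum>k\<in>UNIV. (pd j (g m k) x + pd k (g j m) x - pd m (g j k) x) / 2 * h $ j * v $ k)"
    by (simp only: sum_distrib_right[symmetric] lower_levi_civita[where g = g and x = x, OF inv])
  finally have low: "(\<Sum>i\<in>UNIV. g m i x * ?G $ i)
      = (\<Sum>j\<in>UNIV. \<Sum>k\<in>UNIV. (pd j (g m k) x + pd k (g j m) x - pd m (g j k) x) / 2 * h $ j * v $ k)" for m .
  have "2 * (\<Sum>i\<in>UNIV. \<Sum>j\<in>UNIV. g i j x * v $ i * ?G $ j) = 2 * (\<Sum>m\<in>UNIV. v $ m * (\<Sum>i\<in>UNIV. g m i x * ?G $ i))"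
    by (simp add: sum_distrib_left mult.commute mult.left_commute)
  also have "\<dots> = (\<Sum>m\<in>UNIV. \<Sum>j\<in>UNIV. \<Sum>k\<in>UNIV. h $ j * pd j (g m k) x * v $ m * v $ k)
      + ((\<Sum>m\<in>UNIV. \<Sum>j\<in>UNIV. \<Sum>k\<in>UNIV. h $ j * pd k (g j m) x * v $ m * v $ k)
       - (\<Sum>m\<in>UNIV. \<Sum>j\<in>UNIV. \<Sum>k\<in>UNIV. h $ j * pd m (g j k) x * v $ m * v $ k))"
    unfolding low
    by (simp add: sum_distrib_left sum.distrib[symmetric] sum_subtractf[symmetric] algebra_simps add_divide_distrib diff_divide_distrib)
  \<comment> \<open>The two indices contracted with v are renamed into each other; this is the
    cancellation.\<close>
  also have "(\<Sum>m\<in>UNIV. \<Sum>j\<in>UNIV. \<Sum>k\<in>UNIV. h $ j * pd k (g j m) x * v $ m * v $ k)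
      = (\<Sum>m\<in>UNIV. \<Sum>j\<in>UNIV. \<Sum>k\<in>UNIV. h $ j * pd m (g j k) x * v $ m * v $ k)"
  proof -
    have "(\<Sum>m\<in>UNIV. \<Sum>j\<in>UNIV. \<Sum>k\<in>UNIV. h $ j * pd k (g j m) x * v $ m * v $ k)
        = (\<Sum>j\<in>UNIV. \<Sum>m\<in>UNIV. \<Sum>k\<in>UNIV. h $ j * pd k (g j m) x * v $ m * v $ k)" by (rule sum.swap)
    also have "\<dots> = (\<Sum>j\<in>UNIV. \<Sum>k\<in>UNIV. \<Sum>m\<in>UNIV. h $ j * pd k (g j m) x * v $ m * v $ k)"
      by (rule sum.cong[OF refl]) (rule sum.swap)
    also have "\<dots> = (\<Sum>k\<in>UNIV. \<Sum>j\<in>UNIV. \<Sum>m\<in>UNIV. h $ j * pd k (g j m) x * v $ m * v $ k)" by (rule sum.swap)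
    finally show ?thesis by (simp add: mult.commute mult.left_commute)
  qed
  also have "(\<Sum>m\<in>UNIV. \<Sum>j\<in>UNIV. \<Sum>k\<in>UNIV. h $ j * pd j (g m k) x * v $ m * v $ k)
      = (\<Sum>i\<in>UNIV. \<Sum>j\<in>UNIV. dd h (g i j) x * v $ i * v $ j)"
  proof (rule sum.cong[OF refl])
    fix m
    have "(\<Sum>j\<in>UNIV. \<Sum>k\<in>UNIV. h $ j * pd j (g m k) x * v $ m * v $ k)
        = (\<Sum>k\<in>UNIV. \<Sum>j\<in>UNIV. h $ j * pd j (g m k) x * v $ m * v $ k)" by (rule sum.swap)
    then show "(\<Sum>j\<in>UNIV. \<Sum>k\<in>UNIV. h $ j * pd j (g m k) x * v $ m * v $ k) = (\<Sum>j\<in>UNIV. dd h (g m j) x * v $ m * v $ j)"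
      by (simp add: dd_pd[OF d] sum_distrib_right)
  qed
  finally show ?thesis
    by (simp add: dd_quad_form[OF d sym[OF X(2)]] sum_negf)
qed

lemma levi_civita_parallel_at:
  assumes X: "open X" "x \<in> X" and g: "\<And>i j. smooth_on X (g i j)" and sym: "\<And>i j y. y \<in> X \<Longrightarrow> g i j y = g j i y"
    and inv: "invertible (\<chi> i j. g i j x)"
  shows "parallel_at (X \<times> UNIV) (quad_form g) x (bilin_of (levi_civita g x))"
  unfolding parallel_at_def
proof (intro conjI allI impI)
  show "bilin_of (levi_civita g x) u w = bilin_of (levi_civita g x) w u" for u w
    by (rule bilin_of_sym) (rule levi_civita_sym[OF X sym])
  show "dd (h, - bilin_of (levi_civita g x) h v) (quad_form g) (x, v) = 0" for h v
    by (rule levi_civita_metric_compatible[OF X g sym inv])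
qed (rule bilinear_bilin_of)

text \<open>Horizontal differentiation of the function \<open>\<beta>\<close> on the tangent space
  is covariant differentiation of b; the vertical part of the lift supplies the Christoffel
  term.\<close>

lemma dd_lin_form_horizontal:
  assumes b: "\<And>i. b i differentiable (at x)"
  shows "dd (h, - bilin_of (levi_civita g x) h v) (lin_form b) (x, v)
    = (\<Sum>i\<in>UNIV. \<Sum>k\<in>UNIV. cov_deriv g b x i k * h $ i * v $ k)"
proof -
  have "(\<Sum>l\<in>UNIV. b l x * bilin_of (levi_civita g x) h v $ l)
      = (\<Sum>l\<in>UNIV. \<Sum>i\<in>UNIV. \<Sum>k\<in>UNIV. levi_civita g x l i k * b l x * h $ i * v $ k)"
    by (simp add: bilin_of_def sum_distrib_left mult.commute mult.left_commute)
  also have "\<dots> = (\<Sum>i\<in>UNIV. \<Sum>k\<in>UNIV. \<Sum>l\<in>UNIV. levi_civita g x l i k * b l x * h $ i * v $ k)"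
    by (subst sum.swap, rule sum.cong[OF refl], rule sum.swap)
  finally have 1: "(\<Sum>l\<in>UNIV. b l x * bilin_of (levi_civita g x) h v $ l)
      = (\<Sum>i\<in>UNIV. \<Sum>k\<in>UNIV. (\<Sum>l\<in>UNIV. levi_civita g x l i k * b l x) * h $ i * v $ k)"
    by (simp add: sum_distrib_right)
  have "(\<Sum>k\<in>UNIV. dd h (b k) x * v $ k) = (\<Sum>k\<in>UNIV. \<Sum>i\<in>UNIV. pd i (b k) x * h $ i * v $ k)"
    by (simp add: dd_pd[OF b] sum_distrib_left mult.commute mult.left_commute)
  also have "\<dots> = (\<Sum>i\<in>UNIV. \<Sum>k\<in>UNIV. pd i (b k) x * h $ i * v $ k)" by (rule sum.swap)
  finally show ?thesis
    by (simp add: dd_lin_form[OF b] sum_negf 1 cov_deriv_def sum_subtractf[symmetric] left_diff_distrib)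
qed

lemma dd_alpha_beta:
  fixes \<alpha> \<beta> :: "'a::real_normed_vector \<Rightarrow> real"
  assumes S: "open S" "z \<in> S" and F: "\<And>y. y \<in> S \<Longrightarrow> F y = \<Omega> ((\<beta> y)\<^sup>2 / \<alpha> y) * \<alpha> y"
    and d: "\<alpha> differentiable (at z)" "\<beta> differentiable (at z)" and nz: "\<alpha> z \<noteq> 0"
    and \<Omega>: "(\<Omega> has_field_derivative \<Omega>1) (at ((\<beta> z)\<^sup>2 / \<alpha> z))"
  shows "dd h F z = \<Omega>1 * (2 * \<beta> z * dd h \<beta> z - (\<beta> z)\<^sup>2 / \<alpha> z * dd h \<alpha> z) + \<Omega> ((\<beta> z)\<^sup>2 / \<alpha> z) * dd h \<alpha> z"
proof -
  note da = has_derivative_dd[OF d(1)] and db = has_derivative_dd[OF d(2)]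
  have s: "((\<lambda>y. (\<beta> y)\<^sup>2 / \<alpha> y) has_derivative
      (\<lambda>h. 2 * \<beta> z * dd h \<beta> z / \<alpha> z - (\<beta> z)\<^sup>2 * dd h \<alpha> z / (\<alpha> z)\<^sup>2)) (at z)"
    by (rule derivative_eq_intros da db nz refl)+
      (use nz in \<open>auto simp: fun_eq_iff field_simps power2_eq_square\<close>)
  have "((\<lambda>y. \<Omega> ((\<beta> y)\<^sup>2 / \<alpha> y)) has_derivative
      (\<lambda>h. \<Omega>1 * (2 * \<beta> z * dd h \<beta> z / \<alpha> z - (\<beta> z)\<^sup>2 * dd h \<alpha> z / (\<alpha> z)\<^sup>2))) (at z)"
    using has_derivative_compose[OF s, of \<Omega> "(*) \<Omega>1"] \<Omega> by (simp add: has_field_derivative_def)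
  from has_derivative_mult[OF this da]
  have "(F has_derivative (\<lambda>h. \<Omega> ((\<beta> z)\<^sup>2 / \<alpha> z) * dd h \<alpha> z
      + \<Omega>1 * (2 * \<beta> z * dd h \<beta> z / \<alpha> z - (\<beta> z)\<^sup>2 * dd h \<alpha> z / (\<alpha> z)\<^sup>2) * \<alpha> z)) (at z)"
    by (rule has_derivative_transform_within_open[OF _ S]) (simp add: F)
  moreover have "\<Omega>1 * (2 * \<beta> z * dd h \<beta> z / \<alpha> z - (\<beta> z)\<^sup>2 * dd h \<alpha> z / (\<alpha> z)\<^sup>2) * \<alpha> z
      = \<Omega>1 * (2 * \<beta> z * dd h \<beta> z - (\<beta> z)\<^sup>2 / \<alpha> z * dd h \<alpha> z)"
    using nz by (simp add: field_simps power2_eq_square)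
  ultimately show ?thesis using dd_has_derivative[of F _ z h] by simp
qed

section \<open>Charts\<close>

definition overlap :: "('m, 'n::finite) chart \<Rightarrow> ('m, 'n) chart \<Rightarrow> (real ^ 'n) set" where
  "overlap c d = chart_map c ` (chart_dom c \<inter> chart_dom d)"

locale smooth_manifold =
  fixes At :: "('m::topological_space, 'n::finite) chart set"
  assumes atlas: "smooth_atlas At"
begin

lemma atlas_chart: "c \<in> At \<Longrightarrow> is_chart c"
  using atlas by (simp add: smooth_atlas_def)

lemma open_chart_img: "c \<in> At \<Longrightarrow> open (chart_img c)"
  using atlas_chart by (auto simp: is_chart_def)

lemma chart_inv_map: "c \<in> At \<Longrightarrow> p \<in> chart_dom c \<Longrightarrow> chart_inv c (chart_map c p) = p"
  using atlas_chart[of c] by (auto simp: is_chart_def homeomorphism_def)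

lemma chart_map_inv: "c \<in> At \<Longrightarrow> x \<in> chart_img c \<Longrightarrow> chart_map c (chart_inv c x) = x"
  using atlas_chart[of c] by (auto simp: is_chart_def homeomorphism_def)

lemma chart_inv_dom: "c \<in> At \<Longrightarrow> x \<in> chart_img c \<Longrightarrow> chart_inv c x \<in> chart_dom c"
  using atlas_chart[of c] by (auto simp: is_chart_def homeomorphism_def)

lemma chart_map_img: "p \<in> chart_dom c \<Longrightarrow> chart_map c p \<in> chart_img c"
  by (simp add: chart_img_def)

lemma overlap_iff: "c \<in> At \<Longrightarrow> x \<in> overlap c d \<longleftrightarrow> x \<in> chart_img c \<and> chart_inv c x \<in> chart_dom d"
  using chart_inv_map chart_map_inv chart_inv_dom unfolding overlap_def chart_img_def by fastforce

lemma open_overlap: "c \<in> At \<Longrightarrow> d \<in> At \<Longrightarrow> open (overlap c d)"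
proof -
  assume c: "c \<in> At" and d: "d \<in> At"
  have "continuous_on (chart_img c) (chart_inv c)" "open (chart_dom d)"
    using atlas_chart[OF c] atlas_chart[OF d] by (auto simp: is_chart_def homeomorphism_def)
  then have "open (chart_img c \<inter> chart_inv c -` chart_dom d)"
    using open_chart_img[OF c] continuous_open_preimage by blast
  moreover have "overlap c d = chart_img c \<inter> chart_inv c -` chart_dom d"
    by (rule set_eqI) (simp add: overlap_iff[OF c])
  ultimately show ?thesis by simp
qed

lemma smooth_transition: "c \<in> At \<Longrightarrow> d \<in> At \<Longrightarrow> smooth_on (overlap c d) (transition c d)"
  using atlas by (simp add: smooth_atlas_def overlap_def)

lemma transition_overlap: "c \<in> At \<Longrightarrow> d \<in> At \<Longrightarrow> x \<in> overlap c d \<Longrightarrow> transition c d x \<in> overlap d c"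
  using chart_inv_map chart_inv_dom by (auto simp: overlap_iff transition_def intro: chart_map_img)

lemma chart_inv_transition: "c \<in> At \<Longrightarrow> d \<in> At \<Longrightarrow> x \<in> overlap c d \<Longrightarrow> chart_inv d (transition c d x) = chart_inv c x"
  by (simp add: overlap_iff transition_def chart_inv_map)

text \<open>Cocycle property of the Jacobians, from the chain rule on the triple overlap. It makes
  the columns of \<open>coord_vec\<close> one tangent vector.\<close>

lemma dd_transition_compose:
  assumes c: "c \<in> At" and d: "d \<in> At" and e: "e \<in> At"
    and x: "x \<in> overlap c d" "x \<in> overlap c e"
  shows "dd (dd v (transition c d) x) (transition d e) (transition c d x) = dd v (transition c e) x"
proof -
  let ?y = "transition c d x"
  have y: "?y \<in> overlap d e"
    using x transition_overlap[OF c d x(1)] chart_inv_transition[OF c d x(1)] by (auto simp: overlap_iff c d)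
  have "((\<lambda>x. transition d e (transition c d x)) has_derivative
      (\<lambda>v. dd (dd v (transition c d) x) (transition d e) ?y)) (at x)"
    using has_derivative_compose[OF smooth_on_has_derivative[OF smooth_transition[OF c d] x(1)],
        OF smooth_on_has_derivative[OF smooth_transition[OF d e] y]] .
  moreover have "open (overlap c d \<inter> overlap c e)"
    by (intro open_Int open_overlap c d e)
  moreover have "transition d e (transition c d z) = transition c e z" if "z \<in> overlap c d \<inter> overlap c e" for z
    using that chart_inv_transition[OF c d] by (simp add: transition_def[of d e] transition_def[of c e])
  ultimately have "(transition c e has_derivative
      (\<lambda>v. dd (dd v (transition c d) x) (transition d e) ?y)) (at x)"
    using has_derivative_transform_within_open[where s = "overlap c d \<inter> overlap c e"] x by blast
  from dd_has_derivative[OF this, of v] show ?thesis by simp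
qed

lemma dd_transition_self:
  assumes c: "c \<in> At" and x: "x \<in> chart_img c"
  shows "dd v (transition c c) x = v"
proof -
  have "((\<lambda>x. x) has_derivative (\<lambda>v. v)) (at x)" by simp
  then have "(transition c c has_derivative (\<lambda>v. v)) (at x)"
    by (rule has_derivative_transform_within_open[OF _ open_chart_img[OF c] x])
      (simp add: transition_def chart_map_inv[OF c])
  from dd_has_derivative[OF this, of v] show ?thesis .
qed

lemma overlap_self: "c \<in> At \<Longrightarrow> overlap c c = chart_img c"
  by (simp add: overlap_def chart_img_def)

lemma dd_transition_inverse:
  assumes c: "c \<in> At" and d: "d \<in> At" and x: "x \<in> overlap c d"
  shows "dd (dd v (transition c d) x) (transition d c) (transition c d x) = v"
  using dd_transition_compose[OF c d c x] x dd_transition_self[OF c] overlap_self[OF c] overlap_iff[OF c] by auto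

lemma transition_inverse: "c \<in> At \<Longrightarrow> d \<in> At \<Longrightarrow> x \<in> overlap c d \<Longrightarrow> transition d c (transition c d x) = x"
  using chart_inv_transition[of c d x] by (simp add: transition_def[of d c] overlap_iff chart_map_inv)

section \<open>Tangent vectors and functions on the tangent bundle in coordinates\<close>

lemma fst_coord_vec: "fst (coord_vec At c x v) = chart_inv c x"
  by (simp add: coord_vec_def)

lemma snd_coord_vec:
  "snd (coord_vec At c x v) d = (if d \<in> At \<and> chart_inv c x \<in> chart_dom d then dd v (transition c d) x else 0)"
  by (simp add: coord_vec_def)

lemma coord_vec_self: "c \<in> At \<Longrightarrow> x \<in> chart_img c \<Longrightarrow> snd (coord_vec At c x v) c = v"
  by (simp add: snd_coord_vec chart_inv_dom dd_transition_self)

lemma snd_coord_vec_tangent: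
  assumes c: "c \<in> At" and x: "x \<in> chart_img c"
  shows "snd (coord_vec At c x v) \<in> tangent_space At (chart_inv c x)"
  unfolding tangent_space_def
proof (intro CollectI conjI ballI allI impI)
  fix d e assume d: "d \<in> At" and e: "e \<in> At"
    and "chart_inv c x \<in> chart_dom d \<and> chart_inv c x \<in> chart_dom e"
  then have de: "chart_inv c x \<in> chart_dom d" "chart_inv c x \<in> chart_dom e" by auto
  then have xo: "x \<in> overlap c d" "x \<in> overlap c e" using x by (auto simp: overlap_iff[OF c])
  have "transition c d x = chart_map d (chart_inv c x)" by (simp add: transition_def)
  then show "snd (coord_vec At c x v) e =
      frechet_derivative (transition d e) (at (chart_map d (chart_inv c x))) (snd (coord_vec At c x v) d)"
    using dd_transition_compose[OF c d e xo, of v] d e de by (simp add: snd_coord_vec)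
next
  fix d assume "\<not> (d \<in> At \<and> chart_inv c x \<in> chart_dom d)"
  then show "snd (coord_vec At c x v) d = 0" unfolding snd_coord_vec by (rule if_not_P)
qed

lemma coord_vec_bundle: "c \<in> At \<Longrightarrow> x \<in> chart_img c \<Longrightarrow> coord_vec At c x v \<in> tangent_bundle At"
  using snd_coord_vec_tangent[of c x v] fst_coord_vec[of c x v]
  by (cases "coord_vec At c x v") (simp add: tangent_bundle_def)

lemma coord_vec_of_tangent:
  assumes c: "c \<in> At" and p: "p \<in> chart_dom c" and w: "w \<in> tangent_space At p"
  shows "coord_vec At c (chart_map c p) (w c) = (p, w)"
proof -
  have inv: "chart_inv c (chart_map c p) = p" by (rule chart_inv_map[OF c p])
  have "snd (coord_vec At c (chart_map c p) (w c)) d = w d" for d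
  proof (cases "d \<in> At \<and> p \<in> chart_dom d")
    case True
    then show ?thesis using w c p unfolding snd_coord_vec inv tangent_space_def by fastforce
  next
    case False
    then have "w d = 0" using w unfolding tangent_space_def by blast
    then show ?thesis unfolding snd_coord_vec inv if_not_P[OF False] ..
  qed
  then have "snd (coord_vec At c (chart_map c p) (w c)) = w" by (rule ext)
  then show ?thesis using fst_coord_vec[of c "chart_map c p" "w c"] inv by (metis prod.collapse)
qed

lemma coord_vec_change:
  assumes c: "c \<in> At" and d: "d \<in> At" and x: "x \<in> overlap c d"
  shows "coord_vec At d (transition c d x) (dd v (transition c d) x) = coord_vec At c x v"
proof -
  have xc: "x \<in> chart_img c" "chart_inv c x \<in> chart_dom d" using x by (auto simp: overlap_iff[OF c])
  have "coord_vec At d (chart_map d (chart_inv c x)) (snd (coord_vec At c x v) d) = (chart_inv c x, snd (coord_vec At c x v))"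
    by (rule coord_vec_of_tangent[OF d xc(2) snd_coord_vec_tangent[OF c xc(1)]])
  then show ?thesis using xc d by (simp add: snd_coord_vec transition_def) (metis fst_coord_vec prod.collapse transition_def)
qed

lemma coord_vec_add:
  assumes c: "c \<in> At" and x: "x \<in> chart_img c"
  shows "snd (coord_vec At c x (u + w)) = tadd (snd (coord_vec At c x u)) (snd (coord_vec At c x w))"
proof
  fix d
  show "snd (coord_vec At c x (u + w)) d = tadd (snd (coord_vec At c x u)) (snd (coord_vec At c x w)) d"
  proof (cases "d \<in> At \<and> chart_inv c x \<in> chart_dom d")
    case True
    then have "transition c d differentiable (at x)"
      using smooth_on_differentiable[OF smooth_transition[OF c]] x by (auto simp: overlap_iff[OF c])
    from dd_bilinear_simps(1)[OF this] True show ?thesis by (simp add: snd_coord_vec tadd_def)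
  qed (simp add: snd_coord_vec tadd_def del: de_Morgan_conj)
qed

lemma coord_vec_scale:
  assumes c: "c \<in> At" and x: "x \<in> chart_img c"
  shows "snd (coord_vec At c x (r *\<^sub>R u)) = tscale r (snd (coord_vec At c x u))"
proof
  fix d
  show "snd (coord_vec At c x (r *\<^sub>R u)) d = tscale r (snd (coord_vec At c x u)) d"
  proof (cases "d \<in> At \<and> chart_inv c x \<in> chart_dom d")
    case True
    then have "transition c d differentiable (at x)"
      using smooth_on_differentiable[OF smooth_transition[OF c]] x by (auto simp: overlap_iff[OF c])
    from dd_bilinear_simps(3)[OF this] True show ?thesis by (simp add: snd_coord_vec tscale_def)
  qed (simp add: snd_coord_vec tscale_def del: de_Morgan_conj)
qed

lemma local_rep_change:
  "c \<in> At \<Longrightarrow> d \<in> At \<Longrightarrow> x \<in> overlap c d \<Longrightarrow>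
    local_rep At c F (x, v) = local_rep At d F (transition c d x, dd v (transition c d) x)"
  by (simp add: local_rep_def coord_vec_change)

lemma local_region_change:
  assumes c: "c \<in> At" and d: "d \<in> At" and x: "x \<in> overlap c d"
  shows "(transition c d x, w) \<in> local_region At d A \<longleftrightarrow> (x, dd w (transition d c) (transition c d x)) \<in> local_region At c A"
proof -
  let ?y = "transition c d x"
  have y: "?y \<in> overlap d c" by (rule transition_overlap[OF c d x])
  have "coord_vec At d ?y w = coord_vec At c x (dd w (transition d c) ?y)"
    using coord_vec_change[OF d c y, of w] transition_inverse[OF c d x] by simp
  then show ?thesis using x y by (auto simp: local_region_def overlap_iff[OF c] overlap_iff[OF d])
qed

lemma fibre_linear_coord:
  assumes c: "c \<in> At" and x: "x \<in> chart_img c" and f: "fibre_linear At (chart_inv c x) f"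
  shows "f (snd (coord_vec At c x v)) = (\<Sum>i\<in>UNIV. v $ i * f (coord_basis At c x i))"
proof -
  have "linear (\<lambda>v. f (snd (coord_vec At c x v)))"
  proof (rule linearI)
    show "f (snd (coord_vec At c x (u + w))) = f (snd (coord_vec At c x u)) + f (snd (coord_vec At c x w))" for u w
      using f snd_coord_vec_tangent[OF c x] by (simp add: coord_vec_add[OF c x] fibre_linear_def)
    show "f (snd (coord_vec At c x (r *\<^sub>R u))) = r *\<^sub>R f (snd (coord_vec At c x u))" for r u
      using f snd_coord_vec_tangent[OF c x] by (simp add: coord_vec_scale[OF c x] fibre_linear_def)
  qed
  from linear_axis_expansion[OF this, of v] show ?thesis by (simp add: coord_basis_def)
qed

text \<open>Transporting \<open>B\<close> from c to d gives a parallel map in d, and uniqueness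
  identifies it with \<open>B'\<close>. \<open>A\<close> and \<open>F\<close> are arbitrary, so that
  the lemma serves both the Lagrangian and the quadratic form of the metric; the second-derivative
  term is the same in both cases.\<close>

lemma parallel_at_change:
  assumes c: "c \<in> At" and d: "d \<in> At" and x: "x \<in> overlap c d"
    and reg: "\<And>c. c \<in> At \<Longrightarrow> open (local_region At c A)"
    and F: "\<And>c. c \<in> At \<Longrightarrow> smooth_on (local_region At c A) (local_rep At c F)"
    and nd: "\<And>c. c \<in> At \<Longrightarrow> fibre_nondegenerate (local_region At c A) (local_rep At c F)"
    and ne: "(x, v) \<in> local_region At c A"
    and par: "parallel_at (local_region At c A) (local_rep At c F) x B"
      "parallel_at (local_region At d A) (local_rep At d F) (transition c d x) B'"
  shows "B' (dd h (transition c d) x) (dd k (transition c d) x) = dd (B h k) (transition c d) x - dd h (dd k (transition c d)) x"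
proof -
  let ?\<phi> = "transition c d" and ?K = "\<lambda>w. dd w (transition d c) (transition c d x)"
  have y: "?\<phi> x \<in> overlap d c" by (rule transition_overlap[OF c d x])
  have K\<phi>: "?K (dd w ?\<phi> x) = w" for w by (rule dd_transition_inverse[OF c d x])
  have "parallel_at (local_region At d A) (local_rep At d F) (?\<phi> x)
      (\<lambda>h k. dd (B (?K h) (?K k)) ?\<phi> x - dd (?K h) (dd (?K k) ?\<phi>) x)"
  proof (rule parallel_at_transfer[OF F[OF d] reg[OF c] smooth_transition[OF c d] open_overlap[OF c d] x _ _ _ _ par(1)])
    show "local_rep At c F (y, w) = local_rep At d F (?\<phi> y, dd w ?\<phi> y)" if "y \<in> overlap c d" for y w
      by (rule local_rep_change[OF c d that])
    show "(x, ?K w) \<in> local_region At c A" if "(?\<phi> x, w) \<in> local_region At d A" for w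
      using local_region_change[OF c d x] that by blast
    show "linear ?K" by (rule dd_linear[OF smooth_on_differentiable[OF smooth_transition[OF d c] y]])
    show "dd (?K w) ?\<phi> x = w" for w
      using dd_transition_inverse[OF d c y, of w] transition_inverse[OF c d x] by simp
  qed
  from parallel_at_unique[OF F[OF d] nd[OF d] reg[OF d] _ par(2) this, of "dd v ?\<phi> x" "dd h ?\<phi> x" "dd k ?\<phi> x"]
  show ?thesis using local_region_change[OF c d x, of "dd v ?\<phi> x" A] ne by (simp add: K\<phi>)
qed

end

section \<open>Derivatives of \<Omega> and the algebra of the two conditions\<close>

lemma smooth_on_deriv:
  fixes f :: "real \<Rightarrow> real"
  assumes "open W" "smooth_on W f"
  shows "smooth_on W (deriv f)" "s \<in> W \<Longrightarrow> (f has_field_derivative deriv f s) (at s)"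
proof -
  have d: "(f has_field_derivative deriv f s) (at s)" if "s \<in> W" for s
    using smooth_on_differentiable[OF assms(2) that] DERIV_deriv_iff_real_differentiable by blast
  then show "s \<in> W \<Longrightarrow> (f has_field_derivative deriv f s) (at s)" .
  show "smooth_on W (deriv f)"
  proof (rule smooth_on_cong[OF smooth_on_dd[OF assms(2), of 1] assms(1)])
    show "dd 1 f s = deriv f s" if "s \<in> W" for s
      using dd_has_derivative[OF d[OF that, unfolded has_field_derivative_def], of 1] by simp
  qed
qed

text \<open>Here w stands for the deviation of a connection from Levi-Civita, applied to h and v.
  The Levi-Civita part of the lift annihilates \<alpha>, so \<alpha> contributes only through w;
  collecting the two occurrences of its derivative gives the factor
  \<open>\<Omega> - s \<Omega>'\<close>, with s the ratio.\<close>

lemma horizontal_alpha_beta: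
  fixes g :: "'n::finite \<Rightarrow> 'n \<Rightarrow> real ^ 'n \<Rightarrow> real"
  assumes X: "open X" and S: "open S" "(x, v) \<in> S" "S \<subseteq> X \<times> UNIV"
    and g: "\<And>i j. smooth_on X (g i j)" and sym: "\<And>i j y. y \<in> X \<Longrightarrow> g i j y = g j i y"
    and inv: "invertible (\<chi> i j. g i j x)" and b: "\<And>i. smooth_on X (b i)"
    and F: "\<And>z. z \<in> S \<Longrightarrow> F z = \<Omega> ((lin_form b z)\<^sup>2 / quad_form g z) * quad_form g z"
    and nz: "quad_form g (x, v) \<noteq> 0"
    and \<Omega>: "(\<Omega> has_field_derivative \<Omega>1) (at ((lin_form b (x, v))\<^sup>2 / quad_form g (x, v)))"
  shows "dd (h, - (bilin_of (levi_civita g x) h v + w)) F (x, v) =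
    2 * lin_form b (x, v) * \<Omega>1 * (\<Sum>i\<in>UNIV. \<Sum>k\<in>UNIV. cov_deriv g b x i k * h $ i * v $ k)
    - (2 * lin_form b (x, v) * \<Omega>1 * (\<Sum>j\<in>UNIV. b j x * w $ j)
      + 2 * (\<Omega> ((lin_form b (x, v))\<^sup>2 / quad_form g (x, v)) - (lin_form b (x, v))\<^sup>2 / quad_form g (x, v) * \<Omega>1)
        * (\<Sum>j\<in>UNIV. (\<Sum>k\<in>UNIV. g j k x * v $ k) * w $ j))"
proof -
  have x: "x \<in> X" using S by auto
  let ?G = "bilin_of (levi_civita g x) h v"
  note db = smooth_on_differentiable[OF b x] and dg = smooth_on_differentiable[OF g x]
  have d: "quad_form g differentiable (at (x, v))" "lin_form b differentiable (at (x, v))"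
    using smooth_on_differentiable[OF smooth_on_quad_form[OF X g]] smooth_on_differentiable[OF smooth_on_lin_form[OF X b]] x
    by auto
  have split: "dd (h, - (?G + w)) f (x, v) = dd (h, - ?G) f (x, v) - dd (0, w) f (x, v)"
    if "f differentiable (at (x, v))" for f :: "(real ^ 'n) \<times> (real ^ 'n) \<Rightarrow> real"
    using dd_bilinear_simps(2)[OF that, of "(h, - ?G)" "(0, w)"] by simp
  have a: "dd (h, - (?G + w)) (quad_form g) (x, v) = - 2 * (\<Sum>j\<in>UNIV. (\<Sum>k\<in>UNIV. g j k x * v $ k) * w $ j)"
  proof -
    have "(\<Sum>i\<in>UNIV. \<Sum>j\<in>UNIV. g i j x * v $ i * w $ j) = (\<Sum>j\<in>UNIV. (\<Sum>k\<in>UNIV. g j k x * v $ k) * w $ j)"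
      by (subst sum.swap) (simp add: sum_distrib_right sym[OF x, of _ j for j])
    moreover have lc: "dd (h, - ?G) (quad_form g) (x, v) = 0"
      by (rule levi_civita_metric_compatible[OF X x g sym inv])
    ultimately show ?thesis
      unfolding split[OF d(1)] unfolding lc
      unfolding dd_quad_form[OF dg sym[OF x]]
      using dd_linear[OF dg, THEN linear_0] by simp
  qed
  have bb: "dd (h, - (?G + w)) (lin_form b) (x, v) =
      (\<Sum>i\<in>UNIV. \<Sum>k\<in>UNIV. cov_deriv g b x i k * h $ i * v $ k) - (\<Sum>j\<in>UNIV. b j x * w $ j)"
    unfolding split[OF d(2)] unfolding dd_lin_form_horizontal[OF db]
    using dd_linear[OF db, THEN linear_0] by (simp add: dd_lin_form[OF db])
  show ?thesis
    using dd_alpha_beta[where \<alpha> = "quad_form g" and \<beta> = "lin_form b" and F = F and h = "(h, - (?G + w))",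
        OF S(1,2) F d nz \<Omega>]
    unfolding a bb by (simp add: algebra_simps)
qed

text \<open>The condition restricted to a line \<open>v + r e\<close> in a fibre, where every
  ingredient other than \<Omega> and its derivative is a polynomial in r. The conclusion is the
  derivative at \<open>r = 0\<close>, to which the second-order coefficients \<open>Q2\<close> and
  \<open>\<alpha>2\<close> do not contribute.\<close>

lemma condition_derivative_line:
  fixes \<Omega> :: "real \<Rightarrow> real"
  assumes eq: "eventually (\<lambda>r. N0 + r * N1 = P0 + r * P1 + (Q0 + r * Q1 + r * r * Q2) *
      (\<Omega> ((\<beta> + r * \<beta>1)\<^sup>2 / (\<alpha> + 2 * r * \<alpha>1 + r * r * \<alpha>2)) /
        (deriv \<Omega> ((\<beta> + r * \<beta>1)\<^sup>2 / (\<alpha> + 2 * r * \<alpha>1 + r * r * \<alpha>2)) * (\<beta> + r * \<beta>1))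
       - (\<beta> + r * \<beta>1) / (\<alpha> + 2 * r * \<alpha>1 + r * r * \<alpha>2))) (nhds 0)"
    and s: "s = \<beta>\<^sup>2 / \<alpha>" and \<Omega>: "(\<Omega> has_field_derivative \<Omega>1) (at s)" "(deriv \<Omega> has_field_derivative \<Omega>2) (at s)"
    and \<Omega>1: "\<Omega>1 = deriv \<Omega> s" and nz: "\<alpha> \<noteq> 0" "\<beta> \<noteq> 0" "\<Omega>1 \<noteq> 0"
  shows "N1 = P1 + Q1 * (\<Omega> s / (\<Omega>1 * \<beta>) - \<beta> / \<alpha>)
    + Q0 * (\<alpha>1 * (2 * \<beta> / \<alpha>\<^sup>2) * (\<Omega> s * \<Omega>2 / \<Omega>1\<^sup>2)
       - \<beta>1 * (- 1 / \<alpha> + \<Omega> s / (\<Omega>1 * \<beta>\<^sup>2) + 2 * \<Omega> s * \<Omega>2 / (\<Omega>1\<^sup>2 * \<alpha>)))"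
proof -
  let ?b = "\<lambda>r. \<beta> + r * \<beta>1" and ?a = "\<lambda>r. \<alpha> + 2 * r * \<alpha>1 + r * r * \<alpha>2"
  define s1 where "s1 = 2 * \<beta> * \<beta>1 / \<alpha> - 2 * \<beta>\<^sup>2 * \<alpha>1 / \<alpha>\<^sup>2"
  have s': "((\<lambda>r. (?b r)\<^sup>2 / ?a r) has_field_derivative s1) (at 0)"
    by (rule derivative_eq_intros refl)+ (use nz in \<open>auto simp: s1_def field_simps power2_eq_square\<close>)
  have o: "((\<lambda>r. \<Omega> ((?b r)\<^sup>2 / ?a r)) has_field_derivative \<Omega>1 * s1) (at 0)"
    using DERIV_chain2[of \<Omega> \<Omega>1 "\<lambda>r. (?b r)\<^sup>2 / ?a r" 0, OF _ s'] \<Omega>(1) s by simp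
  have o': "((\<lambda>r. deriv \<Omega> ((?b r)\<^sup>2 / ?a r)) has_field_derivative \<Omega>2 * s1) (at 0)"
    using DERIV_chain2[of "deriv \<Omega>" \<Omega>2 "\<lambda>r. (?b r)\<^sup>2 / ?a r" 0, OF _ s'] \<Omega>(2) s by simp
  have [simp]: "\<Omega> (\<beta>\<^sup>2 / \<alpha>) = \<Omega> s" "deriv \<Omega> (\<beta>\<^sup>2 / \<alpha>) = \<Omega>1"
    "\<Omega> (\<beta> * \<beta> / \<alpha>) = \<Omega> s" "deriv \<Omega> (\<beta> * \<beta> / \<alpha>) = \<Omega>1"
    by (simp_all add: s \<Omega>1 power2_eq_square)
  have q: "((\<lambda>r. \<Omega> ((?b r)\<^sup>2 / ?a r) / (deriv \<Omega> ((?b r)\<^sup>2 / ?a r) * ?b r)) has_field_derivative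
      (\<Omega>1 * s1 * (\<Omega>1 * \<beta>) - \<Omega> s * (\<Omega>2 * s1 * \<beta> + \<Omega>1 * \<beta>1)) / (\<Omega>1 * \<beta>)\<^sup>2) (at 0)"
    by (rule derivative_eq_intros o o' refl)+ (use nz in \<open>simp_all add: power2_eq_square algebra_simps\<close>)
  have p: "((\<lambda>r. ?b r / ?a r) has_field_derivative (\<beta>1 * \<alpha> - \<beta> * (2 * \<alpha>1)) / \<alpha>\<^sup>2) (at 0)"
    by (rule derivative_eq_intros refl)+ (use nz in \<open>simp_all add: power2_eq_square\<close>)
  \<comment> \<open>The derivative of the bracket, before it is simplified to the form in the
    statement.\<close>
  define R where "R = (\<Omega>1 * s1 * (\<Omega>1 * \<beta>) - \<Omega> s * (\<Omega>2 * s1 * \<beta> + \<Omega>1 * \<beta>1)) / (\<Omega>1 * \<beta>)\<^sup>2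
     - (\<beta>1 * \<alpha> - \<beta> * (2 * \<alpha>1)) / \<alpha>\<^sup>2"
  have "((\<lambda>r. N0 + r * N1) has_field_derivative P1 + (Q1 * (\<Omega> s / (\<Omega>1 * \<beta>) - \<beta> / \<alpha>) + Q0 * R)) (at 0)"
  proof (rule DERIV_transfer_nhds[OF _ eventually_mono[OF eq sym]])
    show "((\<lambda>r. P0 + r * P1 + (Q0 + r * Q1 + r * r * Q2) * (\<Omega> ((?b r)\<^sup>2 / ?a r) / (deriv \<Omega> ((?b r)\<^sup>2 / ?a r) * ?b r) - ?b r / ?a r))
      has_field_derivative P1 + (Q1 * (\<Omega> s / (\<Omega>1 * \<beta>) - \<beta> / \<alpha>) + Q0 * R)) (at 0)"
      by (rule derivative_eq_intros DERIV_diff[OF q p] refl)+ (simp add: R_def)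
  qed
  moreover have "((\<lambda>r. N0 + r * N1) has_field_derivative N1) (at 0)"
    by (auto intro!: derivative_eq_intros)
  ultimately have "N1 = P1 + (Q1 * (\<Omega> s / (\<Omega>1 * \<beta>) - \<beta> / \<alpha>) + Q0 * R)" by (metis DERIV_unique)
  moreover have "R = \<alpha>1 * (2 * \<beta> / \<alpha>\<^sup>2) * (\<Omega> s * \<Omega>2 / \<Omega>1\<^sup>2)
       - \<beta>1 * (- 1 / \<alpha> + \<Omega> s / (\<Omega>1 * \<beta>\<^sup>2) + 2 * \<Omega> s * \<Omega>2 / (\<Omega>1\<^sup>2 * \<alpha>))"
    using nz by (simp add: R_def s1_def field_simps power2_eq_square)
  ultimately show ?thesis by simp
qed

text \<open>Euler's theorem in disguise: contraction with v doubles the quadratic term and, the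
  bracket having degree -1, turns the derivative of the bracket into \<open>- R\<close>. What
  remains is \<open>2 Q0 R - Q0 R\<close>.\<close>

lemma condition_contract:
  fixes v :: "real ^ 'n::finite"
  assumes eq: "\<And>d. n d = P1 d + Q1 d * R + Q0 * (xl d * (2 * \<beta> / \<alpha>\<^sup>2) * (\<Omega>0 * \<Omega>2 / \<Omega>1\<^sup>2)
       - b d * (- 1 / \<alpha> + \<Omega>0 / (\<Omega>1 * \<beta>\<^sup>2) + 2 * \<Omega>0 * \<Omega>2 / (\<Omega>1\<^sup>2 * \<alpha>)))"
    and R: "R = \<Omega>0 / (\<Omega>1 * \<beta>) - \<beta> / \<alpha>"
    and nz: "\<alpha> \<noteq> 0" "\<beta> \<noteq> 0" "\<Omega>1 \<noteq> 0"
    and sums: "(\<Sum>d\<in>UNIV. v $ d * P1 d) = P0" "(\<Sum>d\<in>UNIV. v $ d * Q1 d) = 2 * Q0"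
      "(\<Sum>d\<in>UNIV. v $ d * xl d) = \<alpha>" "(\<Sum>d\<in>UNIV. v $ d * b d) = \<beta>"
  shows "(\<Sum>d\<in>UNIV. v $ d * n d) = P0 + Q0 * R"
proof -
  define E B where "E = (2 * \<beta> / \<alpha>\<^sup>2) * (\<Omega>0 * \<Omega>2 / \<Omega>1\<^sup>2)"
    and "B = - 1 / \<alpha> + \<Omega>0 / (\<Omega>1 * \<beta>\<^sup>2) + 2 * \<Omega>0 * \<Omega>2 / (\<Omega>1\<^sup>2 * \<alpha>)"
  have "n d = P1 d + Q1 d * R + Q0 * (xl d * E - b d * B)" for d
    using eq[of d] by (simp add: E_def B_def mult.assoc)
  then have "(\<Sum>d\<in>UNIV. v $ d * n d) = (\<Sum>d\<in>UNIV. v $ d * P1 d + (v $ d * Q1 d) * R + Q0 * ((v $ d * xl d) * E - (v $ d * b d) * B))"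
    by (intro sum.cong refl) (simp only:, simp add: algebra_simps)
  also have "\<dots> = P0 + 2 * Q0 * R + Q0 * (\<alpha> * E - \<beta> * B)"
    by (simp only: sum.distrib sum_subtractf sum_distrib_left[symmetric] sum_distrib_right[symmetric] sums)
  also have "\<alpha> * E - \<beta> * B = - R"
    using nz by (simp add: E_def B_def R field_simps power2_eq_square)
  finally show ?thesis by simp
qed

section \<open>The geometry in a chart\<close>

lemma christoffel_eq: "christoffel At c a i j k x = levi_civita (metric_comp At c a) x i j k"
  by (simp add: christoffel_def levi_civita_def metric_inv_def)

lemma nabla_form_eq: "nabla_form At c a b i j x = cov_deriv (metric_comp At c a) (form_comp At c b) x i j"
  by (simp add: nabla_form_def cov_deriv_def christoffel_eq)

text \<open>If \<Omega>' vanished on an interval of ratios, the condition would be void on an open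
  set of vectors; \<open>critical\<close> excludes this. \<open>ratio_set\<close> leaves out vectors
  with \<beta> zero, so \<Omega> may fail to be differentiable at 0, as a square root does.\<close>

locale alpha_beta_geometry = smooth_manifold At
  for At :: "('m::topological_space, 'n::finite) chart set" +
  fixes a :: "'m \<Rightarrow> ('m, 'n) tvec \<Rightarrow> ('m, 'n) tvec \<Rightarrow> real"
    and b :: "'m \<Rightarrow> ('m, 'n) tvec \<Rightarrow> real"
    and L :: "'m \<times> ('m, 'n) tvec \<Rightarrow> real"
    and A :: "('m \<times> ('m, 'n) tvec) set"
    and \<Omega> :: "real \<Rightarrow> real" and W :: "real set"
  assumes metric: "pseudo_riemannian_metric At a"
    and form: "one_form At b"
    and lagrangian: "finsler_lagrangian At L A"
    and alpha_beta: "alpha_beta_form At L a b \<Omega>"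
    and W: "open W" "ratio_set A a b \<subseteq> W" "smooth_on W \<Omega>"
    and critical: "interior {s \<in> ratio_set A a b. deriv \<Omega> s = 0} = {}"
begin

abbreviation "\<alpha> c \<equiv> quad_form (metric_comp At c a)"
abbreviation "\<beta> c \<equiv> lin_form (form_comp At c b)"
abbreviation "U c \<equiv> local_region At c A"
abbreviation "F c \<equiv> local_rep At c L"
abbreviation "V c \<equiv> local_region At c (formula_region A a b \<Omega>)"
abbreviation "LC c x \<equiv> bilin_of (levi_civita (metric_comp At c a) x)"
abbreviation "TC c T x \<equiv> bilin_of (\<lambda>i j k. tensor_comp At c T i j k x)"

lemma smooth_metric_comp: "c \<in> At \<Longrightarrow> smooth_on (chart_img c) (metric_comp At c a i j)"
  using metric by (auto simp: pseudo_riemannian_metric_def)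

lemma smooth_form_comp: "c \<in> At \<Longrightarrow> smooth_on (chart_img c) (form_comp At c b i)"
  using form by (auto simp: one_form_def)

lemma coord_basis_tangent: "c \<in> At \<Longrightarrow> x \<in> chart_img c \<Longrightarrow> coord_basis At c x i \<in> tangent_space At (chart_inv c x)"
  unfolding coord_basis_def by (rule snd_coord_vec_tangent)

lemma metric_comp_sym: "c \<in> At \<Longrightarrow> x \<in> chart_img c \<Longrightarrow> metric_comp At c a i j x = metric_comp At c a j i x"
  using metric coord_basis_tangent unfolding metric_comp_def pseudo_riemannian_metric_def by blast

lemma metric_coord:
  assumes c: "c \<in> At" and x: "x \<in> chart_img c"
  shows "a (chart_inv c x) (snd (coord_vec At c x u)) (snd (coord_vec At c x w))
    = (\<Sum>i\<in>UNIV. \<Sum>j\<in>UNIV. metric_comp At c a i j x * u $ i * w $ j)"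
proof -
  let ?p = "chart_inv c x" and ?e = "coord_basis At c x"
  have lin: "fibre_linear At ?p (a ?p z)" if "z \<in> tangent_space At ?p" for z
    using metric that by (auto simp: pseudo_riemannian_metric_def)
  have sym: "a ?p y z = a ?p z y" if "y \<in> tangent_space At ?p" "z \<in> tangent_space At ?p" for y z
    using metric that unfolding pseudo_riemannian_metric_def by blast
  note t = snd_coord_vec_tangent[OF c x] and e = coord_basis_tangent[OF c x]
  have "a ?p (snd (coord_vec At c x u)) (?e j) = (\<Sum>i\<in>UNIV. u $ i * metric_comp At c a i j x)" for j
    using fibre_linear_coord[OF c x lin[OF e[of j]], of u] sym[OF e[of j] t[of u]] metric_comp_sym[OF c x, of j]
    by (simp add: metric_comp_def)
  then have "a ?p (snd (coord_vec At c x u)) (snd (coord_vec At c x w))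
      = (\<Sum>j\<in>UNIV. w $ j * (\<Sum>i\<in>UNIV. u $ i * metric_comp At c a i j x))"
    using fibre_linear_coord[OF c x lin[OF t[of u]], of w] by simp
  also have "\<dots> = (\<Sum>j\<in>UNIV. \<Sum>i\<in>UNIV. metric_comp At c a i j x * u $ i * w $ j)"
    by (simp add: sum_distrib_left mult.commute mult.left_commute)
  also have "\<dots> = (\<Sum>i\<in>UNIV. \<Sum>j\<in>UNIV. metric_comp At c a i j x * u $ i * w $ j)" by (rule sum.swap)
  finally show ?thesis .
qed

lemma quad_coord: "c \<in> At \<Longrightarrow> x \<in> chart_img c \<Longrightarrow> quad a (coord_vec At c x v) = \<alpha> c (x, v)"
  by (simp add: quad_def fst_coord_vec metric_coord quad_form_def)

lemma lin_coord: "c \<in> At \<Longrightarrow> x \<in> chart_img c \<Longrightarrow> lin b (coord_vec At c x v) = \<beta> c (x, v)"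
  using fibre_linear_coord[of c x "b (chart_inv c x)" v] form
  by (simp add: lin_def fst_coord_vec one_form_def lin_form_def form_comp_def mult.commute)

lemma metric_comp_invertible:
  assumes c: "c \<in> At" and x: "x \<in> chart_img c"
  shows "invertible (\<chi> i j. metric_comp At c a i j x)"
proof -
  let ?M = "\<chi> i j. metric_comp At c a i j x" and ?p = "chart_inv c x"
  have "u = 0" if u: "?M *v u = 0" for u
  proof -
    have "a ?p (snd (coord_vec At c x u)) y = 0" if y: "y \<in> tangent_space At ?p" for y
    proof -
      have y': "y = snd (coord_vec At c x (y c))"
        using coord_vec_of_tangent[OF c chart_inv_dom[OF c x] y] chart_map_inv[OF c x] by simp
      have "(\<Sum>i\<in>UNIV. \<Sum>j\<in>UNIV. metric_comp At c a i j x * u $ i * y c $ j)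
          = (\<Sum>j\<in>UNIV. (?M *v u) $ j * y c $ j)"
        by (subst sum.swap) (simp add: matrix_vector_mult_def sum_distrib_right metric_comp_sym[OF c x, of _ j for j])
      then have "a ?p (snd (coord_vec At c x u)) (snd (coord_vec At c x (y c))) = 0"
        by (simp add: metric_coord[OF c x] u)
      then show ?thesis using y' by simp
    qed
    then have "snd (coord_vec At c x u) = (\<lambda>c. 0)"
      using metric snd_coord_vec_tangent[OF c x, of u] unfolding pseudo_riemannian_metric_def by blast
    from fun_cong[OF this, of c] show ?thesis by (simp add: coord_vec_self[OF c x])
  qed
  then obtain M' where "M' ** ?M = mat 1" using matrix_left_invertible_ker[of ?M] by blast
  then show ?thesis using invertible_left_inverse by blast
qed

lemma region_img: "(x, v) \<in> local_region At c B \<Longrightarrow> x \<in> chart_img c"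
  by (simp add: local_region_def)

lemma open_region: "c \<in> At \<Longrightarrow> open (U c)"
  using lagrangian by (auto simp: finsler_lagrangian_def conic_subbundle_def)

lemma smooth_rep: "c \<in> At \<Longrightarrow> smooth_on (U c) (F c)"
  using lagrangian by (auto simp: finsler_lagrangian_def)

lemma fibre_metric_invertible: "c \<in> At \<Longrightarrow> z \<in> U c \<Longrightarrow> invertible (fibre_metric (F c) z)"
  using lagrangian by (auto simp: finsler_lagrangian_def L_metric_eq)

lemma coord_vec_scale_pair:
  "c \<in> At \<Longrightarrow> x \<in> chart_img c \<Longrightarrow>
    coord_vec At c x (r *\<^sub>R v) = (chart_inv c x, tscale r (snd (coord_vec At c x v)))"
  using coord_vec_scale[of c x r v] fst_coord_vec[of c x "r *\<^sub>R v"]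
  by (cases "coord_vec At c x (r *\<^sub>R v)") simp

lemma region_cone: "c \<in> At \<Longrightarrow> (x, v) \<in> U c \<Longrightarrow> r > 0 \<Longrightarrow> (x, r *\<^sub>R v) \<in> U c"
proof -
  assume c: "c \<in> At" and v: "(x, v) \<in> U c" and r: "r > 0"
  have x: "x \<in> chart_img c" and A: "(chart_inv c x, snd (coord_vec At c x v)) \<in> A"
    using v by (auto simp: local_region_def fst_coord_vec[of c x v, symmetric])
  have "(chart_inv c x, tscale r (snd (coord_vec At c x v))) \<in> A"
    using lagrangian A r unfolding finsler_lagrangian_def conic_subbundle_def by blast
  then show ?thesis using x coord_vec_scale_pair[OF c x] by (simp add: local_region_def)
qed

lemma rep_scale: "c \<in> At \<Longrightarrow> x \<in> chart_img c \<Longrightarrow> r > 0 \<Longrightarrow> F c (x, r *\<^sub>R v) = r\<^sup>2 * F c (x, v)"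
proof -
  assume c: "c \<in> At" and x: "x \<in> chart_img c" and r: "r > 0"
  have "L (chart_inv c x, tscale r (snd (coord_vec At c x v))) = r\<^sup>2 * L (chart_inv c x, snd (coord_vec At c x v))"
    using lagrangian snd_coord_vec_tangent[OF c x, of v] r unfolding finsler_lagrangian_def by blast
  then show ?thesis using coord_vec_scale_pair[OF c x, of r v] fst_coord_vec[of c x v]
    by (cases "coord_vec At c x v") (simp add: local_rep_def)
qed

text \<open>Supplies the vector that uniqueness of parallel maps requires in every fibre.\<close>

lemma region_nonempty: "c \<in> At \<Longrightarrow> x \<in> chart_img c \<Longrightarrow> \<exists>v. (x, v) \<in> U c"
proof -
  assume c: "c \<in> At" and x: "x \<in> chart_img c"
  obtain w where w: "(chart_inv c x, w) \<in> A"
    using lagrangian unfolding finsler_lagrangian_def conic_subbundle_def by blast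
  then have "w \<in> tangent_space At (chart_inv c x)"
    using lagrangian by (auto simp: finsler_lagrangian_def conic_subbundle_def tangent_bundle_def)
  then have "coord_vec At c x (w c) = (chart_inv c x, w)"
    using coord_vec_of_tangent[OF c chart_inv_dom[OF c x], of w] chart_map_inv[OF c x] by simp
  with w have "coord_vec At c x (w c) \<in> A" by simp
  then show ?thesis using x by (auto simp: local_region_def)
qed

lemma rep_alpha_beta:
  "c \<in> At \<Longrightarrow> x \<in> chart_img c \<Longrightarrow> \<alpha> c (x, v) \<noteq> 0 \<Longrightarrow>
    F c (x, v) = \<Omega> ((\<beta> c (x, v))\<^sup>2 / \<alpha> c (x, v)) * \<alpha> c (x, v)"
  using alpha_beta coord_vec_bundle[of c x v] by (simp add: alpha_beta_form_def local_rep_def quad_coord lin_coord)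

lemma formula_region_iff:
  assumes c: "c \<in> At"
  shows "(x, v) \<in> V c \<longleftrightarrow> (x, v) \<in> U c \<and> \<alpha> c (x, v) \<noteq> 0 \<and> \<beta> c (x, v) \<noteq> 0
     \<and> deriv \<Omega> ((\<beta> c (x, v))\<^sup>2 / \<alpha> c (x, v)) \<noteq> 0"
  by (auto simp: local_region_def formula_region_def quad_coord[OF c] lin_coord[OF c])

lemma ratio_mem:
  assumes c: "c \<in> At" and v: "(x, v) \<in> U c" "\<alpha> c (x, v) \<noteq> 0" "\<beta> c (x, v) \<noteq> 0"
  shows "(\<beta> c (x, v))\<^sup>2 / \<alpha> c (x, v) \<in> ratio_set A a b" "(\<beta> c (x, v))\<^sup>2 / \<alpha> c (x, v) \<in> W"
proof -
  note x = region_img[OF v(1)]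
  have "coord_vec At c x v \<in> A" using v(1) by (simp add: local_region_def)
  then show "(\<beta> c (x, v))\<^sup>2 / \<alpha> c (x, v) \<in> ratio_set A a b"
    using v(2,3) unfolding ratio_set_def quad_coord[OF c x, symmetric] lin_coord[OF c x, symmetric] by blast
  then show "(\<beta> c (x, v))\<^sup>2 / \<alpha> c (x, v) \<in> W" using W(2) by blast
qed

lemma smooth_alpha: "c \<in> At \<Longrightarrow> smooth_on (chart_img c \<times> UNIV) (\<alpha> c)"
  by (rule smooth_on_quad_form[OF open_chart_img smooth_metric_comp])

lemma smooth_beta: "c \<in> At \<Longrightarrow> smooth_on (chart_img c \<times> UNIV) (\<beta> c)"
  by (rule smooth_on_lin_form[OF open_chart_img smooth_form_comp])

lemma region_subset: "U c \<subseteq> chart_img c \<times> UNIV"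
  by (auto simp: local_region_def)

lemma open_nonzero:
  fixes f :: "'a::topological_space \<Rightarrow> real"
  assumes "open S" "continuous_on S f"
  shows "open {z \<in> S. f z \<noteq> 0}"
proof -
  have "{z \<in> S. f z \<noteq> 0} = S \<inter> f -` (- {0})" by auto
  then show ?thesis using continuous_open_preimage[OF assms(2,1), of "- {0}"] by auto
qed

lemma continuous_alpha_beta:
  assumes c: "c \<in> At" and S: "S \<subseteq> U c"
  shows "continuous_on S (\<alpha> c)" "continuous_on S (\<beta> c)"
  using S region_subset[of c] smooth_on_continuous_on[OF smooth_alpha[OF c]]
    smooth_on_continuous_on[OF smooth_beta[OF c]] continuous_on_subset by blast+

lemma open_nondegenerate_region: "c \<in> At \<Longrightarrow> open {z \<in> U c. \<alpha> c z \<noteq> 0}"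
  by (intro open_nonzero open_region continuous_alpha_beta) auto

text \<open>The region is cut out in stages: the ratio is continuous only where \<alpha> is nonzero,
  and \<Omega>' is controlled only at ratios in \<open>W\<close>, which requires \<beta> nonzero as
  well.\<close>

lemma open_formula_region: "c \<in> At \<Longrightarrow> open (V c)"
proof -
  assume c: "c \<in> At"
  let ?R = "{z \<in> {z \<in> U c. \<alpha> c z \<noteq> 0}. \<beta> c z \<noteq> 0}"
  have R: "open ?R"
    by (rule open_nonzero[OF open_nondegenerate_region[OF c]]) (rule continuous_alpha_beta(2)[OF c], auto)
  have "continuous_on ?R (\<lambda>z. deriv \<Omega> ((\<beta> c z)\<^sup>2 / \<alpha> c z))"
  proof (rule continuous_on_compose2[OF smooth_on_continuous_on[OF smooth_on_deriv(1)[OF W(1,3)]]])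
    show "continuous_on ?R (\<lambda>z. (\<beta> c z)\<^sup>2 / \<alpha> c z)"
      by (intro continuous_on_divide continuous_on_power continuous_alpha_beta[OF c]) auto
    show "(\<lambda>z. (\<beta> c z)\<^sup>2 / \<alpha> c z) ` ?R \<subseteq> W" using ratio_mem(2)[OF c] by auto
  qed
  from open_nonzero[OF R this] have "open {z \<in> ?R. deriv \<Omega> ((\<beta> c z)\<^sup>2 / \<alpha> c z) \<noteq> 0}" .
  moreover have "V c = {z \<in> ?R. deriv \<Omega> ((\<beta> c z)\<^sup>2 / \<alpha> c z) \<noteq> 0}"
    using formula_region_iff[OF c] by auto
  ultimately show ?thesis by simp
qed

section \<open>The condition in chart components\<close>

definition cond_lhs where "cond_lhs c x v i =
  (\<Sum>k\<in>UNIV. v $ k * cov_deriv (metric_comp At c a) (form_comp At c b) x i k)"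

definition cond_lin where "cond_lin c T x v i =
  (\<Sum>j\<in>UNIV. \<Sum>k\<in>UNIV. tensor_comp At c T j i k x * v $ k * form_comp At c b j x)"

definition cond_quad where "cond_quad c T x v i =
  (\<Sum>j\<in>UNIV. \<Sum>k\<in>UNIV. tensor_comp At c T j i k x * v $ k * lower At c a x v j)"

lemma berwald_condition_iff:
  "berwald_condition At A a b \<Omega> T \<longleftrightarrow> (\<forall>c\<in>At. \<forall>x v i. (x, v) \<in> V c \<longrightarrow>
     cond_lhs c x v i = cond_lin c T x v i + cond_quad c T x v i *
       (\<Omega> ((\<beta> c (x, v))\<^sup>2 / \<alpha> c (x, v)) / (deriv \<Omega> ((\<beta> c (x, v))\<^sup>2 / \<alpha> c (x, v)) * \<beta> c (x, v)) - \<beta> c (x, v) / \<alpha> c (x, v)))"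
proof -
  have "c \<in> At \<Longrightarrow> (x, v) \<in> V c \<Longrightarrow> quad a (coord_vec At c x v) = \<alpha> c (x, v) \<and> lin b (coord_vec At c x v) = \<beta> c (x, v)" for c x v
    using region_img quad_coord lin_coord by blast
  then show ?thesis
    unfolding berwald_condition_def cond_lhs_def cond_lin_def cond_quad_def
    by (simp add: Let_def nabla_form_eq split_paired_Ball_Sigma[symmetric] Ball_def split_paired_All)
qed

text \<open>The pointwise bridge between the formula and parallelism for the connection
  \<open>LC + T\<close>, one basis direction at a time.\<close>

lemma condition_iff_horizontal:
  assumes c: "c \<in> At" and v: "(x, v) \<in> V c"
  shows "cond_lhs c x v i = cond_lin c T x v i + cond_quad c T x v i *
       (\<Omega> ((\<beta> c (x, v))\<^sup>2 / \<alpha> c (x, v)) / (deriv \<Omega> ((\<beta> c (x, v))\<^sup>2 / \<alpha> c (x, v)) * \<beta> c (x, v)) - \<beta> c (x, v) / \<alpha> c (x, v))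
     \<longleftrightarrow> dd (axis i 1, - (LC c x (axis i 1) v + TC c T x (axis i 1) v)) (F c) (x, v) = 0"
proof -
  let ?s = "(\<beta> c (x, v))\<^sup>2 / \<alpha> c (x, v)"
  have vU: "(x, v) \<in> U c" and nz: "\<alpha> c (x, v) \<noteq> 0" "\<beta> c (x, v) \<noteq> 0" "deriv \<Omega> ?s \<noteq> 0"
    using v by (auto simp: formula_region_iff[OF c])
  note x = region_img[OF vU]
  let ?S = "{z \<in> U c. \<alpha> c z \<noteq> 0}"
  let ?w = "TC c T x (axis i 1) v"
  have w: "?w $ j = (\<Sum>k\<in>UNIV. tensor_comp At c T j i k x * v $ k)" for j
    by (rule bilin_of_axis_left)
  have lhs: "(\<Sum>i'\<in>UNIV. \<Sum>k\<in>UNIV. cov_deriv (metric_comp At c a) (form_comp At c b) x i' k * axis i 1 $ i' * v $ k) = cond_lhs c x v i"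
  proof -
    have "(\<Sum>k\<in>UNIV. cov_deriv (metric_comp At c a) (form_comp At c b) x i' k * axis i 1 $ i' * v $ k)
        = (if i' = i then cond_lhs c x v i else 0)" for i'
      by (simp add: axis_def cond_lhs_def mult.commute)
    then show ?thesis by simp
  qed
  have lin: "(\<Sum>j\<in>UNIV. form_comp At c b j x * ?w $ j) = cond_lin c T x v i"
    by (simp add: w cond_lin_def sum_distrib_left mult.commute)
  have qd: "(\<Sum>j\<in>UNIV. (\<Sum>k\<in>UNIV. metric_comp At c a j k x * v $ k) * ?w $ j) = cond_quad c T x v i"
    unfolding lower_def[of At c a x v, symmetric]
    by (simp add: w cond_quad_def sum_distrib_left mult.commute)
  have "dd (axis i 1, - (LC c x (axis i 1) v + ?w)) (F c) (x, v) =
    2 * \<beta> c (x, v) * deriv \<Omega> ?s * cond_lhs c x v i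
    - (2 * \<beta> c (x, v) * deriv \<Omega> ?s * cond_lin c T x v i + 2 * (\<Omega> ?s - ?s * deriv \<Omega> ?s) * cond_quad c T x v i)"
  proof (subst horizontal_alpha_beta[OF open_chart_img[OF c] open_nondegenerate_region[OF c]])
    show "?S \<subseteq> chart_img c \<times> UNIV" using region_subset[of c] by blast
    show "F c z = \<Omega> ((\<beta> c z)\<^sup>2 / \<alpha> c z) * \<alpha> c z" if "z \<in> ?S" for z
    proof -
      have "fst z \<in> chart_img c" using that region_subset[of c] by auto
      from rep_alpha_beta[OF c this, of "snd z"] that show ?thesis by simp
    qed
    show "(\<Omega> has_field_derivative deriv \<Omega> ?s) (at ?s)"
      by (rule smooth_on_deriv(2)[OF W(1,3)]) (rule ratio_mem(2)[OF c vU nz(1,2)])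
  qed (use vU nz metric_comp_sym[OF c] smooth_metric_comp[OF c] smooth_form_comp[OF c]
      metric_comp_invertible[OF c x] in \<open>auto simp: lhs lin qd\<close>)
  \<comment> \<open>The two equations differ by the factor \<open>2 * \<beta>0 * o1\<close>, which
    is nonzero on the formula region.\<close>
  moreover have iff: "l = p + q * (o0 / (o1 * \<beta>0) - \<beta>0 / \<alpha>0) \<longleftrightarrow>
      2 * \<beta>0 * o1 * l - (2 * \<beta>0 * o1 * p + 2 * (o0 - \<beta>0\<^sup>2 / \<alpha>0 * o1) * q) = 0"
    if "\<alpha>0 \<noteq> 0" "\<beta>0 \<noteq> 0" "o1 \<noteq> 0" for l p q o0 o1 \<alpha>0 \<beta>0 :: real
  proof -
    have "2 * \<beta>0 * o1 * l - (2 * \<beta>0 * o1 * p + 2 * (o0 - \<beta>0\<^sup>2 / \<alpha>0 * o1) * q)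
        = 2 * \<beta>0 * o1 * (l - (p + q * (o0 / (o1 * \<beta>0) - \<beta>0 / \<alpha>0)))"
      using that by (simp add: field_simps power2_eq_square)
    then show ?thesis using that by simp
  qed
  ultimately show ?thesis by (simp only: iff[OF nz])
qed

end

section \<open>From the Berwald property to the tensor field\<close>

context smooth_manifold
begin

text \<open>The homogeneous transformation law is what makes the chartwise columns of
  \<open>T p u w\<close> a single tangent vector; bilinearity and symmetry are then checked in each
  column.\<close>

lemma tensor_field_of_components:
  fixes t :: "('m, 'n) chart \<Rightarrow> 'n \<Rightarrow> 'n \<Rightarrow> 'n \<Rightarrow> real ^ 'n \<Rightarrow> real"
  assumes smooth: "\<And>c i j k. c \<in> At \<Longrightarrow> smooth_on (chart_img c) (t c i j k)"
    and sym: "\<And>c i j k x. c \<in> At \<Longrightarrow> x \<in> chart_img c \<Longrightarrow> t c i j k x = t c i k j x"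
    and change: "\<And>c d x h k. c \<in> At \<Longrightarrow> d \<in> At \<Longrightarrow> x \<in> overlap c d \<Longrightarrow>
      bilin_of (\<lambda>i j k. t d i j k (transition c d x)) (dd h (transition c d) x) (dd k (transition c d) x)
        = dd (bilin_of (\<lambda>i j k. t c i j k x) h k) (transition c d) x"
  obtains T where "tensor12_field At T" "symmetric_tensor12 At T"
    "\<And>c i j k x. c \<in> At \<Longrightarrow> x \<in> chart_img c \<Longrightarrow> tensor_comp At c T i j k x = t c i j k x"
proof -
  \<comment> \<open>Columns of charts that are not around p are zero because
    \<open>tangent_space\<close> fixes them so.\<close>
  define T :: "'m \<Rightarrow> ('m, 'n) tvec \<Rightarrow> ('m, 'n) tvec \<Rightarrow> ('m, 'n) tvec" where
    "T p u w c = (if c \<in> At \<and> p \<in> chart_dom c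
       then bilin_of (\<lambda>i j k. t c i j k (chart_map c p)) (u c) (w c) else 0)" for p u w c
  note bil = bilinear_bilin_of
  have tangent: "T p u w \<in> tangent_space At p" if u: "u \<in> tangent_space At p" and w: "w \<in> tangent_space At p" for p u w
    unfolding tangent_space_def
  proof (intro CollectI conjI ballI allI impI)
    fix c d assume c: "c \<in> At" and d: "d \<in> At" and "p \<in> chart_dom c \<and> p \<in> chart_dom d"
    then have p: "p \<in> chart_dom c" "p \<in> chart_dom d" by auto
    let ?x = "chart_map c p"
    have x: "?x \<in> overlap c d" using p by (simp add: overlap_def)
    have y: "transition c d ?x = chart_map d p" by (simp add: transition_def chart_inv_map[OF c p(1)])
    have "u d = dd (u c) (transition c d) ?x" "w d = dd (w c) (transition c d) ?x"
      using u w c d p unfolding tangent_space_def by blast+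
    then show "T p u w d = dd (T p u w c) (transition c d) ?x"
      using change[OF c d x, of "u c" "w c"] c d p by (simp add: T_def y)
  next
    fix c assume "\<not> (c \<in> At \<and> p \<in> chart_dom c)"
    then show "T p u w c = 0" unfolding T_def by (rule if_not_P)
  qed
  have sym': "T p u w = T p w u" for p u w
  proof
    fix c
    show "T p u w c = T p w u c"
    proof (cases "c \<in> At \<and> p \<in> chart_dom c")
      case True
      show ?thesis unfolding T_def if_P[OF True]
        by (rule bilin_of_sym, rule sym) (use True in \<open>auto intro: chart_map_img\<close>)
    next
      case False
      show ?thesis unfolding T_def if_not_P[OF False] by (rule refl)
    qed
  qed
  have add: "T p u (tadd w w') = tadd (T p u w) (T p u w')" for p u w w'
    by (auto simp: fun_eq_iff T_def tadd_def bilinear_radd[OF bil])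
  have scale: "T p u (tscale r w) = tscale r (T p u w)" for p u w r
    by (auto simp: fun_eq_iff T_def tscale_def bilinear_rmul[OF bil])
  have comp: "tensor_comp At c T i j k x = t c i j k x" if c: "c \<in> At" and x: "x \<in> chart_img c" for c i j k x
    using c chart_inv_dom[OF c x]
    by (simp add: tensor_comp_def T_def chart_map_inv[OF c x] coord_basis_def coord_vec_self[OF c x] bilin_of_axis)
  show ?thesis
  proof (rule that)
    show "symmetric_tensor12 At T" using sym' by (simp add: symmetric_tensor12_def)
    show "tensor_comp At c T i j k x = t c i j k x" if "c \<in> At" "x \<in> chart_img c" for c i j k x
      by (rule comp[OF that])
    have "fibre_endo At p (T p u)" if "u \<in> tangent_space At p" for p u
      using tangent[OF that] by (simp add: fibre_endo_def add scale)
    moreover from this have "fibre_endo At p (\<lambda>u. T p u w)" if "w \<in> tangent_space At p" for p w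
      using that sym'[of p _ w] by simp
    moreover have "smooth_on (chart_img c) (tensor_comp At c T i j k)" if c: "c \<in> At" for c i j k
      by (rule smooth_on_cong[OF smooth[OF c] open_chart_img[OF c]]) (simp add: comp[OF c])
    ultimately show "tensor12_field At T" by (simp add: tensor12_field_def)
  qed
qed

end

context alpha_beta_geometry
begin

lemma nondegenerate_rep: "c \<in> At \<Longrightarrow> fibre_nondegenerate (U c) (F c)"
  by (rule fibre_nondegenerateI[OF smooth_rep open_region fibre_metric_invertible])

lemma local_region_bundle: "c \<in> At \<Longrightarrow> local_region At c (tangent_bundle At) = chart_img c \<times> UNIV"
  by (auto simp: local_region_def coord_vec_bundle)

lemma local_rep_quad: "c \<in> At \<Longrightarrow> z \<in> chart_img c \<times> UNIV \<Longrightarrow> local_rep At c (quad a) z = \<alpha> c z"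
  by (auto simp: local_rep_def quad_coord)

text \<open>Levi-Civita is the unique parallel map of the quadratic form on the whole tangent
  bundle, so its law is an instance of \<open>parallel_at_change\<close> and no Christoffel symbol
  has to be transformed by hand. The zero vector serves as the required element of the
  fibre.\<close>

lemma levi_civita_change:
  assumes c: "c \<in> At" and d: "d \<in> At" and x: "x \<in> overlap c d"
  shows "LC d (transition c d x) (dd h (transition c d) x) (dd k (transition c d) x)
    = dd (LC c x h k) (transition c d) x - dd h (dd k (transition c d)) x"
proof (rule parallel_at_change[OF c d x, where A = "tangent_bundle At" and F = "quad a" and v = 0])
  have smooth: "smooth_on (local_region At e (tangent_bundle At)) (local_rep At e (quad a))" if e: "e \<in> At" for e
    unfolding local_region_bundle[OF e]
    by (rule smooth_on_cong[OF smooth_alpha[OF e]])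
      (use open_chart_img[OF e] local_rep_quad[OF e] in \<open>auto intro: open_Times\<close>)
  have op: "open (local_region At e (tangent_bundle At))" if e: "e \<in> At" for e
    unfolding local_region_bundle[OF e] using open_chart_img[OF e] by (auto intro: open_Times)
  have eq: "dd h (local_rep At e (quad a)) z = dd h (\<alpha> e) z" if e: "e \<in> At" "z \<in> chart_img e \<times> UNIV" for e h z
    by (rule dd_cong_open[where S = "chart_img e \<times> UNIV"])
      (use open_chart_img[OF e(1)] local_rep_quad[OF e(1)] e(2) in \<open>auto intro: open_Times\<close>)
  show "smooth_on (local_region At e (tangent_bundle At)) (local_rep At e (quad a))" if e: "e \<in> At" for e
    by (rule smooth[OF e])
  show "open (local_region At e (tangent_bundle At))" if e: "e \<in> At" for e
    by (rule op[OF e])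
  have fm: "fibre_metric (local_rep At e (quad a)) (y, v) = fibre_metric (\<alpha> e) (y, v)"
    if e: "e \<in> At" "y \<in> chart_img e" for e y v
  proof -
    have "dd h (dd k (local_rep At e (quad a))) (y, v) = dd h (dd k (\<alpha> e)) (y, v)" for h k
      by (rule dd_cong_open[where S = "chart_img e \<times> UNIV"])
        (use open_chart_img[OF e(1)] eq[OF e(1)] e(2) in \<open>auto intro: open_Times\<close>)
    then show ?thesis by (simp add: fibre_metric_def pdv_eq_dd)
  qed
  show "fibre_nondegenerate (local_region At e (tangent_bundle At)) (local_rep At e (quad a))" if e: "e \<in> At" for e
  proof (rule fibre_nondegenerateI[OF smooth[OF e] op[OF e]])
    fix z assume "z \<in> local_region At e (tangent_bundle At)"
    then obtain y v where z: "z = (y, v)" "y \<in> chart_img e" by (auto simp: local_region_bundle[OF e])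
    show "invertible (fibre_metric (local_rep At e (quad a)) z)"
      unfolding z fm[OF e z(2)]
      using fibre_metric_quad_form[OF open_chart_img[OF e] z(2) smooth_metric_comp[OF e] metric_comp_sym[OF e]]
        metric_comp_invertible[OF e z(2)] by simp
  qed
  have par: "parallel_at (local_region At e (tangent_bundle At)) (local_rep At e (quad a)) y (LC e y)"
    if e: "e \<in> At" "y \<in> chart_img e" for e y
  proof -
    have "dd z (local_rep At e (quad a)) (y, v) = dd z (\<alpha> e) (y, v)" for z v
      by (rule eq[OF e(1)]) (simp add: e(2))
    moreover have "parallel_at (chart_img e \<times> UNIV) (\<alpha> e) y (LC e y)"
      by (rule levi_civita_parallel_at[OF open_chart_img[OF e(1)] e(2) smooth_metric_comp[OF e(1)]
        metric_comp_sym[OF e(1)] metric_comp_invertible[OF e]])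
    ultimately show ?thesis unfolding parallel_at_def local_region_bundle[OF e(1)] by metis
  qed
  have "x \<in> chart_img c" using x by (simp add: overlap_iff[OF c])
  then show "parallel_at (local_region At c (tangent_bundle At)) (local_rep At c (quad a)) x (LC c x)"
    by (rule par[OF c])
  show "(x, 0) \<in> local_region At c (tangent_bundle At)"
    using \<open>x \<in> chart_img c\<close> by (simp add: local_region_bundle[OF c])
  have "transition c d x \<in> chart_img d" using transition_overlap[OF c d x] by (simp add: overlap_iff[OF d])
  then show "parallel_at (local_region At d (tangent_bundle At)) (local_rep At d (quad a)) (transition c d x) (LC d (transition c d x))"
    by (rule par[OF d])
qed

lemma bilin_of_diff: "bilin_of (\<lambda>i j k. C i j k - D i j k) u w = bilin_of C u w - bilin_of D u w"
  by (simp add: bilin_of_def vec_eq_iff algebra_simps sum_subtractf)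

lemma berwald_imp_condition:
  assumes "berwald_type At L A"
  obtains T where "tensor12_field At T" "symmetric_tensor12 At T" "berwald_condition At A a b \<Omega> T"
proof -
  have "\<forall>c\<in>At. \<exists>\<Xi> :: 'n \<Rightarrow> 'n \<Rightarrow> 'n \<Rightarrow> real ^ 'n \<Rightarrow> real. \<forall>x v. (x, v) \<in> U c \<longrightarrow>
      (\<forall>i j. pdv j (spray (F c) i) (x, v) / 4 = (\<Sum>k\<in>UNIV. \<Xi> i j k x * v $ k))"
    using assms unfolding berwald_type_def cartan_connection_eq by blast
  from bchoice[OF this] obtain \<Xi> :: "('m, 'n) chart \<Rightarrow> 'n \<Rightarrow> 'n \<Rightarrow> 'n \<Rightarrow> real ^ 'n \<Rightarrow> real" where
    \<Xi>: "pdv j (spray (F c) i) (x, v) / 4 = (\<Sum>k\<in>UNIV. \<Xi> c i j k x * v $ k)"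
    if "c \<in> At" "(x, v) \<in> U c" for c x v i j
    by blast
  have hom: "F c (y, r *\<^sub>R w) = r\<^sup>2 * F c (y, w)" if "c \<in> At" "(y, w) \<in> U c" "r > 0" for c y w r
    by (rule rep_scale[OF that(1) region_img[OF that(2)] that(3)])
  have cartan: "parallel_at (U c) (F c) x (bilin_of (\<lambda>i j k. \<Xi> c i j k x))"
      "\<Xi> c i j k x = pdv k (pdv j (spray (F c) i)) (x, v) / 4"
    if c: "c \<in> At" and v: "(x, v) \<in> U c" for c x v i j k
    by (rule cartan_imp_parallel_at[OF smooth_rep[OF c] open_region[OF c] fibre_metric_invertible[OF c]
        region_cone[OF c] hom[OF c] \<Xi>[OF c] v], assumption+)+
  have par: "parallel_at (U c) (F c) x (bilin_of (\<lambda>i j k. \<Xi> c i j k x))" if c: "c \<in> At" and x: "x \<in> chart_img c" for c x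
    using cartan(1)[OF c] region_nonempty[OF c x] by blast
  have sym: "\<Xi> c i j k x = \<Xi> c i k j x" if c: "c \<in> At" and x: "x \<in> chart_img c" for c i j k x
    using par[OF c x] bilin_of_axis[of "\<lambda>i j k. \<Xi> c i j k x"] unfolding parallel_at_def by metis
  \<comment> \<open>The coefficients are given as mere functions. Near x a fixed vector v stays in
    the open region, and there they equal a quarter of the second fibre derivatives of the smooth
    spray at \<open>(y, v)\<close>.\<close>
  have smooth: "smooth_on (chart_img c) (\<Xi> c i j k)" if c: "c \<in> At" for c i j k
  proof (rule smooth_on_local)
    fix x assume "x \<in> chart_img c"
    then obtain v where v: "(x, v) \<in> U c" using region_nonempty[OF c] by blast
    let ?S = "{y. (y, v) \<in> U c}"
    have S: "open ?S" using open_vimage[OF open_region[OF c], of "\<lambda>y. (y, v)"]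
      by (simp add: vimage_def continuous_on_Pair)
    have "smooth_on (U c) (\<lambda>z. pdv k (pdv j (spray (F c) i)) z / 4)"
      unfolding pdv_eq_dd
      by (intro smooth_on_divide smooth_on_dd smooth_on_spray smooth_on_const smooth_rep[OF c] open_region[OF c]
          fibre_metric_invertible[OF c]) auto
    from smooth_on_affine_pre[OF _ open_region[OF c] this S, of "\<lambda>y. (y, 0)" "(0, v)"]
    have "smooth_on ?S (\<lambda>y. pdv k (pdv j (spray (F c) i)) (y, v) / 4)"
      using bounded_linear_Pair[OF bounded_linear_ident bounded_linear_zero] by simp
    then have "smooth_on ?S (\<Xi> c i j k)"
      by (rule smooth_on_cong[OF _ S]) (simp add: cartan(2)[OF c])
    then show "\<exists>T. open T \<and> x \<in> T \<and> smooth_on T (\<Xi> c i j k)" using S v by blast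
  qed
  define t where "t c i j k x = \<Xi> c i j k x - levi_civita (metric_comp At c a) x i j k" for c i j k x
  have t_bilin: "bilin_of (\<lambda>i j k. t c i j k x) u w = bilin_of (\<lambda>i j k. \<Xi> c i j k x) u w - LC c x u w" for c x u w
    unfolding t_def by (rule bilin_of_diff)
  obtain T where T: "tensor12_field At T" "symmetric_tensor12 At T"
    "\<And>c i j k x. c \<in> At \<Longrightarrow> x \<in> chart_img c \<Longrightarrow> tensor_comp At c T i j k x = t c i j k x"
  proof (rule tensor_field_of_components[of t])
    show "smooth_on (chart_img c) (t c i j k)" if c: "c \<in> At" for c i j k
      unfolding t_def[abs_def]
      by (intro smooth_on_diff smooth smooth_on_levi_civita open_chart_img c smooth_metric_comp metric_comp_invertible)
    show "t c i j k x = t c i k j x" if c: "c \<in> At" and x: "x \<in> chart_img c" for c i j k x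
      unfolding t_def
      using sym[OF c x, of i j k] levi_civita_sym[where g = "metric_comp At c a" and i = i and j = j and k = k,
          OF open_chart_img[OF c] x metric_comp_sym[OF c]] by simp
    fix c d x h k assume c: "c \<in> At" and d: "d \<in> At" and x: "x \<in> overlap c d"
    have xc: "x \<in> chart_img c" using x by (simp add: overlap_iff[OF c])
    have y: "transition c d x \<in> chart_img d" using transition_overlap[OF c d x] by (simp add: overlap_iff[OF d])
    obtain v where v: "(x, v) \<in> U c" using region_nonempty[OF c xc] by blast
    have "transition c d differentiable (at x)" by (rule smooth_on_differentiable[OF smooth_transition[OF c d] x])
    \<comment> \<open>Both connections carry the same second derivative of the transition, so their
      difference transforms as a tensor.\<close>
    then show "bilin_of (\<lambda>i j k. t d i j k (transition c d x)) (dd h (transition c d) x) (dd k (transition c d) x)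
        = dd (bilin_of (\<lambda>i j k. t c i j k x) h k) (transition c d) x"
      unfolding t_bilin
      by (simp add: dd_bilinear_simps levi_civita_change[OF c d x]
          parallel_at_change[OF c d x open_region smooth_rep nondegenerate_rep v par[OF c xc] par[OF d y]])
  qed blast
  have "berwald_condition At A a b \<Omega> T"
    unfolding berwald_condition_iff
  proof (intro ballI allI impI)
    fix c x v i assume c: "c \<in> At" and v: "(x, v) \<in> V c"
    have vU: "(x, v) \<in> U c" using v by (simp add: formula_region_iff[OF c])
    note x = region_img[OF vU]
    have "LC c x (axis i 1) v + TC c T x (axis i 1) v = bilin_of (\<lambda>i j k. \<Xi> c i j k x) (axis i 1) v"
      by (simp add: T(3)[OF c x] t_bilin)
    then have "dd (axis i 1, - (LC c x (axis i 1) v + TC c T x (axis i 1) v)) (F c) (x, v) = 0"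
      using par[OF c x] vU unfolding parallel_at_def by metis
    then show "cond_lhs c x v i = cond_lin c T x v i + cond_quad c T x v i *
       (\<Omega> ((\<beta> c (x, v))\<^sup>2 / \<alpha> c (x, v)) / (deriv \<Omega> ((\<beta> c (x, v))\<^sup>2 / \<alpha> c (x, v)) * \<beta> c (x, v)) - \<beta> c (x, v) / \<alpha> c (x, v))"
      using condition_iff_horizontal[OF c v] by blast
  qed
  with T(1,2) show ?thesis by (rule that)
qed

end

section \<open>From the tensor field to the Berwald property\<close>

text \<open>Two distinct points of a connected set of reals would bring a whole open interval into
  \<open>Z\<close>. Used to make the ratio constant on a ball all of whose ratios are
  critical.\<close>

lemma connected_real_interior_empty:
  fixes S :: "real set"
  assumes "connected S" "S \<subseteq> Z" "interior Z = {}" "x \<in> S" "y \<in> S"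
  shows "x = y"
proof (rule ccontr)
  assume "x \<noteq> y"
  then obtain p q where pq: "p < q" "p \<in> S" "q \<in> S" using assms(4,5) by (metis linorder_neqE_linordered_idom)
  then have "{p..q} \<subseteq> S" using connected_contains_Icc[OF assms(1)] by blast
  then have "{p<..<q} \<subseteq> Z" using assms(2) by force
  then have "{p<..<q} \<subseteq> interior Z" by (intro interior_maximal) auto
  moreover have "(p + q) / 2 \<in> {p<..<q}" using pq by simp
  ultimately show False using assms(3) by blast
qed

lemma linear_times_left: "linear f \<Longrightarrow> linear (\<lambda>z. k * f z :: real)"
  using linear_compose[of f "(*) k"] by (simp add: o_def linear_times)

lemma horizontal_zero_all_directions:
  fixes B :: "real ^ 'k::finite \<Rightarrow> 'b \<Rightarrow> 'b::real_normed_vector" and f :: "(real ^ 'k) \<times> 'b \<Rightarrow> 'd::real_normed_vector"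
  assumes "\<And>i. dd (axis i 1, - B (axis i 1) v) f (x, v) = 0" "linear (\<lambda>h. B h v)" "f differentiable (at (x, v))"
  shows "dd (h, - B h v) f (x, v) = 0"
proof -
  have "linear (\<lambda>h. dd (h, - B h v) f (x, v))"
    by (rule linear_compose[OF _ dd_linear[OF assms(3)], unfolded o_def])
      (auto intro!: linearI simp: linear_add[OF assms(2)] linear_cmul[OF assms(2)])
  from linear_axis_expansion[OF this, of h] show ?thesis by (simp add: assms(1))
qed

context alpha_beta_geometry
begin

text \<open>An arbitrary choice of \<open>B\<close> at each point is enough, because
  \<open>berwald_type\<close> asks for no regularity of its coefficients.\<close>

lemma berwald_typeI:
  assumes "\<And>c x. c \<in> At \<Longrightarrow> x \<in> chart_img c \<Longrightarrow> \<exists>B. parallel_at (U c) (F c) x B"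
  shows "berwald_type At L A"
  unfolding berwald_type_def
proof
  fix c assume c: "c \<in> At"
  define B where "B x = (SOME B. parallel_at (U c) (F c) x B)" for x
  have par: "parallel_at (U c) (F c) x (B x)" if "x \<in> chart_img c" for x
    unfolding B_def by (rule someI_ex[OF assms[OF c that]])
  have "cartan_connection At c L i j (x, v) = (\<Sum>k\<in>UNIV. B x (axis j 1) (axis k 1) $ i * v $ k)"
    if v: "(x, v) \<in> U c" for x v i j
  proof -
    have "bilinear (B x)" using par[OF region_img[OF v]] by (simp add: parallel_at_def)
    then have "B x (axis j 1) v = bilin_of (\<lambda>i j k. B x (axis j 1) (axis k 1) $ i) (axis j 1) v"
      by (rule bilinear_eq_bilin_of)
    moreover have "cartan_connection At c L i j (x, v) = B x (axis j 1) v $ i"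
      unfolding cartan_connection_eq
      by (rule parallel_at_imp_cartan[OF smooth_rep[OF c] open_region[OF c] v fibre_metric_invertible[OF c] par[OF region_img[OF v]]])
    ultimately show ?thesis by (simp add: bilin_of_axis_left)
  qed
  then show "\<exists>\<Xi>. \<forall>(x, v)\<in>U c. \<forall>i j. cartan_connection At c L i j (x, v) = (\<Sum>k\<in>UNIV. \<Xi> i j k x * v $ k)"
    by (intro exI[of _ "\<lambda>i j k x. B x (axis j 1) (axis k 1) $ i"]) auto
qed

text \<open>Extension by continuity. The points of \<open>S\<close> may lie over other base points,
  because the form can vanish at x itself; hence the coefficients vary with y and density refers to
  open sets of the total space.\<close>

lemma parallel_at_of_dense:
  assumes c: "c \<in> At"
    and zero: "\<And>y w i. (y, w) \<in> S \<Longrightarrow> dd (axis i 1, - bilin_of (C y) (axis i 1) w) (F c) (y, w) = 0"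
    and S: "S \<subseteq> U c"
    and sym: "\<And>i j k. C x i j k = C x i k j"
    and cont: "\<And>i j k. continuous_on (chart_img c) (\<lambda>y. C y i j k)"
    and dense: "\<And>v N. (x, v) \<in> N \<Longrightarrow> N \<subseteq> U c \<Longrightarrow> open N \<Longrightarrow> N \<inter> S \<noteq> {}"
  shows "parallel_at (U c) (F c) x (bilin_of (C x))"
  unfolding parallel_at_def
proof (intro conjI allI impI)
  show "bilinear (bilin_of (C x))" by (rule bilinear_bilin_of)
  show "bilin_of (C x) u w = bilin_of (C x) w u" for u w by (rule bilin_of_sym[OF sym])
  fix v h assume v: "(x, v) \<in> U c"
  show "dd (h, - bilin_of (C x) h v) (F c) (x, v) = 0"
  proof (rule horizontal_zero_all_directions)
    show "F c differentiable (at (x, v))" by (rule smooth_on_differentiable[OF smooth_rep[OF c] v])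
    show "linear (\<lambda>h. bilin_of (C x) h v)" using bilinear_bilin_of by (auto simp: bilinear_def)
    fix i
    \<comment> \<open>The horizontal derivative written out in components, which exhibits it as a
      continuous function on the region.\<close>
    define Q where "Q z = dd (axis i 1, 0) (F c) z
      - (\<Sum>j\<in>UNIV. (\<Sum>k\<in>UNIV. C (fst z) j i k * snd z $ k) * dd (0, axis j 1) (F c) z)" for z
    have Q: "dd (axis i 1, - bilin_of (C y) (axis i 1) w) (F c) (y, w) = Q (y, w)" if "(y, w) \<in> U c" for y w
    proof -
      note d = smooth_on_differentiable[OF smooth_rep[OF c] that]
      show ?thesis
        unfolding dd_pair[OF d, of "axis i 1" "- bilin_of (C y) (axis i 1) w"] dd_fibre(4)[OF d]
          linear_axis_expansion[OF linear_fibre_dd(1)[OF d], of "bilin_of (C y) (axis i 1) w"]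
        by (simp add: Q_def bilin_of_axis_left)
    qed
    have "continuous_on (U c) (\<lambda>z. C (fst z) j i k)" for j k
      by (rule continuous_on_compose2[OF cont]) (use region_subset[of c] in \<open>auto intro: continuous_intros\<close>)
    moreover have "continuous_on (U c) (dd h (F c))" for h
      by (rule smooth_on_continuous_on[OF smooth_on_dd[OF smooth_rep[OF c]]])
    ultimately have "continuous_on (U c) Q"
      unfolding Q_def by (intro continuous_intros)
    then have op: "open {z \<in> U c. Q z \<noteq> 0}" by (rule open_nonzero[OF open_region[OF c]])
    have "Q (x, v) = 0"
    proof (rule ccontr)
      assume "Q (x, v) \<noteq> 0"
      with v have "{z \<in> U c. Q z \<noteq> 0} \<inter> S \<noteq> {}" by (intro dense[OF _ _ op]) auto
      then obtain y w where "(y, w) \<in> U c" "Q (y, w) \<noteq> 0" "(y, w) \<in> S" by auto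
      then show False using zero Q by metis
    qed
    then show "dd (axis i 1, - bilin_of (C x) (axis i 1) v) (F c) (x, v) = 0" using Q[OF v] by simp
  qed
qed

section \<open>Density of the region where the condition is defined\<close>

abbreviation "metric_at c x u w \<equiv> (\<Sum>i\<in>UNIV. \<Sum>j\<in>UNIV. metric_comp At c a i j x * u $ i * w $ j)"

lemma bilinear_metric_at: "bilinear (\<lambda>u w. metric_at c x u w)"
  by (auto simp: bilinear_def algebra_simps sum.distrib sum_distrib_left intro!: linearI)

lemma metric_at_sym: "c \<in> At \<Longrightarrow> x \<in> chart_img c \<Longrightarrow> metric_at c x u w = metric_at c x w u"
  by (subst sum.swap) (simp add: metric_comp_sym[of c x] mult.commute mult.left_commute)

lemma alpha_eq_metric_at: "\<alpha> c (x, v) = metric_at c x v v"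
  by (simp add: quad_form_def)

lemma metric_at_nondegenerate:
  assumes c: "c \<in> At" and x: "x \<in> chart_img c" and z: "\<And>w. metric_at c x w u = 0"
  shows "u = 0"
proof -
  let ?M = "\<chi> i j. metric_comp At c a i j x"
  have "(?M *v u) $ i = 0" for i
  proof -
    have "(\<Sum>j\<in>UNIV. metric_comp At c a i' j x * axis i 1 $ i' * u $ j) = (if i' = i then (?M *v u) $ i else 0)" for i'
      by (simp add: axis_def matrix_vector_mult_def)
    then show ?thesis using z[of "axis i 1"] by simp
  qed
  then have "?M *v u = 0" by (simp add: vec_eq_iff)
  then have "(matrix_inv ?M ** ?M) *v u = 0" by (simp add: matrix_vector_mul_assoc[symmetric])
  then show ?thesis by (simp add: matrix_inv_left[OF metric_comp_invertible[OF c x]])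
qed

text \<open>Were \<alpha> zero on an open part of a fibre, polarization would make the metric zero
  there, against nondegeneracy.\<close>

lemma alpha_nonzero_dense:
  assumes c: "c \<in> At" and x: "x \<in> chart_img c" and Z: "open Z" "v \<in> Z"
  shows "\<exists>w\<in>Z. \<alpha> c (x, w) \<noteq> 0"
proof (rule ccontr)
  assume "\<not> ?thesis"
  then have zero: "metric_at c x w w = 0" if "w \<in> Z" for w
    using that by (auto simp: alpha_eq_metric_at)
  have "metric_at c x u w = 0" for u w
    by (rule symmetric_bilinear_zero_on_open[where D = "\<lambda>u w. metric_at c x u w",
        OF bilinear_metric_at metric_at_sym[OF c x] Z zero])
  then have "u = 0" for u :: "real ^ 'n" by (intro metric_at_nondegenerate[OF c x])
  from this[of "axis undefined 1"] show False by (simp add: axis_eq_0_iff)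
qed

lemma linear_beta: "linear (\<lambda>u. \<beta> c (x, u))"
  by (auto simp: lin_form_def algebra_simps sum.distrib sum_distrib_left intro!: linearI)

text \<open>A zero of the linear function is left by a small step along a vector u on which it does
  not vanish.\<close>

lemma beta_nonzero_dense:
  assumes "\<beta> c (x, u) \<noteq> 0" and Z: "open Z" "v \<in> Z"
  shows "\<exists>w\<in>Z. \<beta> c (x, w) \<noteq> 0"
proof (cases "\<beta> c (x, v) = 0")
  case True
  have "open ((\<lambda>t::real. v + t *\<^sub>R u) -` Z)" by (intro open_vimage Z(1) continuous_intros)
  moreover have "0 \<in> (\<lambda>t::real. v + t *\<^sub>R u) -` Z" using Z(2) by simp
  ultimately obtain e where e: "e > 0" "ball 0 e \<subseteq> (\<lambda>t::real. v + t *\<^sub>R u) -` Z"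
    using open_contains_ball by blast
  then have "v + (e / 2) *\<^sub>R u \<in> Z" by (auto simp: subset_iff dist_norm)
  moreover have eq: "\<beta> c (x, v + (e / 2) *\<^sub>R u) = e / 2 * \<beta> c (x, u)"
    using linear_add[OF linear_beta[of c x], of v "(e / 2) *\<^sub>R u"] linear_cmul[OF linear_beta[of c x], of "e / 2" u]
      True by simp
  have "\<beta> c (x, v + (e / 2) *\<^sub>R u) \<noteq> 0" unfolding eq using assms(1) e by simp
  ultimately show ?thesis by blast
qed (use Z in blast)

lemma continuous_fibre:
  "continuous_on S (\<lambda>w. \<alpha> c (x, w))" "continuous_on S (\<lambda>w. \<beta> c (x, w))"
  unfolding quad_form_def lin_form_def by (auto intro!: continuous_intros)

text \<open>If \<open>\<Omega>'\<close> vanished on an open set of vectors, then \<open>\<beta>\<^sup>2 / \<alpha>\<close> would be constant there, which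
  makes the metric a multiple of the rank one form \<open>\<beta> \<otimes> \<beta>\<close>.\<close>

lemma formula_region_dense:
  assumes c: "c \<in> At" and x: "x \<in> chart_img c" and dim: "\<exists>i j :: 'n. i \<noteq> j"
    and b: "\<beta> c (x, u) \<noteq> 0" and N: "open N" "(x, v) \<in> N" "N \<subseteq> U c"
  shows "\<exists>w. (x, w) \<in> N \<inter> V c"
proof -
  let ?V1 = "{w. (x, w) \<in> N}" and ?s = "\<lambda>w. (\<beta> c (x, w))\<^sup>2 / \<alpha> c (x, w)"
  have V1: "open ?V1" by (rule open_fibre[OF N(1)])
  obtain w1 where w1: "w1 \<in> ?V1" "\<beta> c (x, w1) \<noteq> 0"
    using beta_nonzero_dense[OF b V1, of v] N(2) by blast
  let ?V2 = "{w \<in> ?V1. \<beta> c (x, w) \<noteq> 0}"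
  have V2: "open ?V2" by (rule open_nonzero[OF V1 continuous_fibre(2)])
  obtain w2 where w2: "w2 \<in> ?V2" "\<alpha> c (x, w2) \<noteq> 0"
    using alpha_nonzero_dense[OF c x V2, of w1] w1 by blast
  let ?V3 = "{w \<in> ?V2. \<alpha> c (x, w) \<noteq> 0}"
  have V3: "open ?V3" by (rule open_nonzero[OF V2 continuous_fibre(1)])
  obtain e where e: "e > 0" "ball w2 e \<subseteq> ?V3" using V3 w2 open_contains_ball by blast
  have "\<exists>w\<in>ball w2 e. deriv \<Omega> (?s w) \<noteq> 0"
  proof (rule ccontr)
    assume "\<not> ?thesis"
    \<comment> \<open>All ratios over the ball are critical. Their set is connected and, by
      \<open>critical\<close>, has no room for an interval, so it is a single value
      \<open>k\<close>, nonzero because \<beta> is.\<close>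
    then have crit: "?s ` ball w2 e \<subseteq> {s \<in> ratio_set A a b. deriv \<Omega> s = 0}"
      using e(2) N(3) ratio_mem(1)[OF c] by fastforce
    have "continuous_on (ball w2 e) ?s"
      using e(2) by (intro continuous_intros continuous_fibre) auto
    then have conn: "connected (?s ` ball w2 e)" by (intro connected_continuous_image) auto
    have const: "?s w = ?s w2" if "w \<in> ball w2 e" for w
      by (rule connected_real_interior_empty[OF conn crit critical]) (use that e(1) in auto)
    define k where "k = ?s w2"
    have k: "k \<noteq> 0" using w2 by (simp add: k_def)
    \<comment> \<open>Polarization of \<open>\<beta>\<^sup>2 = k \<alpha>\<close>, known on the
      ball, extends it to all pairs of vectors.\<close>
    have prod: "\<beta> c (x, y) * \<beta> c (x, z) - k * metric_at c x y z = 0" for y z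
    proof (rule symmetric_bilinear_zero_on_open[where D = "\<lambda>y z. \<beta> c (x, y) * \<beta> c (x, z) - k * metric_at c x y z"
          and V = "ball w2 e" and v = w2])
      have "bilinear (\<lambda>y z. \<beta> c (x, y) * \<beta> c (x, z))"
        using linear_add[OF linear_beta[of c x]] linear_cmul[OF linear_beta[of c x]]
        by (auto simp: bilinear_def algebra_simps intro!: linearI)
      moreover have "bilinear (\<lambda>y z. k * metric_at c x y z)"
        using bilinear_metric_at[of c x] unfolding bilinear_def
        by (auto intro: linear_times_left)
      ultimately show "bilinear (\<lambda>y z. \<beta> c (x, y) * \<beta> c (x, z) - k * metric_at c x y z)"
        by (rule bilinear_diff)
      show "\<beta> c (x, y) * \<beta> c (x, z) - k * metric_at c x y z = \<beta> c (x, z) * \<beta> c (x, y) - k * metric_at c x z y" for y z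
        using metric_at_sym[OF c x, of y z] by simp
      show "\<beta> c (x, y) * \<beta> c (x, y) - k * metric_at c x y y = 0" if y: "y \<in> ball w2 e" for y
      proof -
        have "\<alpha> c (x, y) \<noteq> 0" using y e(2) by auto
        then have "(\<beta> c (x, y))\<^sup>2 = k * \<alpha> c (x, y)"
          using const[OF y] unfolding k_def[symmetric] by (simp add: field_simps)
        then show ?thesis unfolding alpha_eq_metric_at power2_eq_square by simp
      qed
    qed (use e in auto)
    obtain i j :: 'n where ij: "i \<noteq> j" using dim by blast
    \<comment> \<open>A nonzero vector in the kernel of \<beta>, available because there are two
      basis vectors. By \<open>prod\<close> it is orthogonal to everything, which the metric
      forbids.\<close>
    define u0 :: "real ^ 'n" where "u0 = (if \<beta> c (x, axis i 1) = 0 then axis i 1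
       else \<beta> c (x, axis j 1) *\<^sub>R axis i 1 - \<beta> c (x, axis i 1) *\<^sub>R axis j 1)"
    have "\<beta> c (x, u0) = 0"
      using linear_diff[OF linear_beta[of c x]] linear_cmul[OF linear_beta[of c x]] by (simp add: u0_def)
    then have "metric_at c x w u0 = 0" for w using prod[of w u0] k by simp
    then have "u0 = 0" by (rule metric_at_nondegenerate[OF c x])
    moreover have "u0 $ (if \<beta> c (x, axis i 1) = 0 then i else j) \<noteq> 0"
      using ij by (auto simp: u0_def axis_def)
    ultimately show False by simp
  qed
  then obtain w where w: "w \<in> ball w2 e" "deriv \<Omega> (?s w) \<noteq> 0" by blast
  then have "w \<in> ?V3" using e by blast
  then have "(x, w) \<in> N \<inter> V c" using w N(3) by (auto simp: formula_region_iff[OF c])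
  then show ?thesis by blast
qed

text \<open>Here the ratio depends on the base point only, so it may be critical throughout and the
  condition may say nothing. For the same reason \<open>F\<close> is a quadratic form on each fibre,
  and parallelism at one nonzero vector determines \<open>B\<close>.\<close>

lemma parallel_at_dimension_one:
  assumes c: "c \<in> At" and x: "x \<in> chart_img c" and dim: "\<And>i j :: 'n. i = j"
  shows "\<exists>B. parallel_at (U c) (F c) x B"
proof -
  \<comment> \<open>The only index.\<close>
  let ?n = "undefined :: 'n"
  have vec1: "u = u $ ?n *\<^sub>R axis ?n 1" for u :: "real ^ 'n"
  proof -
    have "u $ i = (u $ ?n *\<^sub>R axis ?n 1) $ i" for i
      unfolding dim[of i ?n] by simp
    then show ?thesis unfolding vec_eq_iff by (rule allI)
  qed
  have eqI: "u = w" if "u $ ?n = w $ ?n" for u w :: "real ^ 'n"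
    by (rule trans[OF vec1[of u]]) (simp only: that vec1[of w, symmetric])
  have F0: "F c (y, 0) = 0" if "y \<in> chart_img c" for y
    using rep_scale[OF c that, of 2 0] by simp
  have alpha: "\<alpha> c (y, w) \<noteq> 0" if y: "y \<in> chart_img c" and w: "w \<noteq> 0" for y w
  proof
    assume 0: "\<alpha> c (y, w) = 0"
    have "metric_at c y u w = 0" for u
    proof -
      have "w $ ?n \<noteq> 0" using w eqI[of w 0] by auto
      then have "u = (u $ ?n / w $ ?n) *\<^sub>R w" by (intro eqI) simp
      then have "metric_at c y u w = (u $ ?n / w $ ?n) * metric_at c y w w"
        using bilinear_lmul[OF bilinear_metric_at[of c y], of "u $ ?n / w $ ?n" w w] by simp
      then show ?thesis using 0 by (simp add: alpha_eq_metric_at)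
    qed
    then show False using metric_at_nondegenerate[OF c y] w by blast
  qed
  \<comment> \<open>Homogeneity for every real factor: \<alpha> and the square of \<beta> do not see
    the sign.\<close>
  have hom: "F c (y, t *\<^sub>R w) = t\<^sup>2 * F c (y, w)" if y: "y \<in> chart_img c" for y w t
  proof (cases "t = 0 \<or> w = 0")
    case True
    then show ?thesis using F0[OF y] by auto
  next
    case False
    have "\<alpha> c (y, t *\<^sub>R w) = t\<^sup>2 * \<alpha> c (y, w)" "\<beta> c (y, t *\<^sub>R w) = t * \<beta> c (y, w)"
      by (simp_all add: quad_form_def lin_form_def sum_distrib_left power2_eq_square mult_ac)
    then show ?thesis
      using rep_alpha_beta[OF c y alpha[OF y], of w] rep_alpha_beta[OF c y alpha[OF y], of "t *\<^sub>R w"] False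
      by (simp add: power_mult_distrib)
  qed
  have op: "open {v. (x, v) \<in> U c}" by (rule open_fibre[OF open_region[OF c]])
  \<comment> \<open>The fibre is open and nonempty, and the singleton of the zero vector is not
    open.\<close>
  obtain v0 where v0: "(x, v0) \<in> U c" "v0 \<noteq> 0"
  proof (rule ccontr)
    assume "\<not> thesis"
    then have "{v. (x, v) \<in> U c} = {0}" using that region_nonempty[OF c x] by blast
    with op show False using not_open_singleton[of "0 :: real ^ 'n"] by simp
  qed
  have v0n: "v0 $ ?n \<noteq> 0" using v0(2) eqI[of v0 0] by auto
  have line: "u = (u $ ?n / v0 $ ?n) *\<^sub>R v0" for u using v0n by (intro eqI) simp
  note F = smooth_rep[OF c]
  note d = smooth_on_differentiable[OF F]
  have sc: "dd (h, t *\<^sub>R k) (F c) (y, t *\<^sub>R w) = t\<^sup>2 * dd (h, k) (F c) (y, w)"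
    if "(y, w) \<in> U c" "(y, t *\<^sub>R w) \<in> U c" for h k t y w
    by (rule dd_scaling[OF open_region[OF c] that(1) hom d[OF that(1)] d[OF that(2)]]) (rule region_img)
  define \<psi> where "\<psi> = dd (0, v0) (F c) (x, v0)"
  \<comment> \<open>If the fibre derivative vanished at \<open>v0\<close>, Euler's theorem in degree
    one would make \<open>v0\<close> a null vector of the Hessian.\<close>
  have \<psi>: "\<psi> \<noteq> 0"
  proof
    assume 0: "\<psi> = 0"
    have "dd (0, v0) (dd (0, k) (F c)) (x, v0) = 0" for k
    proof -
      have "dd (0, k) (F c) (x, v0) = (k $ ?n / v0 $ ?n) *\<^sub>R \<psi>"
        unfolding \<psi>_def dd_fibre(3)[OF d[OF v0(1)], symmetric] line[of k, symmetric] ..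
      moreover have "dd (0, k) (F c) (x, r *\<^sub>R v0) = r ^ 1 * dd (0, k) (F c) (x, v0)" if "r > 0" for r
        using sc[OF v0(1) region_cone[OF c v0(1) that], of 0 k] that
          dd_fibre(3)[OF d[OF region_cone[OF c v0(1) that]], of r k] by (simp add: power2_eq_square)
      from euler_homogeneous[OF smooth_on_differentiable[OF smooth_on_dd[OF F] v0(1)] this]
      have "dd (0, v0) (dd (0, k) (F c)) (x, v0) = dd (0, k) (F c) (x, v0)" by simp
      ultimately show ?thesis using 0 by simp
    qed
    then show False using fibre_nondegenerateI[OF F open_region[OF c] fibre_metric_invertible[OF c]] v0
      unfolding fibre_nondegenerate_def by blast
  qed
  define \<phi> where "\<phi> = dd (axis ?n 1, 0) (F c) (x, v0)"
  \<comment> \<open>The quotient \<open>\<phi> / \<psi>\<close> solves the parallelism equation at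
    \<open>v0\<close>: the base derivative is \<open>h $ ?n * \<phi>\<close>, and the fibre
    derivative along \<open>B h v0\<close> is
    \<open>\<phi> / \<psi> * h $ ?n * \<psi>\<close>.\<close>
  define B where "B h k = (\<phi> / \<psi> * h $ ?n) *\<^sub>R k" for h k :: "real ^ 'n"
  have "bilinear B"
    by (auto simp: bilinear_def B_def ring_distribs add_divide_distrib scaleR_add_left scaleR_add_right mult_ac intro!: linearI)
  moreover have "B h k = B k h" for h k by (rule eqI) (simp add: B_def)
  moreover have "dd (h, - B h v) (F c) (x, v) = 0" if v: "(x, v) \<in> U c" for h v
  proof (cases "v = 0")
    case True
    \<comment> \<open>The region may contain the zero vector. It is fixed by scaling with 2, so the
      base derivative there equals four times itself.\<close>
    have "dd (h, 2 *\<^sub>R 0) (F c) (x, 2 *\<^sub>R v) = 2\<^sup>2 * dd (h, 0) (F c) (x, v)"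
      by (rule sc[OF v]) (use v True in simp)
    then show ?thesis using True by (simp add: B_def)
  next
    case False
    \<comment> \<open>This factor can be negative, which is why \<open>hom\<close> was extended to
      all reals.\<close>
    let ?t = "v $ ?n / v0 $ ?n"
    have tv: "?t *\<^sub>R v0 = v" by (rule line[symmetric])
    have "dd (h, ?t *\<^sub>R (- B h v0)) (F c) (x, ?t *\<^sub>R v0) = ?t\<^sup>2 * dd (h, - B h v0) (F c) (x, v0)"
      by (rule sc[OF v0(1)]) (simp only: tv v)
    moreover have "?t *\<^sub>R (- B h v0) = - B h v" by (subst (2) tv[symmetric]) (simp add: B_def mult_ac)
    moreover have "dd (h, - B h v0) (F c) (x, v0) = 0"
    proof -
      have "dd (h, 0) (F c) (x, v0) = h $ ?n * \<phi>"
        using dd_base(2)[OF d[OF v0(1)], of "h $ ?n" "axis ?n 1"] unfolding vec1[of h, symmetric] by (simp add: \<phi>_def)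
      moreover have "dd (0, B h v0) (F c) (x, v0) = \<phi> / \<psi> * h $ ?n * \<psi>"
        unfolding B_def dd_fibre(3)[OF d[OF v0(1)]] by (simp add: \<psi>_def)
      ultimately show ?thesis
        unfolding dd_pair[OF d[OF v0(1)], of h "- B h v0"] dd_fibre(4)[OF d[OF v0(1)]] using \<psi> by simp
    qed
    ultimately show ?thesis by (simp add: tv)
  qed
  ultimately have "parallel_at (U c) (F c) x B" unfolding parallel_at_def by blast
  then show ?thesis by blast
qed

lemma smooth_levi_civita: "c \<in> At \<Longrightarrow> smooth_on (chart_img c) (\<lambda>x. levi_civita (metric_comp At c a) x i j k)"
  by (intro smooth_on_levi_civita open_chart_img smooth_metric_comp metric_comp_invertible)

lemma levi_civita_comp_sym:
  "c \<in> At \<Longrightarrow> x \<in> chart_img c \<Longrightarrow> levi_civita (metric_comp At c a) x i j k = levi_civita (metric_comp At c a) x i k j"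
  by (rule levi_civita_sym[OF open_chart_img]) (auto intro: metric_comp_sym)

text \<open>Near such a point \<open>F\<close> is the constant multiple \<open>\<Omega> 0\<close> of
  \<alpha> wherever \<alpha> is nonzero, so Levi-Civita is parallel there, and vectors with \<alpha>
  zero are reached by density.\<close>

lemma parallel_at_of_vanishing_form:
  assumes c: "c \<in> At" and x: "x \<in> chart_img c" and N: "open N" "x \<in> N"
    and b: "\<And>y u. y \<in> N \<inter> chart_img c \<Longrightarrow> \<beta> c (y, u) = 0"
  shows "parallel_at (U c) (F c) x (LC c x)"
proof (rule parallel_at_of_dense[OF c, where S = "{z \<in> U c. \<alpha> c z \<noteq> 0} \<inter> N \<times> UNIV"])
  let ?S = "{z \<in> U c. \<alpha> c z \<noteq> 0} \<inter> N \<times> UNIV"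
  have S: "open ?S" using open_nondegenerate_region[OF c] N(1) by (auto intro: open_Times)
  show "dd (axis i 1, - LC c y (axis i 1) w) (F c) (y, w) = 0" if yw: "(y, w) \<in> ?S" for y w i
  proof -
    have y: "y \<in> chart_img c" using yw region_img by blast
    have "dd (axis i 1, - LC c y (axis i 1) w) (F c) (y, w) = dd (axis i 1, - LC c y (axis i 1) w) (\<lambda>z. \<Omega> 0 * \<alpha> c z) (y, w)"
    proof (rule dd_cong_open[OF S yw])
      fix z assume "z \<in> ?S"
      then show "F c z = \<Omega> 0 * \<alpha> c z"
        using rep_alpha_beta[OF c, of "fst z" "snd z"] b[of "fst z" "snd z"] region_subset[of c] by auto
    qed
    also have "\<dots> = \<Omega> 0 * dd (axis i 1, - LC c y (axis i 1) w) (\<alpha> c) (y, w)"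
      by (rule dd_has_derivative[OF has_derivative_mult_right[OF smooth_on_has_derivative[OF smooth_alpha[OF c]]]])
        (use y in auto)
    also have "dd (axis i 1, - LC c y (axis i 1) w) (\<alpha> c) (y, w) = 0"
      by (rule levi_civita_metric_compatible[OF open_chart_img[OF c] y smooth_metric_comp[OF c]
            metric_comp_sym[OF c] metric_comp_invertible[OF c y]])
    finally show ?thesis by simp
  qed
  show "?S \<subseteq> U c" by blast
  show "levi_civita (metric_comp At c a) x i j k = levi_civita (metric_comp At c a) x i k j" for i j k
    by (rule levi_civita_comp_sym[OF c x])
  show "continuous_on (chart_img c) (\<lambda>y. levi_civita (metric_comp At c a) y i j k)" for i j k
    by (rule smooth_on_continuous_on[OF smooth_levi_civita[OF c]])
  fix v M assume M: "(x, v) \<in> M" "M \<subseteq> U c" "open M"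
  obtain w where "(x, w) \<in> M" "\<alpha> c (x, w) \<noteq> 0"
    using alpha_nonzero_dense[OF c x open_fibre[OF M(3)], of v x] M(1) by blast
  then show "M \<inter> ?S \<noteq> {}" using M(2) N(2) by blast
qed

lemma condition_imp_berwald:
  assumes T: "tensor12_field At T" "symmetric_tensor12 At T" and cond: "berwald_condition At A a b \<Omega> T"
  shows "berwald_type At L A"
proof (rule berwald_typeI)
  fix c x assume c: "c \<in> At" and x: "x \<in> chart_img c"
  show "\<exists>B. parallel_at (U c) (F c) x B"
  proof (cases "(\<forall>i j :: 'n. i = j) \<or> (\<exists>N. open N \<and> x \<in> N \<and> (\<forall>y u. y \<in> N \<inter> chart_img c \<longrightarrow> \<beta> c (y, u) = 0))")
    case True
    then show ?thesis
    proof
      assume "\<forall>i j :: 'n. i = j"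
      then show ?thesis by (intro parallel_at_dimension_one[OF c x]) blast
    next
      assume "\<exists>N. open N \<and> x \<in> N \<and> (\<forall>y u. y \<in> N \<inter> chart_img c \<longrightarrow> \<beta> c (y, u) = 0)"
      then obtain N where N: "open N" "x \<in> N" "\<And>y u. y \<in> N \<inter> chart_img c \<Longrightarrow> \<beta> c (y, u) = 0"
        by auto
      have "parallel_at (U c) (F c) x (LC c x)"
        by (rule parallel_at_of_vanishing_form[OF c x N(1,2)]) (rule N(3))
      then show ?thesis by blast
    qed
  next
    case False
    then have dim: "\<exists>i j :: 'n. i \<noteq> j" by simp
    have nz: "\<exists>y u. y \<in> N \<inter> chart_img c \<and> \<beta> c (y, u) \<noteq> 0" if "open N" "x \<in> N" for N
      using False that by blast
    define C where "C y i j k = levi_civita (metric_comp At c a) y i j k + tensor_comp At c T i j k y" for y i j k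
    have C: "bilin_of (C y) u w = LC c y u w + TC c T y u w" for y u w
      by (simp add: C_def[abs_def] bilin_of_def vec_eq_iff algebra_simps sum.distrib)
    have "parallel_at (U c) (F c) x (bilin_of (C x))"
    proof (rule parallel_at_of_dense[OF c, where S = "V c"])
      show "dd (axis i 1, - bilin_of (C y) (axis i 1) w) (F c) (y, w) = 0" if "(y, w) \<in> V c" for y w i
        \<comment> \<open>The condition at points of the formula region, read as parallelism for
          \<open>LC + T\<close>.\<close>
        unfolding C using condition_iff_horizontal[OF c that] cond c that unfolding berwald_condition_iff by blast
      show "V c \<subseteq> U c" by (auto simp: local_region_def formula_region_def)
      show "C x i j k = C x i k j" for i j k
        using levi_civita_comp_sym[OF c x, of i j k] T(2) coord_basis_tangent[OF c x]
        by (simp add: C_def tensor_comp_def symmetric_tensor12_def)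
      show "continuous_on (chart_img c) (\<lambda>y. C y i j k)" for i j k
        unfolding C_def using T(1) c
        by (intro continuous_on_add smooth_on_continuous_on[OF smooth_levi_civita[OF c]] smooth_on_continuous_on)
          (auto simp: tensor12_field_def)
      fix v M assume M: "(x, v) \<in> M" "M \<subseteq> U c" "open M"
      \<comment> \<open>The base point is moved first, keeping v, to some y where the form is
        nonzero; within the fibre over y the formula region is dense.\<close>
      have "open {y. (y, v) \<in> M}"
        using open_vimage[OF M(3), of "\<lambda>y. (y, v)"] by (simp add: vimage_def continuous_on_Pair)
      then obtain y u where y: "(y, v) \<in> M" "y \<in> chart_img c" "\<beta> c (y, u) \<noteq> 0"
        using nz[of "{y. (y, v) \<in> M}"] M(1) by blast
      show "M \<inter> V c \<noteq> {}"
        using formula_region_dense[OF c y(2) dim y(3) M(3) y(1) M(2)] by blast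
    qed
    then show ?thesis by blast
  qed
qed

end

section \<open>The differentiated condition\<close>

context alpha_beta_geometry
begin

abbreviation "ratio c z \<equiv> (\<beta> c z)\<^sup>2 / \<alpha> c z"

text \<open>\<open>deriv_lin\<close> and \<open>deriv_quad\<close> are the fibre derivatives of
  \<open>cond_lin\<close> and \<open>cond_quad\<close> along \<open>axis d 1\<close>.\<close>

definition deriv_lin where "deriv_lin c T x i d =
  (\<Sum>j\<in>UNIV. tensor_comp At c T j i d x * form_comp At c b j x)"

definition deriv_quad where "deriv_quad c T x v i d =
  (\<Sum>j\<in>UNIV. tensor_comp At c T j i d x * lower At c a x v j)
  + (\<Sum>j\<in>UNIV. \<Sum>k\<in>UNIV. tensor_comp At c T j i k x * v $ k * metric_comp At c a d j x)"

lemma berwald_condition_deriv_iff: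
  "berwald_condition_deriv At A a b \<Omega> T \<longleftrightarrow> (\<forall>c\<in>At. \<forall>x v. (x, v) \<in> V c \<longrightarrow> (\<forall>i d.
     cov_deriv (metric_comp At c a) (form_comp At c b) x i d = deriv_lin c T x i d
      + deriv_quad c T x v i d * (\<Omega> (ratio c (x, v)) / (deriv \<Omega> (ratio c (x, v)) * \<beta> c (x, v)) - \<beta> c (x, v) / \<alpha> c (x, v))
      + cond_quad c T x v i * (lower At c a x v d * (2 * \<beta> c (x, v) / (\<alpha> c (x, v))\<^sup>2)
            * (\<Omega> (ratio c (x, v)) * deriv (deriv \<Omega>) (ratio c (x, v)) / (deriv \<Omega> (ratio c (x, v)))\<^sup>2)
          - form_comp At c b d x * (- 1 / \<alpha> c (x, v) + \<Omega> (ratio c (x, v)) / (deriv \<Omega> (ratio c (x, v)) * (\<beta> c (x, v))\<^sup>2)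
            + 2 * \<Omega> (ratio c (x, v)) * deriv (deriv \<Omega>) (ratio c (x, v)) / ((deriv \<Omega> (ratio c (x, v)))\<^sup>2 * \<alpha> c (x, v))))))"
proof -
  have "c \<in> At \<Longrightarrow> (x, v) \<in> V c \<Longrightarrow> quad a (coord_vec At c x v) = \<alpha> c (x, v) \<and> lin b (coord_vec At c x v) = \<beta> c (x, v)" for c x v
    using region_img quad_coord lin_coord by blast
  then show ?thesis
    unfolding berwald_condition_deriv_def deriv_lin_def deriv_quad_def cond_quad_def
    by (simp add: Let_def nabla_form_eq Ball_def split_paired_All)
qed

lemma lower_line: "lower At c a x (v + r *\<^sub>R axis d 1) j = lower At c a x v j + r * metric_comp At c a j d x"
proof -
  have "(\<Sum>k\<in>UNIV. metric_comp At c a j k x * (r * (axis d 1 :: real ^ 'n) $ k)) = r * metric_comp At c a j d x"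
    by (simp add: axis_def if_distrib[where f = "\<lambda>x. _ * x"] cong: if_cong)
  then show ?thesis by (simp add: lower_def algebra_simps sum.distrib)
qed

lemma axis_sum:
  fixes f :: "'n \<Rightarrow> real"
  shows "(\<Sum>k\<in>UNIV. f k * (v + r *\<^sub>R axis d 1) $ k) = (\<Sum>k\<in>UNIV. f k * v $ k) + r * f d"
proof -
  have "(\<Sum>k\<in>UNIV. f k * (r * (axis d 1 :: real ^ 'n) $ k)) = r * f d"
    by (simp add: axis_def if_distrib[where f = "\<lambda>x. _ * x"] cong: if_cong)
  then show ?thesis by (simp add: algebra_simps sum.distrib)
qed

lemma alpha_lower: "\<alpha> c (x, v) = (\<Sum>d\<in>UNIV. v $ d * lower At c a x v d)"
  by (simp add: quad_form_def lower_def sum_distrib_left mult_ac)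

lemma cond_quad_alt: "cond_quad c T x v i = (\<Sum>j\<in>UNIV. (\<Sum>k\<in>UNIV. tensor_comp At c T j i k x * v $ k) * lower At c a x v j)"
  by (simp add: cond_quad_def sum_distrib_right)

lemma cond_lin_alt: "cond_lin c T x v i = (\<Sum>k\<in>UNIV. deriv_lin c T x i k * v $ k)"
  unfolding cond_lin_def deriv_lin_def by (subst sum.swap) (simp add: sum_distrib_left sum_distrib_right mult_ac)

text \<open>Provides the polynomial coefficients to which \<open>condition_derivative_line\<close>
  is applied.\<close>

lemma condition_along_line:
  assumes c: "c \<in> At" and x: "x \<in> chart_img c"
  shows "cond_lhs c x (v + r *\<^sub>R axis d 1) i = cond_lhs c x v i + r * cov_deriv (metric_comp At c a) (form_comp At c b) x i d"
    and "cond_lin c T x (v + r *\<^sub>R axis d 1) i = cond_lin c T x v i + r * deriv_lin c T x i d"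
    and "cond_quad c T x (v + r *\<^sub>R axis d 1) i = cond_quad c T x v i + r * deriv_quad c T x v i d
      + r * r * (\<Sum>j\<in>UNIV. tensor_comp At c T j i d x * metric_comp At c a j d x)"
    and "\<beta> c (x, v + r *\<^sub>R axis d 1) = \<beta> c (x, v) + r * form_comp At c b d x"
    and "\<alpha> c (x, v + r *\<^sub>R axis d 1) = \<alpha> c (x, v) + 2 * r * lower At c a x v d + r * r * metric_comp At c a d d x"
proof -
  show "cond_lhs c x (v + r *\<^sub>R axis d 1) i = cond_lhs c x v i + r * cov_deriv (metric_comp At c a) (form_comp At c b) x i d"
    using axis_sum[of "cov_deriv (metric_comp At c a) (form_comp At c b) x i" v r d]
    by (simp add: cond_lhs_def mult.commute)
  show "\<beta> c (x, v + r *\<^sub>R axis d 1) = \<beta> c (x, v) + r * form_comp At c b d x"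
    using axis_sum[of "\<lambda>i. form_comp At c b i x" v r d] by (simp add: lin_form_def)
  show "cond_lin c T x (v + r *\<^sub>R axis d 1) i = cond_lin c T x v i + r * deriv_lin c T x i d"
    using axis_sum[of "deriv_lin c T x i" v r d] by (simp add: cond_lin_alt)
  have "cond_quad c T x (v + r *\<^sub>R axis d 1) i = (\<Sum>j\<in>UNIV.
      ((\<Sum>k\<in>UNIV. tensor_comp At c T j i k x * v $ k) + r * tensor_comp At c T j i d x)
        * (lower At c a x v j + r * metric_comp At c a j d x))"
    unfolding cond_quad_alt lower_line axis_sum ..
  also have "\<dots> = cond_quad c T x v i
      + r * ((\<Sum>j\<in>UNIV. tensor_comp At c T j i d x * lower At c a x v j)
        + (\<Sum>j\<in>UNIV. (\<Sum>k\<in>UNIV. tensor_comp At c T j i k x * v $ k) * metric_comp At c a j d x))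
      + r * r * (\<Sum>j\<in>UNIV. tensor_comp At c T j i d x * metric_comp At c a j d x)"
    unfolding cond_quad_alt by (simp add: sum_distrib_left sum.distrib algebra_simps)
  also have "(\<Sum>j\<in>UNIV. tensor_comp At c T j i d x * lower At c a x v j)
        + (\<Sum>j\<in>UNIV. (\<Sum>k\<in>UNIV. tensor_comp At c T j i k x * v $ k) * metric_comp At c a j d x)
      = deriv_quad c T x v i d"
    unfolding deriv_quad_def using metric_comp_sym[OF c x] by (simp add: sum_distrib_right)
  finally show "cond_quad c T x (v + r *\<^sub>R axis d 1) i = cond_quad c T x v i + r * deriv_quad c T x v i d
      + r * r * (\<Sum>j\<in>UNIV. tensor_comp At c T j i d x * metric_comp At c a j d x)" .
  have "\<alpha> c (x, v + r *\<^sub>R axis d 1) = (\<Sum>j\<in>UNIV. (lower At c a x v j + r * metric_comp At c a j d x) * (v + r *\<^sub>R axis d 1) $ j)"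
    unfolding alpha_lower lower_line by (simp add: mult.commute)
  also have "\<dots> = (\<Sum>j\<in>UNIV. lower At c a x v j * v $ j) + r * (\<Sum>j\<in>UNIV. metric_comp At c a j d x * v $ j)
      + r * (lower At c a x v d + r * metric_comp At c a d d x)"
    unfolding axis_sum by (simp add: sum_distrib_left sum.distrib algebra_simps)
  also have "(\<Sum>j\<in>UNIV. metric_comp At c a j d x * v $ j) = lower At c a x v d"
    unfolding lower_def using metric_comp_sym[OF c x] by simp
  finally show "\<alpha> c (x, v + r *\<^sub>R axis d 1) = \<alpha> c (x, v) + 2 * r * lower At c a x v d + r * r * metric_comp At c a d d x"
    unfolding alpha_lower by (simp add: algebra_simps)
qed

text \<open>The formula region is open, so the condition holds along a short line through v in the
  fibre and may be differentiated there.\<close>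

lemma condition_imp_deriv:
  assumes "berwald_condition At A a b \<Omega> T"
  shows "berwald_condition_deriv At A a b \<Omega> T"
  unfolding berwald_condition_deriv_iff
proof (intro ballI allI impI)
  fix c x v i d assume c: "c \<in> At" and v: "(x, v) \<in> V c"
  have vU: "(x, v) \<in> U c" and nz: "\<alpha> c (x, v) \<noteq> 0" "\<beta> c (x, v) \<noteq> 0" "deriv \<Omega> (ratio c (x, v)) \<noteq> 0"
    using v by (auto simp: formula_region_iff[OF c])
  note s = ratio_mem(2)[OF c vU nz(1,2)]
  have cond: "cond_lhs c x w i = cond_lin c T x w i + cond_quad c T x w i *
       (\<Omega> (ratio c (x, w)) / (deriv \<Omega> (ratio c (x, w)) * \<beta> c (x, w)) - \<beta> c (x, w) / \<alpha> c (x, w))"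
    if "(x, w) \<in> V c" for w
    using assms c that unfolding berwald_condition_iff by blast
  show "cov_deriv (metric_comp At c a) (form_comp At c b) x i d = deriv_lin c T x i d
      + deriv_quad c T x v i d * (\<Omega> (ratio c (x, v)) / (deriv \<Omega> (ratio c (x, v)) * \<beta> c (x, v)) - \<beta> c (x, v) / \<alpha> c (x, v))
      + cond_quad c T x v i * (lower At c a x v d * (2 * \<beta> c (x, v) / (\<alpha> c (x, v))\<^sup>2)
            * (\<Omega> (ratio c (x, v)) * deriv (deriv \<Omega>) (ratio c (x, v)) / (deriv \<Omega> (ratio c (x, v)))\<^sup>2)
          - form_comp At c b d x * (- 1 / \<alpha> c (x, v) + \<Omega> (ratio c (x, v)) / (deriv \<Omega> (ratio c (x, v)) * (\<beta> c (x, v))\<^sup>2)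
            + 2 * \<Omega> (ratio c (x, v)) * deriv (deriv \<Omega>) (ratio c (x, v)) / ((deriv \<Omega> (ratio c (x, v)))\<^sup>2 * \<alpha> c (x, v))))"
  proof (rule condition_derivative_line[OF _ refl _ _ refl nz])
    show "(\<Omega> has_field_derivative deriv \<Omega> (ratio c (x, v))) (at (ratio c (x, v)))"
      by (rule smooth_on_deriv(2)[OF W(1,3) s])
    show "(deriv \<Omega> has_field_derivative deriv (deriv \<Omega>) (ratio c (x, v))) (at (ratio c (x, v)))"
      by (rule smooth_on_deriv(2)[OF W(1) smooth_on_deriv(1)[OF W(1,3)] s])
    show "eventually (\<lambda>r. cond_lhs c x v i + r * cov_deriv (metric_comp At c a) (form_comp At c b) x i d
        = cond_lin c T x v i + r * deriv_lin c T x i d + (cond_quad c T x v i + r * deriv_quad c T x v i d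
            + r * r * (\<Sum>j\<in>UNIV. tensor_comp At c T j i d x * metric_comp At c a j d x)) *
      (\<Omega> ((\<beta> c (x, v) + r * form_comp At c b d x)\<^sup>2 / (\<alpha> c (x, v) + 2 * r * lower At c a x v d + r * r * metric_comp At c a d d x)) /
        (deriv \<Omega> ((\<beta> c (x, v) + r * form_comp At c b d x)\<^sup>2 / (\<alpha> c (x, v) + 2 * r * lower At c a x v d + r * r * metric_comp At c a d d x))
          * (\<beta> c (x, v) + r * form_comp At c b d x))
       - (\<beta> c (x, v) + r * form_comp At c b d x) / (\<alpha> c (x, v) + 2 * r * lower At c a x v d + r * r * metric_comp At c a d d x))) (nhds 0)"
      using eventually_fibre_line[OF open_formula_region[OF c] v, of "axis d 1"]
    proof eventually_elim
      case (elim r)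
      from cond[OF elim] show ?case
        unfolding condition_along_line[OF c region_img[OF vU]] .
    qed
  qed
qed

lemma deriv_imp_condition:
  assumes "berwald_condition_deriv At A a b \<Omega> T"
  shows "berwald_condition At A a b \<Omega> T"
  unfolding berwald_condition_iff
proof (intro ballI allI impI)
  fix c x v i assume c: "c \<in> At" and v: "(x, v) \<in> V c"
  have vU: "(x, v) \<in> U c" and nz: "\<alpha> c (x, v) \<noteq> 0" "\<beta> c (x, v) \<noteq> 0" "deriv \<Omega> (ratio c (x, v)) \<noteq> 0"
    using v by (auto simp: formula_region_iff[OF c])
  have cond: "cov_deriv (metric_comp At c a) (form_comp At c b) x i d = deriv_lin c T x i d
      + deriv_quad c T x v i d * (\<Omega> (ratio c (x, v)) / (deriv \<Omega> (ratio c (x, v)) * \<beta> c (x, v)) - \<beta> c (x, v) / \<alpha> c (x, v))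
      + cond_quad c T x v i * (lower At c a x v d * (2 * \<beta> c (x, v) / (\<alpha> c (x, v))\<^sup>2)
            * (\<Omega> (ratio c (x, v)) * deriv (deriv \<Omega>) (ratio c (x, v)) / (deriv \<Omega> (ratio c (x, v)))\<^sup>2)
          - form_comp At c b d x * (- 1 / \<alpha> c (x, v) + \<Omega> (ratio c (x, v)) / (deriv \<Omega> (ratio c (x, v)) * (\<beta> c (x, v))\<^sup>2)
            + 2 * \<Omega> (ratio c (x, v)) * deriv (deriv \<Omega>) (ratio c (x, v)) / ((deriv \<Omega> (ratio c (x, v)))\<^sup>2 * \<alpha> c (x, v))))" for d
    using assms c v unfolding berwald_condition_deriv_iff by blast
  have "(\<Sum>d\<in>UNIV. v $ d * cov_deriv (metric_comp At c a) (form_comp At c b) x i d) = cond_lin c T x v i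
      + cond_quad c T x v i * (\<Omega> (ratio c (x, v)) / (deriv \<Omega> (ratio c (x, v)) * \<beta> c (x, v)) - \<beta> c (x, v) / \<alpha> c (x, v))"
  proof (rule condition_contract[OF cond refl nz])
    show "(\<Sum>d\<in>UNIV. v $ d * deriv_lin c T x i d) = cond_lin c T x v i"
      by (simp add: cond_lin_alt mult.commute)
    show "(\<Sum>d\<in>UNIV. v $ d * lower At c a x v d) = \<alpha> c (x, v)" by (rule alpha_lower[symmetric])
    show "(\<Sum>d\<in>UNIV. v $ d * form_comp At c b d x) = \<beta> c (x, v)" by (simp add: lin_form_def mult.commute)
    \<comment> \<open>Euler's theorem for the quadratic form \<open>cond_quad\<close>: each of the
      two product-rule terms returns the form once, the second by the symmetry of the
      metric.\<close>
    show "(\<Sum>d\<in>UNIV. v $ d * deriv_quad c T x v i d) = 2 * cond_quad c T x v i"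
    proof -
      have "(\<Sum>d\<in>UNIV. v $ d * (\<Sum>j\<in>UNIV. tensor_comp At c T j i d x * lower At c a x v j)) = cond_quad c T x v i"
        unfolding cond_quad_def by (subst sum.swap) (simp add: sum_distrib_left mult_ac)
      moreover have "(\<Sum>d\<in>UNIV. v $ d * (\<Sum>j\<in>UNIV. \<Sum>k\<in>UNIV. tensor_comp At c T j i k x * v $ k * metric_comp At c a d j x))
          = cond_quad c T x v i"
      proof -
        have "(\<Sum>d\<in>UNIV. v $ d * (\<Sum>j\<in>UNIV. \<Sum>k\<in>UNIV. tensor_comp At c T j i k x * v $ k * metric_comp At c a d j x))
          = (\<Sum>d\<in>UNIV. \<Sum>j\<in>UNIV. (\<Sum>k\<in>UNIV. tensor_comp At c T j i k x * v $ k) * (metric_comp At c a j d x * v $ d))"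
          using metric_comp_sym[OF c region_img[OF vU]]
          by (simp add: sum_distrib_left sum_distrib_right mult_ac)
        also have "\<dots> = (\<Sum>j\<in>UNIV. \<Sum>d\<in>UNIV. (\<Sum>k\<in>UNIV. tensor_comp At c T j i k x * v $ k) * (metric_comp At c a j d x * v $ d))"
          by (rule sum.swap)
        finally show ?thesis by (simp add: cond_quad_alt lower_def sum_distrib_left)
      qed
      ultimately show ?thesis by (simp add: deriv_quad_def distrib_left sum.distrib)
    qed
  qed
  then show "cond_lhs c x v i = cond_lin c T x v i + cond_quad c T x v i *
       (\<Omega> (ratio c (x, v)) / (deriv \<Omega> (ratio c (x, v)) * \<beta> c (x, v)) - \<beta> c (x, v) / \<alpha> c (x, v))"
    by (simp only: cond_lhs_def)
qed

end

theorem corollary2: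
  fixes At :: "('m::{t2_space,second_countable_topology}, 'n::finite) chart set"
    and a :: "'m \<Rightarrow> ('m, 'n) tvec \<Rightarrow> ('m, 'n) tvec \<Rightarrow> real"
    and b :: "'m \<Rightarrow> ('m, 'n) tvec \<Rightarrow> real"
    and L :: "'m \<times> ('m, 'n) tvec \<Rightarrow> real"
    and A :: "('m \<times> ('m, 'n) tvec) set"
    and \<Omega> :: "real \<Rightarrow> real" and W :: "real set"
  assumes "smooth_atlas At"
    and "pseudo_riemannian_metric At a"
    and "one_form At b"
    and "finsler_lagrangian At L A"
    and "alpha_beta_form At L a b \<Omega>"
    and "open W" and "ratio_set A a b \<subseteq> W" and "smooth_on W \<Omega>"
    and "interior {s \<in> ratio_set A a b. deriv \<Omega> s = 0} = {}"
  shows "(berwald_type At L A \<longleftrightarrow>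
           (\<exists>T. tensor12_field At T \<and> symmetric_tensor12 At T \<and> berwald_condition At A a b \<Omega> T)) \<and>
         (\<forall>T. tensor12_field At T \<longrightarrow>
           (berwald_condition At A a b \<Omega> T \<longleftrightarrow> berwald_condition_deriv At A a b \<Omega> T))"
proof -
  interpret alpha_beta_geometry At a b L A \<Omega> W
    by (intro alpha_beta_geometry.intro smooth_manifold.intro alpha_beta_geometry_axioms.intro assms)
  show ?thesis
  proof (intro conjI allI impI)
    show "berwald_type At L A \<longleftrightarrow>
        (\<exists>T. tensor12_field At T \<and> symmetric_tensor12 At T \<and> berwald_condition At A a b \<Omega> T)"
    proof
      assume "berwald_type At L A"
      then obtain T where "tensor12_field At T" "symmetric_tensor12 At T" "berwald_condition At A a b \<Omega> T"
        by (rule berwald_imp_condition)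
      then show "\<exists>T. tensor12_field At T \<and> symmetric_tensor12 At T \<and> berwald_condition At A a b \<Omega> T"
        by (intro exI conjI)
    qed (elim exE conjE, rule condition_imp_berwald)
    show "berwald_condition At A a b \<Omega> T \<longleftrightarrow> berwald_condition_deriv At A a b \<Omega> T" for T
      by (rule iffI[OF condition_imp_deriv deriv_imp_condition])
  qed
qed

end
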